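(* Let $X$ be a simplicial set and let $\mathcal{G}:(\Delta\downarrow X)^{op}\to\mathrm{Grp}$ be a group diagram. Then for all $n\geq 0$ $$\mathrm{colim}^{(\Delta\downarrow X)^{op}}_n\mathcal{G}\cong H_n(X,\mathcal{G})\cong\pi_n(\mathrm{Lan}^{Q_X^{op}}\mathcal{G}).$$
   Context: $\Delta$ is the category of finite ordinals $[n]=\{0,\dots,n\}$, $n\ge 0$, and non-decreasing maps. For a simplicial set $X:\Delta^{op}\to\mathrm{Set}$, $\Delta\downarrow X$ is the category of its singular simplices: objects are pairs $([n],x)$ with $x\in X_n$, i.e. simplicial maps $\Delta[n]\to X$; a morphism $([m],y)\to([n],x)$ is $\alpha:[m]\to[n]$ in $\Delta$ with $X(\alpha)(x)=y$. $Q_X:\Delta\downarrow X\to\Delta$ is the forgetful functor, and $\mathrm{Lan}^{Q_X^{op}}\mathcal{G}:\Delta^{op}\to\mathrm{Grp}$ is the left Kan extension of $\mathcal{G}$ along $Q_X^{op}$; it is a simplicial group, and $\pi_n$ denotes its $n$-th homotopy group. For a small category $\mathscr{C}$ and a functor (group diagram) $\mathcal{G}:\mathscr{C}\to\mathrm{Grp}$, the simplicial replacement is the simplicial group $C_*(\mathscr{C},\mathcal{G})$ with $C_n(\mathscr{C},\mathcal{G})=\star_{c_0\to\cdots\to c_n}\mathcal{G}(c_0)$ (free product over $n$-simplices of the nerve), where $d^0_n$ sends $(c_0\xrightarrow{\alpha_1}c_1\to\cdots\to c_n,x)$ to $(c_1\to\cdots\to c_n,\mathcal{G}(\alpha_1)(x))$,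 $d^i_n$ for $i>0$ takes the $i$-th face of the nerve simplex and keeps $x$, and $s^i_n$ inserts the identity of $c_i$ and keeps $x$. The non-Abelian homology groups are $\mathrm{colim}^{\mathscr{C}}_n\mathcal{G}:=\pi_n(C_*(\mathscr{C},\mathcal{G}))$, $n\ge0$. The non-Abelian homology of $X$ with coefficients in $\mathcal{G}:(\Delta\downarrow X)^{op}\to\mathrm{Grp}$ is $H_n(X,\mathcal{G}):=\mathrm{colim}^{\Delta^{op}}_n\,\mathrm{Lan}^{Q_X^{op}}\mathcal{G}$. *)

theory Defs
  imports "HOL-Algebra.Coset" "HOL-Library.FuncSet"
begin

section \<open>Small categories and functors\<close>

record ('o, 'm) cat =
  Obj :: "'o set"
  Arr :: "'m set"
  Dom :: "'m \<Rightarrow> 'o"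
  Cod :: "'m \<Rightarrow> 'o"
  Ide :: "'o \<Rightarrow> 'm"
  Comp :: "'m \<Rightarrow> 'm \<Rightarrow> 'm"

text \<open>\<open>Comp C g f\<close> is the composite ``first \<open>f\<close>, then \<open>g\<close>''.\<close>

locale category =
  fixes C :: "('o, 'm) cat"
  assumes Dom_Obj: "f \<in> Arr C \<Longrightarrow> Dom C f \<in> Obj C"
    and Cod_Obj: "f \<in> Arr C \<Longrightarrow> Cod C f \<in> Obj C"
    and Ide_Arr: "c \<in> Obj C \<Longrightarrow> Ide C c \<in> Arr C"
    and Dom_Ide: "c \<in> Obj C \<Longrightarrow> Dom C (Ide C c) = c"
    and Cod_Ide: "c \<in> Obj C \<Longrightarrow> Cod C (Ide C c) = c"
    and Comp_Arr: "\<lbrakk>f \<in> Arr C; g \<in> Arr C; Cod C f = Dom C g\<rbrakk> \<Longrightarrow> Comp C g f \<in> Arr C"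
    and Dom_Comp: "\<lbrakk>f \<in> Arr C; g \<in> Arr C; Cod C f = Dom C g\<rbrakk> \<Longrightarrow> Dom C (Comp C g f) = Dom C f"
    and Cod_Comp: "\<lbrakk>f \<in> Arr C; g \<in> Arr C; Cod C f = Dom C g\<rbrakk> \<Longrightarrow> Cod C (Comp C g f) = Cod C g"
    and Comp_Ide: "f \<in> Arr C \<Longrightarrow> Comp C f (Ide C (Dom C f)) = f"
    and Ide_Comp: "f \<in> Arr C \<Longrightarrow> Comp C (Ide C (Cod C f)) f = f"
    and Comp_assoc: "\<lbrakk>f \<in> Arr C; g \<in> Arr C; h \<in> Arr C; Cod C f = Dom C g; Cod C g = Dom C h\<rbrakk>
      \<Longrightarrow> Comp C h (Comp C g f) = Comp C (Comp C h g) f"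

definition op_cat :: "('o, 'm) cat \<Rightarrow> ('o, 'm) cat" where
  "op_cat C = \<lparr>Obj = Obj C, Arr = Arr C, Dom = Cod C, Cod = Dom C, Ide = Ide C,
     Comp = (\<lambda>g f. Comp C f g)\<rparr>"

record ('o, 'm, 'p, 'q) func =
  FObj :: "'o \<Rightarrow> 'p"
  FArr :: "'m \<Rightarrow> 'q"

locale cat_functor =
  fixes C :: "('o, 'm) cat" and D :: "('p, 'q) cat" and S :: "('o, 'm, 'p, 'q) func"
  assumes FObj_Obj: "c \<in> Obj C \<Longrightarrow> FObj S c \<in> Obj D"
    and FArr_Arr: "f \<in> Arr C \<Longrightarrow> FArr S f \<in> Arr D"
    and Dom_FArr: "f \<in> Arr C \<Longrightarrow> Dom D (FArr S f) = FObj S (Dom C f)"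
    and Cod_FArr: "f \<in> Arr C \<Longrightarrow> Cod D (FArr S f) = FObj S (Cod C f)"
    and FArr_Ide: "c \<in> Obj C \<Longrightarrow> FArr S (Ide C c) = Ide D (FObj S c)"
    and FArr_Comp: "\<lbrakk>f \<in> Arr C; g \<in> Arr C; Cod C f = Dom C g\<rbrakk>
      \<Longrightarrow> FArr S (Comp C g f) = Comp D (FArr S g) (FArr S f)"

text \<open>Functors \<open>C \<rightarrow> Set\<close>; the sets \<open>Elts X c\<close> need not be disjoint.\<close>

record ('o, 'm, 'x) set_diagram =
  Elts :: "'o \<Rightarrow> 'x set"
  Map :: "'m \<Rightarrow> 'x \<Rightarrow> 'x"

locale set_functor =
  fixes C :: "('o, 'm) cat" and X :: "('o, 'm, 'x) set_diagram"
  assumes Map_Elts: "\<lbrakk>f \<in> Arr C; x \<in> Elts X (Dom C f)\<rbrakk> \<Longrightarrow> Map X f x \<in> Elts X (Cod C f)"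
    and Map_Ide: "\<lbrakk>c \<in> Obj C; x \<in> Elts X c\<rbrakk> \<Longrightarrow> Map X (Ide C c) x = x"
    and Map_Comp: "\<lbrakk>f \<in> Arr C; g \<in> Arr C; Cod C f = Dom C g; x \<in> Elts X (Dom C f)\<rbrakk>
      \<Longrightarrow> Map X (Comp C g f) x = Map X g (Map X f x)"

text \<open>Functors \<open>C \<rightarrow> Grp\<close>.  Only the values of \<open>Act F f\<close> on the carrier are relevant.\<close>

record ('o, 'm, 'g) grp_diagram =
  Grp :: "'o \<Rightarrow> 'g monoid"
  Act :: "'m \<Rightarrow> 'g \<Rightarrow> 'g"

locale group_diagram =
  fixes C :: "('o, 'm) cat" and F :: "('o, 'm, 'g) grp_diagram"
  assumes Grp_group: "c \<in> Obj C \<Longrightarrow> group (Grp F c)"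
    and Act_hom: "f \<in> Arr C \<Longrightarrow> Act F f \<in> hom (Grp F (Dom C f)) (Grp F (Cod C f))"
    and Act_Ide: "\<lbrakk>c \<in> Obj C; x \<in> carrier (Grp F c)\<rbrakk> \<Longrightarrow> Act F (Ide C c) x = x"
    and Act_Comp: "\<lbrakk>f \<in> Arr C; g \<in> Arr C; Cod C f = Dom C g; x \<in> carrier (Grp F (Dom C f))\<rbrakk>
      \<Longrightarrow> Act F (Comp C g f) x = Act F g (Act F f x)"

definition grp_natural ::
  "('o, 'm) cat \<Rightarrow> ('o, 'm, 'g) grp_diagram \<Rightarrow> ('o, 'm, 'h) grp_diagram \<Rightarrow> ('o \<Rightarrow> 'g \<Rightarrow> 'h) \<Rightarrow> bool" where
  "grp_natural C F M \<theta> \<longleftrightarrow>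
     (\<forall>c\<in>Obj C. \<theta> c \<in> hom (Grp F c) (Grp M c)) \<and>
     (\<forall>f\<in>Arr C. \<forall>x\<in>carrier (Grp F (Dom C f)). \<theta> (Cod C f) (Act F f x) = Act M f (\<theta> (Dom C f) x))"

definition grp_pullback ::
  "('o, 'm, 'p, 'q) func \<Rightarrow> ('p, 'q, 'g) grp_diagram \<Rightarrow> ('o, 'm, 'g) grp_diagram" where
  "grp_pullback S M = \<lparr>Grp = (\<lambda>c. Grp M (FObj S c)), Act = (\<lambda>f. Act M (FArr S f))\<rparr>"


section \<open>Free products and colimits of groups\<close>

text \<open>A letter \<open>(i, x)\<close> stands for the element \<open>x\<close> of the group \<open>G i\<close>.  The group \<open>amalg I G R\<close>
  consists of the words in these letters modulo the congruence generated by the relations holding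
  in each \<open>G i\<close> and by \<open>a \<approx> b\<close> for \<open>(a, b) \<in> R\<close>.\<close>

definition letters :: "'i set \<Rightarrow> ('i \<Rightarrow> 'g monoid) \<Rightarrow> ('i \<times> 'g) set" where
  "letters I G = (SIGMA i:I. carrier (G i))"

inductive_set word_cong ::
  "'i set \<Rightarrow> ('i \<Rightarrow> 'g monoid) \<Rightarrow> (('i \<times> 'g) \<times> ('i \<times> 'g)) set \<Rightarrow> (('i \<times> 'g) list \<times> ('i \<times> 'g) list) set"
  for I G R where
  refl: "w \<in> lists (letters I G) \<Longrightarrow> (w, w) \<in> word_cong I G R"
| sym: "(v, w) \<in> word_cong I G R \<Longrightarrow> (w, v) \<in> word_cong I G R"
| trans: "\<lbrakk>(u, v) \<in> word_cong I G R; (v, w) \<in> word_cong I G R\<rbrakk> \<Longrightarrow> (u, w) \<in> word_cong I G R"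
| unit: "\<lbrakk>u \<in> lists (letters I G); v \<in> lists (letters I G); (i, \<one>\<^bsub>G i\<^esub>) \<in> letters I G\<rbrakk>
    \<Longrightarrow> (u @ [(i, \<one>\<^bsub>G i\<^esub>)] @ v, u @ v) \<in> word_cong I G R"
| mult: "\<lbrakk>u \<in> lists (letters I G); v \<in> lists (letters I G); (i, x) \<in> letters I G; (i, y) \<in> letters I G;
      (i, x \<otimes>\<^bsub>G i\<^esub> y) \<in> letters I G\<rbrakk>
    \<Longrightarrow> (u @ [(i, x), (i, y)] @ v, u @ [(i, x \<otimes>\<^bsub>G i\<^esub> y)] @ v) \<in> word_cong I G R"
| ident: "\<lbrakk>u \<in> lists (letters I G); v \<in> lists (letters I G); a \<in> letters I G; b \<in> letters I G; (a, b) \<in> R\<rbrakk>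
    \<Longrightarrow> (u @ [a] @ v, u @ [b] @ v) \<in> word_cong I G R"

definition amalg ::
  "'i set \<Rightarrow> ('i \<Rightarrow> 'g monoid) \<Rightarrow> (('i \<times> 'g) \<times> ('i \<times> 'g)) set \<Rightarrow> ('i \<times> 'g) list set monoid" where
  "amalg I G R = \<lparr>carrier = lists (letters I G) // word_cong I G R,
     mult = (\<lambda>K L. word_cong I G R `` {v @ w |v w. v \<in> K \<and> w \<in> L}),
     one = word_cong I G R `` {[]}\<rparr>"

text \<open>The map into \<open>amalg I G R\<close> induced by a map \<open>f\<close> of letters.\<close>

definition amalg_map ::
  "'i set \<Rightarrow> ('i \<Rightarrow> 'g monoid) \<Rightarrow> (('i \<times> 'g) \<times> ('i \<times> 'g)) set \<Rightarrow>
   ('j \<times> 'h \<Rightarrow> 'i \<times> 'g) \<Rightarrow> ('j \<times> 'h) list set \<Rightarrow> ('i \<times> 'g) list set" where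
  "amalg_map I G R f K = word_cong I G R `` (map f ` K)"

definition free_prod :: "'i set \<Rightarrow> ('i \<Rightarrow> 'g monoid) \<Rightarrow> ('i \<times> 'g) list set monoid" where
  "free_prod I G = amalg I G {}"

definition free_prod_map ::
  "'i set \<Rightarrow> ('i \<Rightarrow> 'g monoid) \<Rightarrow> ('j \<times> 'h \<Rightarrow> 'i \<times> 'g) \<Rightarrow> ('j \<times> 'h) list set \<Rightarrow> ('i \<times> 'g) list set" where
  "free_prod_map I G = amalg_map I G {}"

definition colim_rel :: "('o, 'm) cat \<Rightarrow> ('o, 'm, 'g) grp_diagram \<Rightarrow> (('o \<times> 'g) \<times> ('o \<times> 'g)) set" where
  "colim_rel C F = {((Dom C f, x), (Cod C f, Act F f x)) |f x. f \<in> Arr C \<and> x \<in> carrier (Grp F (Dom C f))}"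

definition grp_colim :: "('o, 'm) cat \<Rightarrow> ('o, 'm, 'g) grp_diagram \<Rightarrow> ('o \<times> 'g) list set monoid" where
  "grp_colim C F = amalg (Obj C) (Grp F) (colim_rel C F)"


section \<open>Left Kan extensions\<close>

text \<open>The comma category \<open>S \<down> d\<close>; an arrow is a triple (source, underlying arrow of \<open>C\<close>, target).\<close>

definition comma ::
  "('o, 'm) cat \<Rightarrow> ('p, 'q) cat \<Rightarrow> ('o, 'm, 'p, 'q) func \<Rightarrow> 'p \<Rightarrow>
   ('o \<times> 'q, ('o \<times> 'q) \<times> 'm \<times> ('o \<times> 'q)) cat" where
  "comma C D S d = \<lparr>
     Obj = {(c, \<phi>). c \<in> Obj C \<and> \<phi> \<in> Arr D \<and> Dom D \<phi> = FObj S c \<and> Cod D \<phi> = d},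
     Arr = {((c, \<phi>), f, (c', \<phi>')).
       f \<in> Arr C \<and> Dom C f = c \<and> Cod C f = c' \<and>
       \<phi> \<in> Arr D \<and> Dom D \<phi> = FObj S c \<and> Cod D \<phi> = d \<and>
       \<phi>' \<in> Arr D \<and> Dom D \<phi>' = FObj S c' \<and> Cod D \<phi>' = d \<and>
       Comp D \<phi>' (FArr S f) = \<phi>},
     Dom = (\<lambda>(a, f, b). a), Cod = (\<lambda>(a, f, b). b),
     Ide = (\<lambda>(c, \<phi>). ((c, \<phi>), Ide C c, (c, \<phi>))),
     Comp = (\<lambda>(b', g, c) (a, f, b). (a, Comp C g f, c))\<rparr>"

definition comma_diagram :: "('o, 'm, 'g) grp_diagram \<Rightarrow> ('o \<times> 'q, ('o \<times> 'q) \<times> 'm \<times> ('o \<times> 'q), 'g) grp_diagram" where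
  "comma_diagram F = \<lparr>Grp = (\<lambda>(c, \<phi>). Grp F c), Act = (\<lambda>(a, f, b). Act F f)\<rparr>"

text \<open>\<open>Lan\<^sup>S F\<close> at \<open>d\<close> is the colimit of \<open>F\<close> over \<open>S \<down> d\<close>.  See \<open>kan_data.lan_universal\<close>
  below for the universal property.\<close>

definition lan ::
  "('o, 'm) cat \<Rightarrow> ('p, 'q) cat \<Rightarrow> ('o, 'm, 'p, 'q) func \<Rightarrow> ('o, 'm, 'g) grp_diagram \<Rightarrow>
   ('p, 'q, (('o \<times> 'q) \<times> 'g) list set) grp_diagram" where
  "lan C D S F = \<lparr>
     Grp = (\<lambda>d. grp_colim (comma C D S d) (comma_diagram F)),
     Act = (\<lambda>\<beta>. amalg_map (Obj (comma C D S (Cod D \<beta>))) (Grp (comma_diagram F))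
        (colim_rel (comma C D S (Cod D \<beta>)) (comma_diagram F))
        (\<lambda>((c, \<phi>), x). ((c, Comp D \<beta> \<phi>), x)))\<rparr>"

definition lan_unit ::
  "('o, 'm) cat \<Rightarrow> ('p, 'q) cat \<Rightarrow> ('o, 'm, 'p, 'q) func \<Rightarrow> ('o, 'm, 'g) grp_diagram \<Rightarrow>
   'o \<Rightarrow> 'g \<Rightarrow> (('o \<times> 'q) \<times> 'g) list set" where
  "lan_unit C D S F c x =
     word_cong (Obj (comma C D S (FObj S c))) (Grp (comma_diagram F))
       (colim_rel (comma C D S (FObj S c)) (comma_diagram F)) `` {[((c, Ide D (FObj S c)), x)]}"


section \<open>Simplicial sets\<close>

text \<open>The object \<open>n\<close> of \<open>delta\<close> is the ordinal \<open>{..n}\<close>.  Arrows are triples (source, map, target),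
  the map being extensional on the source.\<close>

type_synonym delta_arr = "nat \<times> (nat \<Rightarrow> nat) \<times> nat"

definition delta :: "(nat, delta_arr) cat" where
  "delta = \<lparr>
     Obj = UNIV,
     Arr = {(m, f, n). f \<in> {..m} \<rightarrow>\<^sub>E {..n} \<and> mono_on {..m} f},
     Dom = (\<lambda>(m, f, n). m), Cod = (\<lambda>(m, f, n). n),
     Ide = (\<lambda>n. (n, (\<lambda>k\<in>{..n}. k), n)),
     Comp = (\<lambda>(n', g, p) (m, f, n). (m, compose {..m} g f, p))\<rparr>"

definition coface :: "nat \<Rightarrow> nat \<Rightarrow> delta_arr" where
  "coface n i = (n - 1, (\<lambda>k\<in>{..n - 1}. if k < i then k else Suc k), n)"

definition codegen :: "nat \<Rightarrow> nat \<Rightarrow> delta_arr" where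
  "codegen n i = (Suc n, (\<lambda>k\<in>{..Suc n}. if k \<le> i then k else k - 1), n)"

type_synonym 'x sset = "(nat, delta_arr, 'x) set_diagram"

abbreviation simplicial_set :: "'x sset \<Rightarrow> bool" where
  "simplicial_set X \<equiv> set_functor (op_cat delta) X"

text \<open>The category \<open>\<Delta> \<down> X\<close> of singular simplices.\<close>

type_synonym 'x simp_arr = "(nat \<times> 'x) \<times> delta_arr \<times> (nat \<times> 'x)"

definition simplices :: "'x sset \<Rightarrow> (nat \<times> 'x, 'x simp_arr) cat" where
  "simplices X = \<lparr>
     Obj = {(n, x). x \<in> Elts X n},
     Arr = {((m, y), \<alpha>, (n, x)). \<alpha> \<in> Arr delta \<and> Dom delta \<alpha> = m \<and> Cod delta \<alpha> = n \<and>
       x \<in> Elts X n \<and> y \<in> Elts X m \<and> Map X \<alpha> x = y},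
     Dom = (\<lambda>(a, \<alpha>, b). a), Cod = (\<lambda>(a, \<alpha>, b). b),
     Ide = (\<lambda>(n, x). ((n, x), Ide delta n, (n, x))),
     Comp = (\<lambda>(b', \<beta>, c) (a, \<alpha>, b). (a, Comp delta \<beta> \<alpha>, c))\<rparr>"

text \<open>The same pair of maps is \<open>Q\<^sub>X\<close> and its opposite functor.\<close>

definition Q_functor :: "(nat \<times> 'x, 'x simp_arr, nat, delta_arr) func" where
  "Q_functor = \<lparr>FObj = (\<lambda>(n, x). n), FArr = (\<lambda>(a, \<alpha>, b). \<alpha>)\<rparr>"

definition lan_Q ::
  "'x sset \<Rightarrow> (nat \<times> 'x, 'x simp_arr, 'g) grp_diagram \<Rightarrow>
   (nat, delta_arr, (((nat \<times> 'x) \<times> delta_arr) \<times> 'g) list set) grp_diagram" where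
  "lan_Q X F = lan (op_cat (simplices X)) (op_cat delta) Q_functor F"


section \<open>Simplicial groups and their homotopy groups\<close>

record 'g sgroup =
  Level :: "nat \<Rightarrow> 'g monoid"
  Face :: "nat \<Rightarrow> nat \<Rightarrow> 'g \<Rightarrow> 'g"
  Degen :: "nat \<Rightarrow> nat \<Rightarrow> 'g \<Rightarrow> 'g"

text \<open>\<open>Face G n i\<close> goes from level \<open>n > 0\<close> to level \<open>n - 1\<close>, \<open>Degen G n i\<close> from level \<open>n\<close> to
  level \<open>n + 1\<close>.\<close>

locale simplicial_group =
  fixes G :: "'g sgroup"
  assumes Level_group: "group (Level G n)"
    and Face_hom: "i \<le> Suc n \<Longrightarrow> Face G (Suc n) i \<in> hom (Level G (Suc n)) (Level G n)"
    and Degen_hom: "i \<le> n \<Longrightarrow> Degen G n i \<in> hom (Level G n) (Level G (Suc n))"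
    and Face_Face: "\<lbrakk>i < j; j \<le> Suc (Suc n); x \<in> carrier (Level G (Suc (Suc n)))\<rbrakk>
      \<Longrightarrow> Face G (Suc n) i (Face G (Suc (Suc n)) j x) = Face G (Suc n) (j - 1) (Face G (Suc (Suc n)) i x)"
    and Face_Degen_less: "\<lbrakk>i < j; j \<le> Suc n; x \<in> carrier (Level G (Suc n))\<rbrakk>
      \<Longrightarrow> Face G (Suc (Suc n)) i (Degen G (Suc n) j x) = Degen G n (j - 1) (Face G (Suc n) i x)"
    and Face_Degen_eq: "\<lbrakk>i \<in> {j, Suc j}; j \<le> n; x \<in> carrier (Level G n)\<rbrakk>
      \<Longrightarrow> Face G (Suc n) i (Degen G n j x) = x"
    and Face_Degen_greater: "\<lbrakk>Suc j < i; i \<le> Suc (Suc n); x \<in> carrier (Level G (Suc n))\<rbrakk>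
      \<Longrightarrow> Face G (Suc (Suc n)) i (Degen G (Suc n) j x) = Degen G n j (Face G (Suc n) (i - 1) x)"
    and Degen_Degen: "\<lbrakk>i \<le> j; j \<le> n; x \<in> carrier (Level G n)\<rbrakk>
      \<Longrightarrow> Degen G (Suc n) i (Degen G n j x) = Degen G (Suc n) (Suc j) (Degen G n i x)"

definition sgroup_of :: "(nat, delta_arr, 'g) grp_diagram \<Rightarrow> 'g sgroup" where
  "sgroup_of F = \<lparr>Level = Grp F,
     Face = (\<lambda>n i. Act F (coface n i)),
     Degen = (\<lambda>n i. Act F (codegen n i))\<rparr>"

text \<open>The Moore complex: \<open>moore G n\<close> is the intersection of the kernels of \<open>d\<^sub>i\<close>, \<open>i < n\<close>, with
  differential \<open>d\<^sub>n\<close>.  All faces of an element of \<open>cycles G n\<close> are trivial (no condition for \<open>n = 0\<close>).\<close>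

definition moore :: "'g sgroup \<Rightarrow> nat \<Rightarrow> 'g set" where
  "moore G n = {x \<in> carrier (Level G n). \<forall>i<n. Face G n i x = \<one>\<^bsub>Level G (n - 1)\<^esub>}"

definition cycles :: "'g sgroup \<Rightarrow> nat \<Rightarrow> 'g set" where
  "cycles G n = {x \<in> moore G n. n > 0 \<longrightarrow> Face G n n x = \<one>\<^bsub>Level G (n - 1)\<^esub>}"

definition boundaries :: "'g sgroup \<Rightarrow> nat \<Rightarrow> 'g set" where
  "boundaries G n = Face G (Suc n) (Suc n) ` moore G (Suc n)"

definition homotopy_group :: "nat \<Rightarrow> 'g sgroup \<Rightarrow> 'g set monoid" where
  "homotopy_group n G = (Level G n)\<lparr>carrier := cycles G n\<rparr> Mod boundaries G n"


section \<open>The simplicial replacement and non-Abelian homology\<close>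

text \<open>The \<open>n\<close>-simplex \<open>c\<^sub>0 \<rightarrow> \<dots> \<rightarrow> c\<^sub>n\<close> of the nerve is the pair of \<open>c\<^sub>0\<close> and the list
  \<open>[\<alpha>\<^sub>1, \<dots>, \<alpha>\<^sub>n]\<close>, so \<open>as ! (i - 1)\<close> is \<open>\<alpha>\<^sub>i\<close>.\<close>

definition nerve_vertex :: "('o, 'm) cat \<Rightarrow> 'o \<times> 'm list \<Rightarrow> nat \<Rightarrow> 'o" where
  "nerve_vertex C = (\<lambda>(c, as) i. if i = 0 then c else Cod C (as ! (i - 1)))"

definition nerve :: "('o, 'm) cat \<Rightarrow> nat \<Rightarrow> ('o \<times> 'm list) set" where
  "nerve C n = {(c, as). c \<in> Obj C \<and> set as \<subseteq> Arr C \<and> length as = n \<and>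
     (\<forall>i<n. Dom C (as ! i) = nerve_vertex C (c, as) i)}"

definition nerve_face :: "('o, 'm) cat \<Rightarrow> nat \<Rightarrow> 'o \<times> 'm list \<Rightarrow> 'o \<times> 'm list" where
  "nerve_face C i = (\<lambda>(c, as).
     if i = 0 then (Cod C (hd as), tl as)
     else if i = length as then (c, butlast as)
     else (c, take (i - 1) as @ [Comp C (as ! i) (as ! (i - 1))] @ drop (Suc i) as))"

definition nerve_degen :: "('o, 'm) cat \<Rightarrow> nat \<Rightarrow> 'o \<times> 'm list \<Rightarrow> 'o \<times> 'm list" where
  "nerve_degen C i = (\<lambda>(c, as). (c, take i as @ [Ide C (nerve_vertex C (c, as) i)] @ drop i as))"

definition simplicial_replacement ::
  "('o, 'm) cat \<Rightarrow> ('o, 'm, 'g) grp_diagram \<Rightarrow> (('o \<times> 'm list) \<times> 'g) list set sgroup" where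
  "simplicial_replacement C F = \<lparr>
     Level = (\<lambda>n. free_prod (nerve C n) (\<lambda>(c, as). Grp F c)),
     Face = (\<lambda>n i. free_prod_map (nerve C (n - 1)) (\<lambda>(c, as). Grp F c)
        (\<lambda>((c, as), x). (nerve_face C i (c, as), if i = 0 then Act F (hd as) x else x))),
     Degen = (\<lambda>n i. free_prod_map (nerve C (Suc n)) (\<lambda>(c, as). Grp F c)
        (\<lambda>((c, as), x). (nerve_degen C i (c, as), x)))\<rparr>"

definition colim_n ::
  "nat \<Rightarrow> ('o, 'm) cat \<Rightarrow> ('o, 'm, 'g) grp_diagram \<Rightarrow> (('o \<times> 'm list) \<times> 'g) list set set monoid" where
  "colim_n n C F = homotopy_group n (simplicial_replacement C F)"

definition sset_homology ::
  "nat \<Rightarrow> 'x sset \<Rightarrow> (nat \<times> 'x, 'x simp_arr, 'g) grp_diagram \<Rightarrow>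
   ((nat \<times> delta_arr list) \<times> (((nat \<times> 'x) \<times> delta_arr) \<times> 'g) list set) list set set monoid" where
  "sset_homology n X F = colim_n n (op_cat delta) (lan_Q X F)"


section \<open>Words and free products: basic facts\<close>

lemma word_cong_lists:
  "(v, w) \<in> word_cong I G R \<Longrightarrow> v \<in> lists (letters I G) \<and> w \<in> lists (letters I G)"
  by (induction rule: word_cong.induct) auto

lemma equiv_word_cong: "equiv (lists (letters I G)) (word_cong I G R)"
proof (rule equivI)
  show "word_cong I G R \<subseteq> lists (letters I G) \<times> lists (letters I G)"
    by (auto dest!: word_cong_lists simp del: in_lists_conv_set)
  show "refl_on (lists (letters I G)) (word_cong I G R)"
    by (auto intro!: refl_onI word_cong.refl)
  show "sym (word_cong I G R)" by (auto intro!: symI word_cong.sym)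
  show "trans (word_cong I G R)" by (auto intro: transI word_cong.trans)
qed

lemma word_cong_context:
  assumes "(v, w) \<in> word_cong I G R" "a \<in> lists (letters I G)" "b \<in> lists (letters I G)"
  shows "(a @ v @ b, a @ w @ b) \<in> word_cong I G R"
  using assms
proof (induction rule: word_cong.induct)
  case (refl w)
  then show ?case by (intro word_cong.refl) auto
next
  case (sym v w)
  then show ?case by (blast intro: word_cong.sym)
next
  case (trans u v w)
  then show ?case by (blast intro: word_cong.trans)
next
  case (unit u v i)
  then show ?case using word_cong.unit[of "a @ u" I G "v @ b" i R] by auto
next
  case (mult u v i x y)
  then show ?case using word_cong.mult[of "a @ u" I G "v @ b" i x y R] by auto
next
  case (ident u v x y)
  then show ?case using word_cong.ident[of "a @ u" I G "v @ b" x y R] by auto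
qed

lemma word_cong_append:
  assumes "(v, w) \<in> word_cong I G R" "(v', w') \<in> word_cong I G R"
  shows "(v @ v', w @ w') \<in> word_cong I G R"
  using word_cong_context[OF assms(1), of "[]" v'] word_cong_context[OF assms(2), of w "[]"]
    word_cong_lists[OF assms(1)] word_cong_lists[OF assms(2)]
  by (auto intro: word_cong.trans)

lemma word_class_eq_iff:
  assumes "v \<in> lists (letters I G)" "w \<in> lists (letters I G)"
  shows "word_cong I G R `` {v} = word_cong I G R `` {w} \<longleftrightarrow> (v, w) \<in> word_cong I G R"
  using equiv_class_eq_iff[OF equiv_word_cong] assms by blast

lemma amalg_classE:
  assumes "K \<in> carrier (amalg I G R)"
  obtains w where "w \<in> lists (letters I G)" "K = word_cong I G R `` {w}"
  using assms by (auto simp: amalg_def elim!: quotientE)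

lemma amalg_class_closed:
  "w \<in> lists (letters I G) \<Longrightarrow> word_cong I G R `` {w} \<in> carrier (amalg I G R)"
  by (auto simp: amalg_def intro: quotientI)

lemma Image_word_cong:
  assumes "w \<in> A" "\<And>v. v \<in> A \<Longrightarrow> (w, v) \<in> word_cong I G R"
  shows "word_cong I G R `` A = word_cong I G R `` {w}"
  using assms by (auto intro: word_cong.trans)

lemma amalg_mult_class:
  assumes "v \<in> lists (letters I G)" "w \<in> lists (letters I G)"
  shows "word_cong I G R `` {v} \<otimes>\<^bsub>amalg I G R\<^esub> word_cong I G R `` {w} = word_cong I G R `` {v @ w}"
  unfolding amalg_def monoid.simps
proof (rule Image_word_cong)
  have "v \<in> word_cong I G R `` {v}" "w \<in> word_cong I G R `` {w}"
    using assms by (auto intro: word_cong.refl)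
  then show "v @ w \<in> {x @ y |x y. x \<in> word_cong I G R `` {v} \<and> y \<in> word_cong I G R `` {w}}" by blast
qed (auto intro: word_cong_append)

lemma one_amalg: "\<one>\<^bsub>amalg I G R\<^esub> = word_cong I G R `` {[]}"
  by (simp add: amalg_def)

lemma amalg_left_inverse:
  assumes G: "\<And>i. i \<in> I \<Longrightarrow> group (G i)" and "w \<in> lists (letters I G)"
  shows "\<exists>v \<in> lists (letters I G). (v @ w, []) \<in> word_cong I G R"
  using assms(2)
proof (induction w)
  case Nil
  show ?case by (rule bexI[of _ "[]"]) (auto intro: word_cong.refl)
next
  case (Cons a w)
  obtain i x where a: "a = (i, x)" by force
  have w: "w \<in> lists (letters I G)" using Cons.hyps by simp
  have i: "i \<in> I" and x: "x \<in> carrier (G i)" using Cons.hyps a by (auto simp: letters_def)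
  interpret Gi: group "G i" by (rule G[OF i])
  from Cons.IH obtain v where v: "v \<in> lists (letters I G)" "(v @ w, []) \<in> word_cong I G R"
    by blast
  have "(v @ [(i, inv\<^bsub>G i\<^esub> x), (i, x)] @ w, v @ [(i, inv\<^bsub>G i\<^esub> x \<otimes>\<^bsub>G i\<^esub> x)] @ w) \<in> word_cong I G R"
    using v w i x by (intro word_cong.mult) (auto simp: letters_def)
  moreover have "(v @ [(i, inv\<^bsub>G i\<^esub> x \<otimes>\<^bsub>G i\<^esub> x)] @ w, v @ w) \<in> word_cong I G R"
    using word_cong.unit[of v I G w i R] v w i x by (auto simp: letters_def)
  ultimately have "((v @ [(i, inv\<^bsub>G i\<^esub> x)]) @ a # w, []) \<in> word_cong I G R"
    using v a by (auto intro: word_cong.trans)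
  moreover have "v @ [(i, inv\<^bsub>G i\<^esub> x)] \<in> lists (letters I G)"
    using v i x by (auto simp: letters_def)
  ultimately show ?case by blast
qed

lemma group_amalg:
  assumes "\<And>i. i \<in> I \<Longrightarrow> group (G i)"
  shows "group (amalg I G R)"
proof (rule groupI)
  show "\<one>\<^bsub>amalg I G R\<^esub> \<in> carrier (amalg I G R)"
    by (auto simp: one_amalg intro: amalg_class_closed)
next
  fix K L assume "K \<in> carrier (amalg I G R)" "L \<in> carrier (amalg I G R)"
  then show "K \<otimes>\<^bsub>amalg I G R\<^esub> L \<in> carrier (amalg I G R)"
    by (elim amalg_classE) (simp add: amalg_mult_class amalg_class_closed)
next
  fix K L M assume "K \<in> carrier (amalg I G R)" "L \<in> carrier (amalg I G R)" "M \<in> carrier (amalg I G R)"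
  then show "K \<otimes>\<^bsub>amalg I G R\<^esub> L \<otimes>\<^bsub>amalg I G R\<^esub> M = K \<otimes>\<^bsub>amalg I G R\<^esub> (L \<otimes>\<^bsub>amalg I G R\<^esub> M)"
    by (elim amalg_classE) (simp add: amalg_mult_class)
next
  fix K assume "K \<in> carrier (amalg I G R)"
  then show "\<one>\<^bsub>amalg I G R\<^esub> \<otimes>\<^bsub>amalg I G R\<^esub> K = K"
    by (elim amalg_classE) (simp add: one_amalg amalg_mult_class)
next
  fix K assume "K \<in> carrier (amalg I G R)"
  then obtain w where w: "w \<in> lists (letters I G)" "K = word_cong I G R `` {w}"
    by (rule amalg_classE)
  obtain v where v: "v \<in> lists (letters I G)" "(v @ w, []) \<in> word_cong I G R"
    using amalg_left_inverse[OF assms w(1)] by blast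
  have "word_cong I G R `` {v} \<otimes>\<^bsub>amalg I G R\<^esub> K = \<one>\<^bsub>amalg I G R\<^esub>"
    unfolding w(2) amalg_mult_class[OF v(1) w(1)] one_amalg
    using v w(1) by (subst word_class_eq_iff) auto
  then show "\<exists>L\<in>carrier (amalg I G R). L \<otimes>\<^bsub>amalg I G R\<^esub> K = \<one>\<^bsub>amalg I G R\<^esub>"
    using amalg_class_closed[OF v(1)] by blast
qed

text \<open>Evaluation of words, and the universal property of \<open>amalg\<close>.\<close>

definition word_eval :: "('h, 'b) monoid_scheme \<Rightarrow> ('i \<times> 'g \<Rightarrow> 'h) \<Rightarrow> ('i \<times> 'g) list \<Rightarrow> 'h" where
  "word_eval H h w = foldr (\<lambda>a y. h a \<otimes>\<^bsub>H\<^esub> y) w \<one>\<^bsub>H\<^esub>"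

locale amalg_target = group H for H (structure) +
  fixes I :: "'i set" and G :: "'i \<Rightarrow> 'g monoid" and R and h :: "'i \<times> 'g \<Rightarrow> 'a"
  assumes h_hom: "i \<in> I \<Longrightarrow> (\<lambda>x. h (i, x)) \<in> hom (G i) H"
    and h_R: "\<lbrakk>(a, b) \<in> R; a \<in> letters I G; b \<in> letters I G\<rbrakk> \<Longrightarrow> h a = h b"
    and G_group: "i \<in> I \<Longrightarrow> group (G i)"
begin

lemma h_closed: "a \<in> letters I G \<Longrightarrow> h a \<in> carrier H"
  using h_hom by (auto simp: letters_def hom_def Pi_def)

lemma word_eval_closed: "w \<in> lists (letters I G) \<Longrightarrow> word_eval H h w \<in> carrier H"
  by (induction w) (auto simp: word_eval_def h_closed)

lemma word_eval_append:
  "\<lbrakk>v \<in> lists (letters I G); w \<in> lists (letters I G)\<rbrakk>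
    \<Longrightarrow> word_eval H h (v @ w) = word_eval H h v \<otimes> word_eval H h w"
  using word_eval_closed[of w]
  by (induction v) (auto simp: word_eval_def h_closed m_assoc word_eval_closed[unfolded word_eval_def])

lemma word_eval_singleton: "a \<in> letters I G \<Longrightarrow> word_eval H h [a] = h a"
  by (simp add: word_eval_def h_closed)

lemma word_eval_cong: "(v, w) \<in> word_cong I G R \<Longrightarrow> word_eval H h v = word_eval H h w"
proof (induction rule: word_cong.induct)
  case (unit u v i)
  then have i: "i \<in> I" by (auto simp: letters_def)
  have "h (i, \<one>\<^bsub>G i\<^esub>) = \<one>"
    using hom_one[OF h_hom[OF i] G_group[OF i] is_group] .
  with unit show ?case
    by (simp add: word_eval_append word_eval_closed word_eval_singleton in_listsI del: append_Cons)
next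
  case (mult u v i x y)
  then have i: "i \<in> I" and "x \<in> carrier (G i)" "y \<in> carrier (G i)" by (auto simp: letters_def)
  then have "h (i, x \<otimes>\<^bsub>G i\<^esub> y) = h (i, x) \<otimes> h (i, y)"
    using hom_mult[OF h_hom[OF i]] by auto
  moreover have "word_eval H h [(i, x), (i, y)] = h (i, x) \<otimes> h (i, y)"
    using mult by (simp add: word_eval_def h_closed)
  ultimately show ?case using mult
    by (simp add: word_eval_append word_eval_singleton in_listsI del: append_Cons)
next
  case (ident u v a b)
  then show ?case using h_R[of a b]
    by (simp add: word_eval_append word_eval_singleton in_listsI del: append_Cons)
qed auto

definition amalg_lift :: "('i \<times> 'g) list set \<Rightarrow> 'a" where
  "amalg_lift K = word_eval H h (SOME w. w \<in> K)"

lemma amalg_lift_class: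
  assumes "w \<in> lists (letters I G)"
  shows "amalg_lift (word_cong I G R `` {w}) = word_eval H h w"
proof -
  have "w \<in> word_cong I G R `` {w}" using assms by (auto intro: word_cong.refl)
  then have "(SOME v. v \<in> word_cong I G R `` {w}) \<in> word_cong I G R `` {w}" by (rule someI)
  then show ?thesis using word_eval_cong by (auto simp: amalg_lift_def)
qed

lemma amalg_lift_hom: "amalg_lift \<in> hom (amalg I G R) H"
proof (rule homI)
  fix K assume "K \<in> carrier (amalg I G R)"
  then show "amalg_lift K \<in> carrier H"
    by (elim amalg_classE) (simp add: amalg_lift_class word_eval_closed)
next
  fix K L assume "K \<in> carrier (amalg I G R)" "L \<in> carrier (amalg I G R)"
  then show "amalg_lift (K \<otimes>\<^bsub>amalg I G R\<^esub> L) = amalg_lift K \<otimes> amalg_lift L"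
    by (elim amalg_classE) (simp add: amalg_mult_class amalg_lift_class word_eval_append)
qed

end

lemma hom_amalg_unique:
  assumes H: "group H" and G: "\<And>i. i \<in> I \<Longrightarrow> group (G i)"
    and f: "f \<in> hom (amalg I G R) H" and g: "g \<in> hom (amalg I G R) H"
    and eq: "\<And>a. a \<in> letters I G \<Longrightarrow> f (word_cong I G R `` {[a]}) = g (word_cong I G R `` {[a]})"
    and K: "K \<in> carrier (amalg I G R)"
  shows "f K = g K"
proof -
  have "f (word_cong I G R `` {w}) = g (word_cong I G R `` {w})" if "w \<in> lists (letters I G)" for w
    using that
  proof (induction w)
    case Nil
    show ?case
      using hom_one[OF f group_amalg[OF G] H] hom_one[OF g group_amalg[OF G] H] by (simp add: one_amalg)
  next
    case (Cons a w)
    then have a: "[a] \<in> lists (letters I G)" and w: "w \<in> lists (letters I G)" by auto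
    have "k (word_cong I G R `` {a # w}) = k (word_cong I G R `` {[a]}) \<otimes>\<^bsub>H\<^esub> k (word_cong I G R `` {w})"
      if "k \<in> hom (amalg I G R) H" for k
      using hom_mult[OF that amalg_class_closed[OF a] amalg_class_closed[OF w]] amalg_mult_class[OF a w]
      by simp
    note step = this
    have "f (word_cong I G R `` {[a]}) = g (word_cong I G R `` {[a]})" using Cons.hyps eq by blast
    then show ?case using step[OF f] step[OF g] Cons.IH by simp
  qed
  then show ?thesis using K by (elim amalg_classE) auto
qed

text \<open>Maps of letters that respect the defining relations.\<close>

locale letter_map =
  fixes J :: "'j set" and H :: "'j \<Rightarrow> 'h monoid" and R'
    and I :: "'i set" and G :: "'i \<Rightarrow> 'g monoid" and R
    and f :: "'j \<times> 'h \<Rightarrow> 'i \<times> 'g" and p :: "'j \<Rightarrow> 'i" and q :: "'j \<Rightarrow> 'h \<Rightarrow> 'g"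
  assumes f_eq: "f (j, x) = (p j, q j x)"
    and p_in: "j \<in> J \<Longrightarrow> p j \<in> I"
    and q_hom: "j \<in> J \<Longrightarrow> q j \<in> hom (H j) (G (p j))"
    and f_rel: "\<lbrakk>(a, b) \<in> R'; a \<in> letters J H; b \<in> letters J H\<rbrakk> \<Longrightarrow> (f a, f b) \<in> R"
    and H_group: "j \<in> J \<Longrightarrow> group (H j)"
    and G_group: "i \<in> I \<Longrightarrow> group (G i)"
begin

lemma f_letters: "a \<in> letters J H \<Longrightarrow> f a \<in> letters I G"
  using p_in q_hom by (auto simp: letters_def f_eq hom_def Pi_def)

lemma map_f_lists: "w \<in> lists (letters J H) \<Longrightarrow> map f w \<in> lists (letters I G)"
  using f_letters by auto

lemma map_f_cong: "(v, w) \<in> word_cong J H R' \<Longrightarrow> (map f v, map f w) \<in> word_cong I G R"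
proof (induction rule: word_cong.induct)
  case (refl w)
  then show ?case by (intro word_cong.refl map_f_lists)
next
  case (unit u v j)
  then have j: "j \<in> J" by (auto simp: letters_def)
  have "q j \<one>\<^bsub>H j\<^esub> = \<one>\<^bsub>G (p j)\<^esub>"
    using hom_one[OF q_hom[OF j] H_group[OF j] G_group[OF p_in[OF j]]] .
  then show ?case
    using unit word_cong.unit[OF map_f_lists[of u] map_f_lists[of v], of "p j" R] f_letters[of "(j, \<one>\<^bsub>H j\<^esub>)"]
    by (simp add: f_eq)
next
  case (mult u v j x y)
  then have j: "j \<in> J" and "x \<in> carrier (H j)" "y \<in> carrier (H j)" by (auto simp: letters_def)
  then have "q j (x \<otimes>\<^bsub>H j\<^esub> y) = q j x \<otimes>\<^bsub>G (p j)\<^esub> q j y" using hom_mult[OF q_hom[OF j]] by auto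
  then show ?case
    using mult word_cong.mult[OF map_f_lists[of u] map_f_lists[of v], of "p j" "q j x" "q j y" R]
      f_letters[of "(j, x)"] f_letters[of "(j, y)"] f_letters[of "(j, x \<otimes>\<^bsub>H j\<^esub> y)"]
    by (simp add: f_eq)
next
  case (ident u v a b)
  then show ?case
    using word_cong.ident[OF map_f_lists[of u] map_f_lists[of v], of "f a" "f b" R] f_letters f_rel
    by simp
qed (blast intro: word_cong.sym word_cong.trans)+

lemma amalg_map_class:
  assumes "w \<in> lists (letters J H)"
  shows "amalg_map I G R f (word_cong J H R' `` {w}) = word_cong I G R `` {map f w}"
  unfolding amalg_map_def
  by (rule Image_word_cong) (use assms map_f_cong in \<open>auto intro: word_cong.refl\<close>)

lemma amalg_map_hom: "amalg_map I G R f \<in> hom (amalg J H R') (amalg I G R)"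
proof (rule homI)
  fix K assume "K \<in> carrier (amalg J H R')"
  then show "amalg_map I G R f K \<in> carrier (amalg I G R)"
    using map_f_lists by (elim amalg_classE) (simp only: amalg_map_class amalg_class_closed)
next
  fix K L assume "K \<in> carrier (amalg J H R')" "L \<in> carrier (amalg J H R')"
  then show "amalg_map I G R f (K \<otimes>\<^bsub>amalg J H R'\<^esub> L) =
      amalg_map I G R f K \<otimes>\<^bsub>amalg I G R\<^esub> amalg_map I G R f L"
    using map_f_lists
    by (elim amalg_classE) (simp add: amalg_mult_class amalg_map_class del: in_lists_conv_set)
qed

end


section \<open>The categories, and simplicial groups\<close>

lemma category_op_cat:
  assumes "category C" shows "category (op_cat C)"
proof -
  interpret category C by (rule assms)
  show ?thesis
    by unfold_locales
      (auto simp: op_cat_def Dom_Obj Cod_Obj Ide_Arr Dom_Ide Cod_Ide Comp_Arr Dom_Comp Cod_Comp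
        Comp_Ide Ide_Comp Comp_assoc)
qed

lemma cat_functor_op_cat:
  assumes "cat_functor C D S" shows "cat_functor (op_cat C) (op_cat D) S"
proof -
  interpret cat_functor C D S by (rule assms)
  show ?thesis
    by unfold_locales
      (auto simp: op_cat_def FObj_Obj FArr_Arr Dom_FArr Cod_FArr FArr_Ide FArr_Comp)
qed

lemma category_delta: "category delta"
proof (unfold_locales, goal_cases)
  case (6 f g)
  then obtain m n p \<alpha> \<beta> where fg: "f = (m, \<alpha>, n)" "g = (n, \<beta>, p)"
    and *: "\<alpha> \<in> {..m} \<rightarrow>\<^sub>E {..n}" "mono_on {..m} \<alpha>" "\<beta> \<in> {..n} \<rightarrow>\<^sub>E {..p}" "mono_on {..n} \<beta>"
    by (auto simp: delta_def)
  have \<alpha>: "\<alpha> k \<in> {..n}" if "k \<in> {..m}" for k using *(1) that by (rule PiE_mem)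
  have \<beta>: "\<beta> k \<in> {..p}" if "k \<in> {..n}" for k using *(3) that by (rule PiE_mem)
  have "compose {..m} \<beta> \<alpha> \<in> {..m} \<rightarrow>\<^sub>E {..p}"
    unfolding compose_def using \<alpha> \<beta> by (intro restrict_PiE_iff[THEN iffD2]) blast
  moreover have "mono_on {..m} (compose {..m} \<beta> \<alpha>)"
    by (rule mono_onI) (simp only: compose_eq mono_onD[OF *(4) \<alpha> \<alpha>] mono_onD[OF *(2)])
  ultimately show ?case by (simp add: fg delta_def)
next
  case (9 f)
  then obtain m n \<alpha> where "f = (m, \<alpha>, n)" "\<alpha> \<in> {..m} \<rightarrow> {..n}" "\<alpha> \<in> extensional {..m}"
    by (auto simp: delta_def PiE_def)
  then show ?case by (simp add: delta_def compose_Id)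
next
  case (10 f)
  then obtain m n \<alpha> where "f = (m, \<alpha>, n)" "\<alpha> \<in> {..m} \<rightarrow> {..n}" "\<alpha> \<in> extensional {..m}"
    by (auto simp: delta_def PiE_def)
  then show ?case by (simp add: delta_def Id_compose)
next
  case (11 f g h)
  then obtain m n p q \<alpha> \<beta> \<gamma> where "f = (m, \<alpha>, n)" "g = (n, \<beta>, p)" "h = (p, \<gamma>, q)" "\<alpha> \<in> {..m} \<rightarrow> {..n}"
    by (auto simp: delta_def PiE_def)
  then show ?case by (simp add: delta_def compose_assoc)
qed (auto simp: delta_def mono_on_def)

lemma simplices_ArrE:
  assumes "f \<in> Arr (simplices X)"
  obtains m y \<alpha> n x where "f = ((m, y), \<alpha>, (n, x))" "\<alpha> \<in> Arr delta" "Dom delta \<alpha> = m" "Cod delta \<alpha> = n"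
    "x \<in> Elts X n" "y \<in> Elts X m" "Map X \<alpha> x = y"
proof -
  obtain m y \<alpha> n x where f: "f = ((m, y), \<alpha>, (n, x))" by (metis prod.exhaust)
  show thesis by (rule that[OF f]) (use assms in \<open>simp_all add: f simplices_def\<close>)
qed

lemma category_simplices:
  assumes "simplicial_set X" shows "category (simplices X)"
proof -
  interpret D: category delta by (rule category_delta)
  interpret X: set_functor "op_cat delta" X by (rule assms)
  have proj: "Dom (simplices X) (a, \<alpha>, b) = a" "Cod (simplices X) (a, \<alpha>, b) = b"
    "Comp (simplices X) (b', \<beta>, c) (a, \<alpha>, b) = (a, Comp delta \<beta> \<alpha>, c)"
    "Ide (simplices X) (n, x) = ((n, x), Ide delta n, (n, x))"
    "(n, x) \<in> Obj (simplices X) \<longleftrightarrow> x \<in> Elts X n"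
    "((m, y), \<alpha>, (n, x)) \<in> Arr (simplices X) \<longleftrightarrow> \<alpha> \<in> Arr delta \<and> Dom delta \<alpha> = m \<and> Cod delta \<alpha> = n \<and>
       x \<in> Elts X n \<and> y \<in> Elts X m \<and> Map X \<alpha> x = y" for a \<alpha> b b' \<beta> c m n x y
    by (simp_all add: simplices_def)
  have Obj: "n \<in> Obj delta" for n by (simp add: delta_def)
  have Map: "Map X (Ide delta n) x = x" if "x \<in> Elts X n" for n x
    using X.Map_Ide[of n x] that Obj by (simp add: op_cat_def)
  have Map': "Map X (Comp delta \<beta> \<alpha>) z = Map X \<alpha> (Map X \<beta> z)"
    if "\<alpha> \<in> Arr delta" "\<beta> \<in> Arr delta" "Cod delta \<alpha> = Dom delta \<beta>" "z \<in> Elts X (Cod delta \<beta>)" for \<alpha> \<beta> z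
    using X.Map_Comp[of \<beta> \<alpha> z] that by (simp add: op_cat_def)
  show ?thesis
  proof (intro category.intro, goal_cases)
    case (1 f)
    then show ?case by (elim simplices_ArrE) (simp add: proj)
  next
    case (2 f)
    then show ?case by (elim simplices_ArrE) (simp add: proj)
  next
    case (3 c)
    then show ?case
      by (cases c) (simp add: proj D.Ide_Arr[OF Obj] D.Dom_Ide[OF Obj] D.Cod_Ide[OF Obj] Map)
  next
    case (4 c)
    then show ?case by (cases c) (simp add: proj)
  next
    case (5 c)
    then show ?case by (cases c) (simp add: proj)
  next
    case (6 f g)
    then show ?case
      by (elim simplices_ArrE) (clarsimp simp: proj D.Comp_Arr D.Dom_Comp D.Cod_Comp Map')
  next
    case (7 f g)
    then show ?case by (elim simplices_ArrE) (simp add: proj)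
  next
    case (8 f g)
    then show ?case by (elim simplices_ArrE) (simp add: proj)
  next
    case (9 f)
    then show ?case using D.Comp_Ide by (elim simplices_ArrE) (auto simp: proj)
  next
    case (10 f)
    then show ?case using D.Ide_Comp by (elim simplices_ArrE) (auto simp: proj)
  next
    case (11 f g h)
    then show ?case by (elim simplices_ArrE) (clarsimp simp: proj D.Comp_assoc)
  qed
qed

lemma cat_functor_Q: "cat_functor (simplices X) delta Q_functor"
proof (intro cat_functor.intro, goal_cases)
  case (1 c)
  show ?case by (simp add: delta_def)
next
  case (5 c)
  show ?case by (cases c) (simp add: simplices_def Q_functor_def)
next
  case (6 f g)
  then show ?case by (elim simplices_ArrE) (simp add: simplices_def Q_functor_def)
qed (elim simplices_ArrE, simp add: simplices_def Q_functor_def)+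

lemma coface_Arr: "i \<le> Suc n \<Longrightarrow> coface (Suc n) i \<in> Arr delta"
  by (auto simp: coface_def delta_def mono_on_def)

lemma codegen_Arr: "i \<le> n \<Longrightarrow> codegen n i \<in> Arr delta"
  by (auto simp: codegen_def delta_def mono_on_def)

lemma Dom_Cod_coface: "Dom delta (coface n i) = n - 1" "Cod delta (coface n i) = n"
  by (auto simp: coface_def delta_def)

lemma Dom_Cod_codegen: "Dom delta (codegen n i) = Suc n" "Cod delta (codegen n i) = n"
  by (auto simp: codegen_def delta_def)

lemma Comp_coface_coface:
  "i < j \<Longrightarrow> j \<le> Suc (Suc n) \<Longrightarrow>
   Comp delta (coface (Suc (Suc n)) j) (coface (Suc n) i) = Comp delta (coface (Suc (Suc n)) i) (coface (Suc n) (j - 1))"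
  unfolding delta_def coface_def compose_def
  by (auto intro!: restrict_ext)
lemma Comp_codegen_coface_less:
  "i < j \<Longrightarrow> j \<le> Suc n \<Longrightarrow>
   Comp delta (codegen (Suc n) j) (coface (Suc (Suc n)) i) = Comp delta (coface (Suc n) i) (codegen n (j - 1))"
  unfolding delta_def coface_def codegen_def compose_def
  by (auto intro!: restrict_ext)
lemma Comp_codegen_coface_eq:
  "i \<in> {j, Suc j} \<Longrightarrow> j \<le> n \<Longrightarrow> Comp delta (codegen n j) (coface (Suc n) i) = Ide delta n"
  unfolding delta_def coface_def codegen_def compose_def
  by (auto intro!: restrict_ext)
lemma Comp_codegen_coface_greater:
  "Suc j < i \<Longrightarrow> i \<le> Suc (Suc n) \<Longrightarrow>
   Comp delta (codegen (Suc n) j) (coface (Suc (Suc n)) i) = Comp delta (coface (Suc n) (i - 1)) (codegen n j)"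
  unfolding delta_def coface_def codegen_def compose_def
  by (auto intro!: restrict_ext)
lemma Comp_codegen_codegen:
  "i \<le> j \<Longrightarrow> j \<le> n \<Longrightarrow>
   Comp delta (codegen n j) (codegen (Suc n) i) = Comp delta (codegen n i) (codegen (Suc n) (Suc j))"
  unfolding delta_def codegen_def compose_def
  by (auto intro!: restrict_ext)

lemma simplicial_group_sgroup_of:
  assumes "group_diagram (op_cat delta) F" shows "simplicial_group (sgroup_of F)"
proof -
  interpret F: group_diagram "op_cat delta" F by (rule assms)
  note DC = Dom_Cod_coface Dom_Cod_codegen coface_Arr codegen_Arr
  have comp: "Act F f (Act F g x) = Act F (Comp delta g f) x"
    if "f \<in> Arr delta" "g \<in> Arr delta" "Cod delta f = Dom delta g" "x \<in> carrier (Grp F (Cod delta g))"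
    for f g x
    using F.Act_Comp[of g f x] that by (simp add: op_cat_def)
  have gen: "Act F f (Act F g x) = Act F f' (Act F g' x)"
    if "f \<in> Arr delta" "g \<in> Arr delta" "Cod delta f = Dom delta g" "x \<in> carrier (Grp F (Cod delta g))"
      "f' \<in> Arr delta" "g' \<in> Arr delta" "Cod delta f' = Dom delta g'" "Cod delta g' = Cod delta g"
      "Comp delta g f = Comp delta g' f'"
    for f g f' g' x
    using that by (simp add: comp)
  show ?thesis
  proof (intro simplicial_group.intro, goal_cases)
    case (1 n)
    show ?case using F.Grp_group[of n] by (simp add: sgroup_of_def op_cat_def delta_def)
  next
    case (2 i n)
    then show ?case using F.Act_hom[of "coface (Suc n) i"] by (simp add: sgroup_of_def op_cat_def DC)
  next
    case (3 i n)
    then show ?case using F.Act_hom[of "codegen n i"] by (simp add: sgroup_of_def op_cat_def DC)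
  next
    case (4 i j n x)
    then show ?case unfolding sgroup_of_def sgroup.simps
      by (intro gen Comp_coface_coface) (auto simp: DC)
  next
    case (5 i j n x)
    then show ?case unfolding sgroup_of_def sgroup.simps
      by (intro gen Comp_codegen_coface_less) (auto simp: DC)
  next
    case (6 i j n x)
    have "Act F (Ide delta n) x = x"
      using 6 F.Act_Ide[of n x] by (simp add: sgroup_of_def op_cat_def delta_def)
    moreover have "Act F (coface (Suc n) i) (Act F (codegen n j) x) =
        Act F (Comp delta (codegen n j) (coface (Suc n) i)) x"
      using 6 by (intro comp) (auto simp: DC sgroup_of_def)
    ultimately show ?case using 6 by (simp only: sgroup_of_def sgroup.simps Comp_codegen_coface_eq)
  next
    case (7 j i n x)
    then show ?case unfolding sgroup_of_def sgroup.simps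
      by (intro gen Comp_codegen_coface_greater) (auto simp: DC)
  next
    case (8 i j n x)
    then show ?case unfolding sgroup_of_def sgroup.simps
      by (intro gen Comp_codegen_codegen) (auto simp: DC)
  qed
qed

context simplicial_group
begin

lemma Face_closed: "\<lbrakk>i \<le> Suc n; x \<in> carrier (Level G (Suc n))\<rbrakk> \<Longrightarrow> Face G (Suc n) i x \<in> carrier (Level G n)"
  using Face_hom[of i n] by (auto simp: hom_def Pi_def)

lemma Degen_closed: "\<lbrakk>i \<le> n; x \<in> carrier (Level G n)\<rbrakk> \<Longrightarrow> Degen G n i x \<in> carrier (Level G (Suc n))"
  using Degen_hom[of i n] by (auto simp: hom_def Pi_def)

lemma Face_group_hom: "i \<le> Suc n \<Longrightarrow> group_hom (Level G (Suc n)) (Level G n) (Face G (Suc n) i)"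
  using Face_hom Level_group by (simp add: group_hom_def group_hom_axioms_def)

lemma moore_subgroup: "subgroup (moore G n) (Level G n)"
proof -
  interpret L: group "Level G n" by (rule Level_group)
  show ?thesis
  proof (cases n)
    case 0
    have "moore G n = carrier (Level G n)" by (simp add: moore_def 0)
    then show ?thesis using L.subgroup_self by simp
  next
    case (Suc m)
    interpret Lm: group "Level G m" by (rule Level_group)
    have fh: "group_hom (Level G n) (Level G m) (Face G n i)" if "i < n" for i
      using Face_group_hom[of i m] that Suc by simp
    have m: "n - 1 = m" using Suc by simp
    show ?thesis unfolding moore_def m
      by (intro L.subgroupI)
        (auto simp: group_hom.hom_one[OF fh] group_hom.hom_inv[OF fh] group_hom.hom_mult[OF fh])
  qed
qed

lemma cycles_subgroup: "subgroup (cycles G n) (Level G n)"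
proof (cases n)
  case 0
  then show ?thesis using moore_subgroup[of n] by (simp add: cycles_def)
next
  case (Suc m)
  interpret L: group "Level G n" by (rule Level_group)
  interpret f: group_hom "Level G n" "Level G m" "Face G n n" using Face_group_hom[of n m] Suc by simp
  have "cycles G n = moore G n \<inter> kernel (Level G n) (Level G m) (Face G n n)"
    by (auto simp: cycles_def kernel_def moore_def Suc)
  then show ?thesis
    using L.subgroups_Inter_pair[OF moore_subgroup f.subgroup_kernel] by simp
qed

lemma boundaries_subset: "boundaries G n \<subseteq> cycles G n"
proof
  fix y assume "y \<in> boundaries G n"
  then obtain z where z: "z \<in> carrier (Level G (Suc n))" "\<And>i. i < Suc n \<Longrightarrow> Face G (Suc n) i z = \<one>\<^bsub>Level G n\<^esub>"
    and y: "y = Face G (Suc n) (Suc n) z"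
    by (auto simp: boundaries_def moore_def)
  have "Face G n i y = \<one>\<^bsub>Level G (n - 1)\<^esub>" if "0 < n" "i \<le> n" for i
  proof -
    have "n \<noteq> 0" using that(1) by simp
    then obtain m where m: "n = Suc m" using not0_implies_Suc by blast
    have "Face G n i y = Face G n n (Face G (Suc n) i z)"
      using Face_Face[of i "Suc n" m z] z(1) that by (simp add: m y)
    also have "\<dots> = \<one>\<^bsub>Level G m\<^esub>"
      using group_hom.hom_one[OF Face_group_hom[of n m]] z(2)[of i] that by (simp add: m)
    finally show ?thesis by (simp add: m)
  qed
  moreover have "y \<in> carrier (Level G n)" using y z(1) by (simp add: Face_closed)
  ultimately show "y \<in> cycles G n" by (auto simp: cycles_def moore_def)
qed

lemma Degen_cycle:
  assumes x: "x \<in> cycles G n"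
  shows "Degen G n n x \<in> carrier (Level G (Suc n))"
    "i < n \<Longrightarrow> Face G (Suc n) i (Degen G n n x) = \<one>\<^bsub>Level G n\<^esub>"
    "Face G (Suc n) n (Degen G n n x) = x" "Face G (Suc n) (Suc n) (Degen G n n x) = x"
proof -
  have xc: "x \<in> carrier (Level G n)" using x by (simp add: cycles_def moore_def)
  then show "Degen G n n x \<in> carrier (Level G (Suc n))" by (simp add: Degen_closed)
  show "Face G (Suc n) n (Degen G n n x) = x" "Face G (Suc n) (Suc n) (Degen G n n x) = x"
    using Face_Degen_eq[of _ n n x] xc by auto
  assume i: "i < n"
  then have "n \<noteq> 0" by simp
  then obtain m where m: "n = Suc m" using not0_implies_Suc by blast
  have "Face G (Suc n) i (Degen G n n x) = Degen G m m (Face G n i x)"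
    using Face_Degen_less[of i n m x] i xc m by simp
  also have "Face G n i x = \<one>\<^bsub>Level G m\<^esub>" using x i m by (auto simp: cycles_def moore_def)
  also have "Degen G m m \<one>\<^bsub>Level G m\<^esub> = \<one>\<^bsub>Level G n\<^esub>"
    using hom_one[OF Degen_hom[of m m]] Level_group[of m] Level_group[of n] m by simp
  finally show "Face G (Suc n) i (Degen G n n x) = \<one>\<^bsub>Level G n\<^esub>" .
qed

lemma boundaries_normal: "boundaries G n \<lhd> (Level G n)\<lparr>carrier := cycles G n\<rparr>"
proof -
  interpret L: group "Level G n" by (rule Level_group)
  interpret L': group "Level G (Suc n)" by (rule Level_group)
  let ?Z = "(Level G n)\<lparr>carrier := cycles G n\<rparr>"
  interpret Z: group ?Z by (rule L.subgroup_imp_group[OF cycles_subgroup])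
  have fh: "group_hom (Level G (Suc n)) (Level G n) (Face G (Suc n) i)" if "i \<le> Suc n" for i
    using that by (rule Face_group_hom)
  have B: "subgroup (boundaries G n) (Level G n)"
    unfolding boundaries_def by (rule group_hom.subgroup_img_is_subgroup[OF fh moore_subgroup]) simp
  show ?thesis
  proof (rule Z.normal_invI)
    show "subgroup (boundaries G n) ?Z"
      by (rule L.subgroup_incl[OF B cycles_subgroup boundaries_subset])
  next
    fix x b assume "x \<in> carrier ?Z" and b: "b \<in> boundaries G n"
    then have x: "x \<in> cycles G n" by simp
    then have xc: "x \<in> carrier (Level G n)" by (simp add: cycles_def moore_def)
    note s = Degen_cycle[OF x]
    obtain z where z: "z \<in> carrier (Level G (Suc n))" "\<And>i. i < Suc n \<Longrightarrow> Face G (Suc n) i z = \<one>\<^bsub>Level G n\<^esub>"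
      and b': "b = Face G (Suc n) (Suc n) z"
      using b by (auto simp: boundaries_def moore_def)
    let ?s = "Degen G n n x"
    let ?w = "?s \<otimes>\<^bsub>Level G (Suc n)\<^esub> z \<otimes>\<^bsub>Level G (Suc n)\<^esub> inv\<^bsub>Level G (Suc n)\<^esub> ?s"
    have f: "Face G (Suc n) i ?w = Face G (Suc n) i ?s \<otimes>\<^bsub>Level G n\<^esub> Face G (Suc n) i z
        \<otimes>\<^bsub>Level G n\<^esub> inv\<^bsub>Level G n\<^esub> Face G (Suc n) i ?s" if "i \<le> Suc n" for i
      using s(1) z(1) by (simp add: group_hom.hom_mult[OF fh[OF that]] group_hom.hom_inv[OF fh[OF that]])
    have "?w \<in> moore G (Suc n)"
      using s z xc by (auto simp: moore_def f less_Suc_eq)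
    then have "Face G (Suc n) (Suc n) ?w \<in> boundaries G n" by (simp add: boundaries_def)
    then have "x \<otimes>\<^bsub>Level G n\<^esub> b \<otimes>\<^bsub>Level G n\<^esub> inv\<^bsub>Level G n\<^esub> x \<in> boundaries G n"
      by (simp add: f s b')
    then show "x \<otimes>\<^bsub>?Z\<^esub> b \<otimes>\<^bsub>?Z\<^esub> inv\<^bsub>?Z\<^esub> x \<in> boundaries G n"
      using L.m_inv_consistent[OF cycles_subgroup x] by simp
  qed
qed

lemma group_homotopy_group: "group (homotopy_group n G)"
  unfolding homotopy_group_def by (rule normal.factorgroup_is_group[OF boundaries_normal])

text \<open>Two \<open>n\<close>-simplices with trivial faces lie in the same coset of \<open>boundaries G n\<close> iff they are
  homotopic in the simplicial sense.\<close>

lemma boundaries_coset_iff_homotopic: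
  assumes x: "x \<in> cycles G n" and y: "y \<in> cycles G n"
  shows "y \<otimes>\<^bsub>Level G n\<^esub> inv\<^bsub>Level G n\<^esub> x \<in> boundaries G n \<longleftrightarrow>
    (\<exists>z\<in>carrier (Level G (Suc n)). (\<forall>i<n. Face G (Suc n) i z = \<one>\<^bsub>Level G n\<^esub>) \<and>
       Face G (Suc n) n z = x \<and> Face G (Suc n) (Suc n) z = y)"
proof -
  interpret L: group "Level G n" by (rule Level_group)
  interpret L': group "Level G (Suc n)" by (rule Level_group)
  let ?s = "Degen G n n"
  have xc: "x \<in> carrier (Level G n)" and yc: "y \<in> carrier (Level G n)"
    using x y by (auto simp: cycles_def moore_def)
  note sx = Degen_cycle(1)[OF x] and s_low = Degen_cycle(2)[OF x] and s_top = Degen_cycle(3,4)[OF x]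
  note fh = Face_group_hom[of _ n]
  show ?thesis
  proof
    assume "y \<otimes>\<^bsub>Level G n\<^esub> inv\<^bsub>Level G n\<^esub> x \<in> boundaries G n"
    then obtain w where w: "w \<in> carrier (Level G (Suc n))"
      "\<forall>i<Suc n. Face G (Suc n) i w = \<one>\<^bsub>Level G n\<^esub>"
      "Face G (Suc n) (Suc n) w = y \<otimes>\<^bsub>Level G n\<^esub> inv\<^bsub>Level G n\<^esub> x"
      by (auto simp: boundaries_def moore_def)
    have f: "Face G (Suc n) i (w \<otimes>\<^bsub>Level G (Suc n)\<^esub> ?s x) =
        Face G (Suc n) i w \<otimes>\<^bsub>Level G n\<^esub> Face G (Suc n) i (?s x)" if "i \<le> Suc n" for i
      using hom_mult[OF Face_hom[OF that] w(1) sx] .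
    show "\<exists>z\<in>carrier (Level G (Suc n)). (\<forall>i<n. Face G (Suc n) i z = \<one>\<^bsub>Level G n\<^esub>) \<and>
       Face G (Suc n) n z = x \<and> Face G (Suc n) (Suc n) z = y"
      by (rule bexI[of _ "w \<otimes>\<^bsub>Level G (Suc n)\<^esub> ?s x"])
        (use w sx xc yc in \<open>auto simp: f s_low s_top L.m_assoc\<close>)
  next
    assume "\<exists>z\<in>carrier (Level G (Suc n)). (\<forall>i<n. Face G (Suc n) i z = \<one>\<^bsub>Level G n\<^esub>) \<and>
       Face G (Suc n) n z = x \<and> Face G (Suc n) (Suc n) z = y"
    then obtain z where z: "z \<in> carrier (Level G (Suc n))"
      "\<forall>i<n. Face G (Suc n) i z = \<one>\<^bsub>Level G n\<^esub>" "Face G (Suc n) n z = x" "Face G (Suc n) (Suc n) z = y"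
      by blast
    let ?w = "z \<otimes>\<^bsub>Level G (Suc n)\<^esub> inv\<^bsub>Level G (Suc n)\<^esub> ?s x"
    have f: "Face G (Suc n) i ?w =
        Face G (Suc n) i z \<otimes>\<^bsub>Level G n\<^esub> inv\<^bsub>Level G n\<^esub> Face G (Suc n) i (?s x)" if "i \<le> Suc n" for i
      using hom_mult[OF Face_hom[OF that] z(1)] sx group_hom.hom_inv[OF fh[OF that] sx] by simp
    have "?w \<in> moore G (Suc n)"
      using z sx xc by (auto simp: moore_def f s_low s_top less_Suc_eq)
    moreover have "Face G (Suc n) (Suc n) ?w = y \<otimes>\<^bsub>Level G n\<^esub> inv\<^bsub>Level G n\<^esub> x"
      using z by (simp add: f s_top)
    ultimately show "y \<otimes>\<^bsub>Level G n\<^esub> inv\<^bsub>Level G n\<^esub> x \<in> boundaries G n"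
      unfolding boundaries_def by (metis imageI)
  qed
qed

end


section \<open>The universal property of the left Kan extension\<close>

locale kan_data =
  C: category C + D: category D + S: cat_functor C D S + F: group_diagram C F
  for C :: "('o, 'm) cat" and D :: "('p, 'q) cat" and S and F :: "('o, 'm, 'g) grp_diagram"
begin

abbreviation "cObj d \<equiv> Obj (comma C D S d)"
abbreviation "cGrp \<equiv> Grp (comma_diagram F :: ('o \<times> 'q, ('o \<times> 'q) \<times> 'm \<times> ('o \<times> 'q), 'g) grp_diagram)"
abbreviation "cRel d \<equiv> colim_rel (comma C D S d) (comma_diagram F)"

lemma cObj_iff: "(c, \<phi>) \<in> cObj d \<longleftrightarrow> c \<in> Obj C \<and> \<phi> \<in> Arr D \<and> Dom D \<phi> = FObj S c \<and> Cod D \<phi> = d"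
  by (simp add: comma_def)

lemma cGrp_eq: "cGrp (c, \<phi>) = Grp F c"
  by (simp add: comma_diagram_def)

lemma cGrp_group: "i \<in> cObj d \<Longrightarrow> group (cGrp i)"
  by (cases i) (simp add: cObj_iff cGrp_eq F.Grp_group)

lemma cRelE:
  assumes "(a, b) \<in> cRel d"
  obtains f \<phi>' x where "f \<in> Arr C" "\<phi>' \<in> Arr D" "Dom D \<phi>' = FObj S (Cod C f)" "Cod D \<phi>' = d"
    "x \<in> carrier (Grp F (Dom C f))"
    "a = ((Dom C f, Comp D \<phi>' (FArr S f)), x)" "b = ((Cod C f, \<phi>'), Act F f x)"
  using assms by (auto simp: colim_rel_def comma_def comma_diagram_def)

lemma cRelI:
  assumes "f \<in> Arr C" "\<phi>' \<in> Arr D" "Dom D \<phi>' = FObj S (Cod C f)" "Cod D \<phi>' = d"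
    "x \<in> carrier (Grp F (Dom C f))"
  shows "(((Dom C f, Comp D \<phi>' (FArr S f)), x), ((Cod C f, \<phi>'), Act F f x)) \<in> cRel d"
proof -
  let ?a = "((Dom C f, Comp D \<phi>' (FArr S f)), f, (Cod C f, \<phi>'))"
  have "?a \<in> Arr (comma C D S d)"
    using assms by (simp add: comma_def S.FArr_Arr S.Dom_FArr S.Cod_FArr D.Comp_Arr D.Dom_Comp D.Cod_Comp)
  moreover have "x \<in> carrier (cGrp (Dom (comma C D S d) ?a))"
    using assms by (simp add: comma_def cGrp_eq)
  moreover have "(((Dom C f, Comp D \<phi>' (FArr S f)), x), ((Cod C f, \<phi>'), Act F f x)) =
     ((Dom (comma C D S d) ?a, x), (Cod (comma C D S d) ?a, Act (comma_diagram F) ?a x))"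
    by (simp add: comma_def comma_diagram_def)
  ultimately show ?thesis unfolding colim_rel_def by blast
qed

lemma Grp_lan: "Grp (lan C D S F) d = amalg (cObj d) cGrp (cRel d)"
  by (simp add: lan_def grp_colim_def)

abbreviation "push \<beta> \<equiv> (\<lambda>((c, \<phi>), x). ((c, Comp D \<beta> \<phi>), x))"

lemma Act_lan: "Act (lan C D S F) \<beta> = amalg_map (cObj (Cod D \<beta>)) cGrp (cRel (Cod D \<beta>)) (push \<beta>)"
  by (simp add: lan_def)

lemma push_letter_map:
  assumes "\<beta> \<in> Arr D"
  shows "letter_map (cObj (Dom D \<beta>)) cGrp (cRel (Dom D \<beta>)) (cObj (Cod D \<beta>)) cGrp (cRel (Cod D \<beta>))
    (push \<beta>) (\<lambda>(c, \<phi>). (c, Comp D \<beta> \<phi>)) (\<lambda>_ x. x)"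
proof (intro letter_map.intro, goal_cases)
  case (1 j x)
  show ?case by (cases j) simp
next
  case (2 j)
  then show ?case using assms by (cases j) (simp add: cObj_iff D.Comp_Arr D.Dom_Comp D.Cod_Comp)
next
  case (3 j)
  then show ?case by (cases j) (simp add: cGrp_eq hom_def)
next
  case (4 a b)
  from 4(1) show ?case
  proof (rule cRelE)
    fix f \<phi>' x
    assume *: "f \<in> Arr C" "\<phi>' \<in> Arr D" "Dom D \<phi>' = FObj S (Cod C f)" "Cod D \<phi>' = Dom D \<beta>"
      "x \<in> carrier (Grp F (Dom C f))"
      "a = ((Dom C f, Comp D \<phi>' (FArr S f)), x)" "b = ((Cod C f, \<phi>'), Act F f x)"
    then have "Comp D \<beta> (Comp D \<phi>' (FArr S f)) = Comp D (Comp D \<beta> \<phi>') (FArr S f)"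
      using assms by (intro D.Comp_assoc) (auto simp: S.FArr_Arr S.Cod_FArr)
    then show ?thesis
      using cRelI[of f "Comp D \<beta> \<phi>'" "Cod D \<beta>" x] * assms
      by (simp add: D.Comp_Arr D.Dom_Comp D.Cod_Comp)
  qed
qed (auto intro: cGrp_group)

lemma group_diagram_lan: "group_diagram D (lan C D S F)"
proof (intro group_diagram.intro, goal_cases)
  case (1 d)
  show ?case unfolding Grp_lan by (rule group_amalg) (rule cGrp_group)
next
  case (2 \<beta>)
  interpret L: letter_map "cObj (Dom D \<beta>)" cGrp "cRel (Dom D \<beta>)" "cObj (Cod D \<beta>)" cGrp "cRel (Cod D \<beta>)"
    "push \<beta>" "\<lambda>(c, \<phi>). (c, Comp D \<beta> \<phi>)" "\<lambda>_ x. x" by (rule push_letter_map[OF 2])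
  show ?case unfolding Grp_lan Act_lan by (rule L.amalg_map_hom)
next
  case (3 d K)
  note ide = D.Ide_Arr[OF 3(1)] D.Dom_Ide[OF 3(1)] D.Cod_Ide[OF 3(1)]
  interpret L: letter_map "cObj d" cGrp "cRel d" "cObj d" cGrp "cRel d"
    "push (Ide D d)" "\<lambda>(c, \<phi>). (c, Comp D (Ide D d) \<phi>)" "\<lambda>_ x. x"
    using push_letter_map[OF ide(1)] by (simp add: ide)
  from 3(2) show ?case unfolding Grp_lan
  proof (rule amalg_classE)
    fix w assume w: "w \<in> lists (letters (cObj d) cGrp)" "K = word_cong (cObj d) cGrp (cRel d) `` {w}"
    have "map (push (Ide D d)) w = map id w"
    proof (rule map_cong[OF HOL.refl])
      fix a assume "a \<in> set w"
      then have "a \<in> letters (cObj d) cGrp" using w by auto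
      then show "push (Ide D d) a = id a"
        by (cases a) (auto simp: letters_def cObj_iff D.Ide_Comp)
    qed
    then show "Act (lan C D S F) (Ide D d) K = K"
      using L.amalg_map_class[OF w(1)] by (simp add: Act_lan ide w(2))
  qed
next
  case (4 f g K)
  interpret Lf: letter_map "cObj (Dom D f)" cGrp "cRel (Dom D f)" "cObj (Cod D f)" cGrp "cRel (Cod D f)"
    "push f" "\<lambda>(c, \<phi>). (c, Comp D f \<phi>)" "\<lambda>_ x. x" by (rule push_letter_map[OF 4(1)])
  interpret Lg: letter_map "cObj (Cod D f)" cGrp "cRel (Cod D f)" "cObj (Cod D g)" cGrp "cRel (Cod D g)"
    "push g" "\<lambda>(c, \<phi>). (c, Comp D g \<phi>)" "\<lambda>_ x. x"
    using push_letter_map[OF 4(2)] by (simp add: 4(3))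
  interpret Lgf: letter_map "cObj (Dom D f)" cGrp "cRel (Dom D f)" "cObj (Cod D g)" cGrp "cRel (Cod D g)"
    "push (Comp D g f)" "\<lambda>(c, \<phi>). (c, Comp D (Comp D g f) \<phi>)" "\<lambda>_ x. x"
    using push_letter_map[OF D.Comp_Arr[OF 4(1-3)]] by (simp add: D.Dom_Comp D.Cod_Comp 4(1-3))
  from 4(4) show ?case unfolding Grp_lan
  proof (rule amalg_classE)
    fix w assume w: "w \<in> lists (letters (cObj (Dom D f)) cGrp)"
      "K = word_cong (cObj (Dom D f)) cGrp (cRel (Dom D f)) `` {w}"
    have "map (push (Comp D g f)) w = map (push g) (map (push f) w)"
      unfolding map_map
    proof (rule map_cong[OF HOL.refl])
      fix a assume "a \<in> set w"
      then have "a \<in> letters (cObj (Dom D f)) cGrp" using w by auto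
      then show "push (Comp D g f) a = (push g \<circ> push f) a"
        using 4(1-3) by (cases a) (auto simp: letters_def cObj_iff D.Comp_assoc)
    qed
    then show "Act (lan C D S F) (Comp D g f) K = Act (lan C D S F) g (Act (lan C D S F) f K)"
      using Lf.amalg_map_class[OF w(1)] Lgf.amalg_map_class[OF w(1)]
        Lg.amalg_map_class[OF Lf.map_f_lists[OF w(1)]] 4(3)
      by (simp only: Act_lan w(2) D.Cod_Comp[OF 4(1-3)])
  qed
qed

lemma letter_in: "\<lbrakk>c \<in> Obj C; \<phi> \<in> Arr D; Dom D \<phi> = FObj S c; Cod D \<phi> = d; x \<in> carrier (Grp F c)\<rbrakk>
    \<Longrightarrow> ((c, \<phi>), x) \<in> letters (cObj d) cGrp"
  by (simp add: letters_def cObj_iff cGrp_eq)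

lemma Act_lan_unit:
  assumes "c \<in> Obj C" "\<phi> \<in> Arr D" "Dom D \<phi> = FObj S c" "x \<in> carrier (Grp F c)"
  shows "Act (lan C D S F) \<phi> (lan_unit C D S F c x) =
    word_cong (cObj (Cod D \<phi>)) cGrp (cRel (Cod D \<phi>)) `` {[((c, \<phi>), x)]}"
proof -
  note Sc = S.FObj_Obj[OF assms(1)]
  note ide = D.Ide_Arr[OF Sc] D.Dom_Ide[OF Sc] D.Cod_Ide[OF Sc]
  interpret L: letter_map "cObj (Dom D \<phi>)" cGrp "cRel (Dom D \<phi>)" "cObj (Cod D \<phi>)" cGrp "cRel (Cod D \<phi>)"
    "push \<phi>" "\<lambda>(c, \<psi>). (c, Comp D \<phi> \<psi>)" "\<lambda>_ x. x" by (rule push_letter_map[OF assms(2)])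
  have "[((c, Ide D (FObj S c)), x)] \<in> lists (letters (cObj (Dom D \<phi>)) cGrp)"
    using assms ide by (simp add: letter_in)
  from L.amalg_map_class[OF this] show ?thesis
    using D.Comp_Ide[OF assms(2)] assms(3) by (simp add: Act_lan lan_unit_def)
qed

lemma lan_unit_natural: "grp_natural C F (grp_pullback S (lan C D S F)) (lan_unit C D S F)"
  unfolding grp_natural_def
proof (intro conjI ballI)
  fix c assume c: "c \<in> Obj C"
  note Sc = S.FObj_Obj[OF c]
  note ide = D.Ide_Arr[OF Sc] D.Dom_Ide[OF Sc] D.Cod_Ide[OF Sc]
  interpret Fc: group "Grp F c" using F.Grp_group[OF c] .
  let ?i = "(c, Ide D (FObj S c))" and ?d = "FObj S c"
  have L: "(?i, x) \<in> letters (cObj ?d) cGrp" if "x \<in> carrier (Grp F c)" for x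
    using that c ide by (simp add: letter_in)
  show "lan_unit C D S F c \<in> hom (Grp F c) (Grp (grp_pullback S (lan C D S F)) c)"
  proof (rule homI)
    fix x assume "x \<in> carrier (Grp F c)"
    then show "lan_unit C D S F c x \<in> carrier (Grp (grp_pullback S (lan C D S F)) c)"
      unfolding grp_pullback_def grp_diagram.simps Grp_lan lan_unit_def
      using L by (intro amalg_class_closed) simp
  next
    fix x y assume xy: "x \<in> carrier (Grp F c)" "y \<in> carrier (Grp F c)"
    have "([(?i, x), (?i, y)], [(?i, x \<otimes>\<^bsub>Grp F c\<^esub> y)]) \<in> word_cong (cObj ?d) cGrp (cRel ?d)"
      using word_cong.mult[of "[]" "cObj ?d" cGrp "[]" ?i x y] L xy by (simp add: cGrp_eq)
    then show "lan_unit C D S F c (x \<otimes>\<^bsub>Grp F c\<^esub> y) =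
      lan_unit C D S F c x \<otimes>\<^bsub>Grp (grp_pullback S (lan C D S F)) c\<^esub> lan_unit C D S F c y"
      unfolding grp_pullback_def grp_diagram.simps Grp_lan lan_unit_def
      using L xy by (simp add: amalg_mult_class word_class_eq_iff word_cong.sym)
  qed
next
  fix f x assume f: "f \<in> Arr C" and x: "x \<in> carrier (Grp F (Dom C f))"
  let ?d = "FObj S (Cod C f)"
  note Sd = S.FObj_Obj[OF C.Cod_Obj[OF f]]
  note ide = D.Ide_Arr[OF Sd] D.Dom_Ide[OF Sd] D.Cod_Ide[OF Sd]
  have Fx: "Act F f x \<in> carrier (Grp F (Cod C f))"
    using F.Act_hom[OF f] x by (auto simp: hom_def)
  have comp: "Comp D (Ide D ?d) (FArr S f) = FArr S f"
    using D.Ide_Comp[OF S.FArr_Arr[OF f]] by (simp add: S.Cod_FArr[OF f])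
  have l: "((Dom C f, FArr S f), x) \<in> letters (cObj ?d) cGrp" "((Cod C f, Ide D ?d), Act F f x) \<in> letters (cObj ?d) cGrp"
    using f x Fx ide by (auto simp: letter_in C.Dom_Obj C.Cod_Obj S.FArr_Arr S.Dom_FArr S.Cod_FArr)
  have "([((Dom C f, FArr S f), x)], [((Cod C f, Ide D ?d), Act F f x)]) \<in> word_cong (cObj ?d) cGrp (cRel ?d)"
    using cRelI[of f "Ide D ?d" ?d x] f x ide l word_cong.ident[of "[]" "cObj ?d" cGrp "[]"] by (simp add: comp)
  then have "lan_unit C D S F (Cod C f) (Act F f x) = word_cong (cObj ?d) cGrp (cRel ?d) `` {[((Dom C f, FArr S f), x)]}"
    unfolding lan_unit_def using l by (simp add: word_class_eq_iff word_cong.sym)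
  then show "lan_unit C D S F (Cod C f) (Act F f x) =
     Act (grp_pullback S (lan C D S F)) f (lan_unit C D S F (Dom C f) x)"
    using Act_lan_unit[of "Dom C f" "FArr S f" x] f x
    by (simp add: grp_pullback_def C.Dom_Obj S.FArr_Arr S.Dom_FArr S.Cod_FArr)
qed

lemma lan_universal:
  fixes M :: "('p, 'q, 'h) grp_diagram"
  assumes M: "group_diagram D M" and \<theta>: "grp_natural C F (grp_pullback S M) \<theta>"
  shows "\<exists>\<tau>. grp_natural D (lan C D S F) M \<tau> \<and>
      (\<forall>c\<in>Obj C. \<forall>x\<in>carrier (Grp F c). \<tau> (FObj S c) (lan_unit C D S F c x) = \<theta> c x)"
    and "\<lbrakk>grp_natural D (lan C D S F) M \<tau>; grp_natural D (lan C D S F) M \<tau>';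
      \<And>c x. \<lbrakk>c \<in> Obj C; x \<in> carrier (Grp F c)\<rbrakk> \<Longrightarrow>
        \<tau> (FObj S c) (lan_unit C D S F c x) = \<tau>' (FObj S c) (lan_unit C D S F c x);
      d \<in> Obj D; K \<in> carrier (Grp (lan C D S F) d)\<rbrakk> \<Longrightarrow> \<tau> d K = \<tau>' d K"
proof -
  interpret M: group_diagram D M by (rule M)
  have \<theta>_hom: "\<theta> c \<in> hom (Grp F c) (Grp M (FObj S c))" if "c \<in> Obj C" for c
    using \<theta> that by (simp add: grp_natural_def grp_pullback_def)
  have \<theta>_nat: "\<theta> (Cod C f) (Act F f x) = Act M (FArr S f) (\<theta> (Dom C f) x)"
    if "f \<in> Arr C" "x \<in> carrier (Grp F (Dom C f))" for f x
    using \<theta> that by (simp add: grp_natural_def grp_pullback_def)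
  have \<theta>_closed: "\<theta> c x \<in> carrier (Grp M (FObj S c))" if "c \<in> Obj C" "x \<in> carrier (Grp F c)" for c x
    using \<theta>_hom[OF that(1)] that(2) by (auto simp: hom_def)
  define h where "h = (\<lambda>((c, \<phi>), x). Act M \<phi> (\<theta> c x))"
  have target: "amalg_target (Grp M d) (cObj d) cGrp (cRel d) h" if "d \<in> Obj D" for d
  proof (intro amalg_target.intro amalg_target_axioms.intro M.Grp_group that, goal_cases)
    case (1 i)
    then obtain c \<phi> where i: "i = (c, \<phi>)" "c \<in> Obj C" "\<phi> \<in> Arr D" "Dom D \<phi> = FObj S c" "Cod D \<phi> = d"
      by (cases i) (auto simp: cObj_iff)
    have "Act M \<phi> \<circ> \<theta> c \<in> hom (Grp F c) (Grp M d)"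
      using hom_compose[OF \<theta>_hom[OF i(2)]] M.Act_hom[OF i(3)] i by auto
    then show ?case by (simp add: h_def i cGrp_eq comp_def)
  next
    case (2 a b)
    from 2(1) show ?case
    proof (rule cRelE)
      fix f \<phi>' x
      assume *: "f \<in> Arr C" "\<phi>' \<in> Arr D" "Dom D \<phi>' = FObj S (Cod C f)" "Cod D \<phi>' = d"
        "x \<in> carrier (Grp F (Dom C f))"
        "a = ((Dom C f, Comp D \<phi>' (FArr S f)), x)" "b = ((Cod C f, \<phi>'), Act F f x)"
      then show "h a = h b"
        using M.Act_Comp[of "FArr S f" \<phi>' "\<theta> (Dom C f) x"] \<theta>_closed[of "Dom C f" x]
        by (simp add: h_def \<theta>_nat S.FArr_Arr S.Dom_FArr S.Cod_FArr C.Dom_Obj)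
    qed
  next
    case (3 i)
    then show ?case by (rule cGrp_group)
  qed
  define \<tau> where "\<tau> = (\<lambda>d. amalg_target.amalg_lift (Grp M d) h)"
  have \<tau>_hom: "\<tau> d \<in> hom (Grp (lan C D S F) d) (Grp M d)" if "d \<in> Obj D" for d
    unfolding \<tau>_def Grp_lan by (rule amalg_target.amalg_lift_hom[OF target[OF that]])
  have \<tau>_letter: "\<tau> d (word_cong (cObj d) cGrp (cRel d) `` {[a]}) = h a"
    if "d \<in> Obj D" "a \<in> letters (cObj d) cGrp" for d a
    unfolding \<tau>_def using amalg_target.amalg_lift_class[OF target[OF that(1)], of "[a]"]
      amalg_target.word_eval_singleton[OF target[OF that(1)] that(2)] that(2) by simp
  have L: "group_diagram D (lan C D S F)" by (rule group_diagram_lan)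
  interpret L: group_diagram D "lan C D S F" by (rule L)
  have \<tau>_nat: "\<tau> (Cod D f) (Act (lan C D S F) f K) = Act M f (\<tau> (Dom D f) K)"
    if f: "f \<in> Arr D" and K: "K \<in> carrier (Grp (lan C D S F) (Dom D f))" for f K
  proof -
    interpret Lf: letter_map "cObj (Dom D f)" cGrp "cRel (Dom D f)" "cObj (Cod D f)" cGrp "cRel (Cod D f)"
      "push f" "\<lambda>(c, \<phi>). (c, Comp D f \<phi>)" "\<lambda>_ x. x" by (rule push_letter_map[OF f])
    have "(\<tau> (Cod D f) \<circ> Act (lan C D S F) f) K = (Act M f \<circ> \<tau> (Dom D f)) K"
    proof (rule hom_amalg_unique[of "Grp M (Cod D f)" "cObj (Dom D f)" cGrp _ "cRel (Dom D f)"])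
      show "group (Grp M (Cod D f))" by (rule M.Grp_group[OF D.Cod_Obj[OF f]])
      show "\<tau> (Cod D f) \<circ> Act (lan C D S F) f \<in> hom (amalg (cObj (Dom D f)) cGrp (cRel (Dom D f))) (Grp M (Cod D f))"
        using hom_compose[OF L.Act_hom[OF f] \<tau>_hom[OF D.Cod_Obj[OF f]]] by (simp add: Grp_lan)
      show "Act M f \<circ> \<tau> (Dom D f) \<in> hom (amalg (cObj (Dom D f)) cGrp (cRel (Dom D f))) (Grp M (Cod D f))"
        using hom_compose[OF \<tau>_hom[OF D.Dom_Obj[OF f]] M.Act_hom[OF f]] by (simp add: Grp_lan)
      show "K \<in> carrier (amalg (cObj (Dom D f)) cGrp (cRel (Dom D f)))" using K by (simp add: Grp_lan)
    next
      fix a assume a: "a \<in> letters (cObj (Dom D f)) cGrp"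
      then obtain c \<phi> x where a': "a = ((c, \<phi>), x)" "c \<in> Obj C" "\<phi> \<in> Arr D" "Dom D \<phi> = FObj S c"
        "Cod D \<phi> = Dom D f" "x \<in> carrier (Grp F c)"
        by (cases a) (auto simp: letters_def cObj_iff cGrp_eq)
      have "h (push f a) = Act M f (h a)"
        using M.Act_Comp[of \<phi> f "\<theta> c x"] a' f \<theta>_closed by (simp add: h_def)
      then show "(\<tau> (Cod D f) \<circ> Act (lan C D S F) f) (word_cong (cObj (Dom D f)) cGrp (cRel (Dom D f)) `` {[a]}) =
          (Act M f \<circ> \<tau> (Dom D f)) (word_cong (cObj (Dom D f)) cGrp (cRel (Dom D f)) `` {[a]})"
        using Lf.amalg_map_class[of "[a]"] a Lf.f_letters[OF a] f
        by (simp add: Act_lan \<tau>_letter D.Dom_Obj D.Cod_Obj)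
    qed (rule cGrp_group)
    then show ?thesis by simp
  qed
  have "\<tau> (FObj S c) (lan_unit C D S F c x) = \<theta> c x" if "c \<in> Obj C" "x \<in> carrier (Grp F c)" for c x
  proof -
    note Sc = S.FObj_Obj[OF that(1)]
    have "((c, Ide D (FObj S c)), x) \<in> letters (cObj (FObj S c)) cGrp"
      using that by (intro letter_in) (simp_all add: D.Ide_Arr D.Dom_Ide D.Cod_Ide Sc)
    from \<tau>_letter[OF Sc this] show ?thesis
      using M.Act_Ide[OF Sc \<theta>_closed[OF that]] by (simp add: lan_unit_def h_def)
  qed
  then show "\<exists>\<tau>. grp_natural D (lan C D S F) M \<tau> \<and>
      (\<forall>c\<in>Obj C. \<forall>x\<in>carrier (Grp F c). \<tau> (FObj S c) (lan_unit C D S F c x) = \<theta> c x)"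
    using \<tau>_hom \<tau>_nat unfolding grp_natural_def by blast
  show "\<tau> d K = \<tau>' d K"
    if nat: "grp_natural D (lan C D S F) M \<tau>" "grp_natural D (lan C D S F) M \<tau>'"
      and eq: "\<And>c x. \<lbrakk>c \<in> Obj C; x \<in> carrier (Grp F c)\<rbrakk> \<Longrightarrow>
        \<tau> (FObj S c) (lan_unit C D S F c x) = \<tau>' (FObj S c) (lan_unit C D S F c x)"
      and d: "d \<in> Obj D" and K: "K \<in> carrier (Grp (lan C D S F) d)" for \<tau> \<tau>' d K
  proof (rule hom_amalg_unique[of "Grp M d" "cObj d" cGrp _ "cRel d"])
    show "group (Grp M d)" by (rule M.Grp_group[OF d])
    show "\<tau> d \<in> hom (amalg (cObj d) cGrp (cRel d)) (Grp M d)"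
      "\<tau>' d \<in> hom (amalg (cObj d) cGrp (cRel d)) (Grp M d)"
      using nat d by (auto simp: grp_natural_def Grp_lan)
    show "K \<in> carrier (amalg (cObj d) cGrp (cRel d))" using K by (simp add: Grp_lan)
  next
    fix a assume "a \<in> letters (cObj d) cGrp"
    then obtain c \<phi> x where a: "a = ((c, \<phi>), x)" "c \<in> Obj C" "\<phi> \<in> Arr D" "Dom D \<phi> = FObj S c"
      "Cod D \<phi> = d" "x \<in> carrier (Grp F c)"
      by (cases a) (auto simp: letters_def cObj_iff cGrp_eq)
    have u: "lan_unit C D S F c x \<in> carrier (Grp (lan C D S F) (Dom D \<phi>))"
      using lan_unit_natural a by (auto simp: grp_natural_def grp_pullback_def hom_def)
    have step: "\<sigma> d (word_cong (cObj d) cGrp (cRel d) `` {[a]}) = Act M \<phi> (\<sigma> (FObj S c) (lan_unit C D S F c x))"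
      if "grp_natural D (lan C D S F) M \<sigma>" for \<sigma>
      using that Act_lan_unit[OF a(2-4,6)] u a unfolding grp_natural_def by metis
    then show "\<tau> d (word_cong (cObj d) cGrp (cRel d) `` {[a]}) = \<tau>' d (word_cong (cObj d) cGrp (cRel d) `` {[a]})"
      using step[OF nat(1)] step[OF nat(2)] eq[OF a(2,6)] by (simp only:)
  qed (rule cGrp_group)
qed

end

lemma kan_data_Q:
  assumes "simplicial_set X" "group_diagram (op_cat (simplices X)) F"
  shows "kan_data (op_cat (simplices X)) (op_cat delta) Q_functor F"
  using assms
  by (intro kan_data.intro category_op_cat category_simplices category_delta cat_functor_op_cat cat_functor_Q)


section \<open>The simplicial replacement is a simplicial group\<close>

context category
begin

lemma nerveD:
  assumes "(c, as) \<in> nerve C n"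
  shows "c \<in> Obj C" "length as = n" "\<And>k. k < n \<Longrightarrow> as ! k \<in> Arr C"
    "0 < n \<Longrightarrow> Dom C (as ! 0) = c" "\<And>k. Suc k < n \<Longrightarrow> Dom C (as ! Suc k) = Cod C (as ! k)"
  using assms by (auto simp: nerve_def nerve_vertex_def)

lemma nerveI:
  assumes "c \<in> Obj C" "length as = n" "\<And>k. k < n \<Longrightarrow> as ! k \<in> Arr C"
    "0 < n \<Longrightarrow> Dom C (as ! 0) = c" "\<And>k. Suc k < n \<Longrightarrow> Dom C (as ! Suc k) = Cod C (as ! k)"
  shows "(c, as) \<in> nerve C n"
proof -
  have "Dom C (as ! i) = nerve_vertex C (c, as) i" if "i < n" for i
    using assms(4,5) that by (cases i) (auto simp: nerve_vertex_def)
  then show ?thesis using assms(1-3) by (auto simp: nerve_def in_set_conv_nth)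
qed

lemma nerve_vertex_Obj: "\<lbrakk>(c, as) \<in> nerve C n; i \<le> n\<rbrakk> \<Longrightarrow> nerve_vertex C (c, as) i \<in> Obj C"
  using nerveD[of c as n] by (cases i) (auto simp: nerve_vertex_def Cod_Obj)

lemma fst_nerve_face: "length as = Suc n \<Longrightarrow> fst (nerve_face C i (c, as)) = (if i = 0 then Cod C (as ! 0) else c)"
  by (cases as) (auto simp: nerve_face_def)

lemma length_nerve_face: "\<lbrakk>length as = Suc n; i \<le> Suc n\<rbrakk> \<Longrightarrow> length (snd (nerve_face C i (c, as))) = n"
  by (auto simp: nerve_face_def)

lemma nth_nerve_face:
  assumes "length as = Suc n" "i \<le> Suc n" "k < n"
  shows "snd (nerve_face C i (c, as)) ! k =
    (if Suc k < i then as ! k else if Suc k = i then Comp C (as ! Suc k) (as ! k) else as ! Suc k)"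
proof -
  consider "i = 0" | "i = Suc n" | "0 < i" "i \<le> n" using assms by linarith
  then show ?thesis
  proof cases
    case 1
    then show ?thesis using assms by (auto simp: nerve_face_def nth_tl)
  next
    case 2
    then show ?thesis using assms by (auto simp: nerve_face_def nth_butlast)
  next
    case 3
    then obtain i' where i: "i = Suc i'" by (cases i) auto
    have face: "snd (nerve_face C i (c, as)) = take i' as @ Comp C (as ! i) (as ! i') # drop (Suc i) as"
      using 3 assms i by (auto simp: nerve_face_def)
    consider "k < i'" | "k = i'" | m where "k = Suc (i' + m)"
      by (metis less_imp_Suc_add linorder_neqE_nat)
    then show ?thesis
      unfolding face using assms i 3 by cases (auto simp: nth_append)
  qed
qed

lemma fst_nerve_degen: "fst (nerve_degen C i (c, as)) = c"
  by (simp add: nerve_degen_def)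

lemma length_nerve_degen: "\<lbrakk>length as = n; i \<le> n\<rbrakk> \<Longrightarrow> length (snd (nerve_degen C i (c, as))) = Suc n"
  by (auto simp: nerve_degen_def)

lemma nth_nerve_degen:
  assumes "length as = n" "i \<le> n" "k \<le> n"
  shows "snd (nerve_degen C i (c, as)) ! k =
    (if k < i then as ! k else if k = i then Ide C (nerve_vertex C (c, as) i) else as ! (k - 1))"
proof -
  consider "k < i" | "k = i" | m where "k = Suc (i + m)"
    by (metis less_imp_Suc_add linorder_neqE_nat)
  then show ?thesis
    using assms by cases (auto simp: nerve_degen_def nth_append)
qed

lemma nerve_face_in:
  assumes "(c, as) \<in> nerve C (Suc n)" "i \<le> Suc n"
  shows "nerve_face C i (c, as) \<in> nerve C n"
proof -
  note D = nerveD[OF assms(1)]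
  have "(fst (nerve_face C i (c, as)), snd (nerve_face C i (c, as))) \<in> nerve C n"
  proof (rule nerveI, goal_cases)
    case 1
    then show ?case using D by (auto simp: fst_nerve_face Cod_Obj)
  next
    case 2
    then show ?case using D assms by (simp add: length_nerve_face)
  next
    case (3 k)
    then show ?case using D assms by (auto simp: nth_nerve_face Comp_Arr)
  next
    case 4
    then show ?case using D assms by (auto simp: fst_nerve_face nth_nerve_face Dom_Comp)
  next
    case (5 k)
    then show ?case using D assms by (auto simp: nth_nerve_face Dom_Comp Cod_Comp)
  qed
  then show ?thesis by simp
qed

lemma nerve_degen_in:
  assumes "(c, as) \<in> nerve C n" "i \<le> n"
  shows "nerve_degen C i (c, as) \<in> nerve C (Suc n)"
proof -
  note D = nerveD[OF assms(1)]
  note V = nerve_vertex_Obj[OF assms]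
  have V0: "nerve_vertex C (c, as) i = (if i = 0 then c else Cod C (as ! (i - 1)))"
    by (simp add: nerve_vertex_def)
  have "(fst (nerve_degen C i (c, as)), snd (nerve_degen C i (c, as))) \<in> nerve C (Suc n)"
  proof (rule nerveI, goal_cases)
    case 1
    then show ?case using D by (simp add: fst_nerve_degen)
  next
    case 2
    then show ?case using D assms by (simp add: length_nerve_degen)
  next
    case (3 k)
    then show ?case using D assms V by (auto simp: nth_nerve_degen Ide_Arr)
  next
    case 4
    then show ?case using D assms V
      by (cases "i = 0") (auto simp: nth_nerve_degen fst_nerve_degen Dom_Ide V0 nerve_vertex_def)
  next
    case (5 k)
    consider "Suc k < i" | "Suc k = i" | "k = i" | "i < k" by linarith
    then show ?case
    proof cases
      case 4
      then obtain m where "k = Suc m" by (cases k) auto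
      then show ?thesis using 4 5 D assms by (auto simp: nth_nerve_degen)
    next
      case 3
      have "Dom C (as ! k) = nerve_vertex C (c, as) k" if "k < n"
        using D that by (cases k) (auto simp: nerve_vertex_def)
      then show ?thesis using 3 5 D assms V Cod_Ide by (auto simp: nth_nerve_degen)
    qed (use 5 D assms V Dom_Ide Cod_Ide in \<open>auto simp: nth_nerve_degen V0\<close>)
  qed
  then show ?thesis by simp
qed

lemma nerve_simplex_eqI:
  assumes "fst \<sigma> = fst \<tau>" "length (snd \<sigma>) = n" "length (snd \<tau>) = n" "\<And>k. k < n \<Longrightarrow> snd \<sigma> ! k = snd \<tau> ! k"
  shows "\<sigma> = \<tau>"
  using assms by (intro prod_eqI nth_equalityI) auto

lemma nerve_face_face:
  assumes \<sigma>: "\<sigma> \<in> nerve C (Suc (Suc n))" and ij: "i < j" "j \<le> Suc (Suc n)"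
  shows "nerve_face C i (nerve_face C j \<sigma>) = nerve_face C (j - 1) (nerve_face C i \<sigma>)"
proof -
  obtain c as where s: "\<sigma> = (c, as)" by force
  note D = nerveD[OF \<sigma>[unfolded s]]
  obtain c1 as1 where 1: "nerve_face C j (c, as) = (c1, as1)" by force
  obtain c2 as2 where 2: "nerve_face C i (c, as) = (c2, as2)" by force
  have len: "length as1 = Suc n" "length as2 = Suc n"
    using length_nerve_face[of as "Suc n" j c] length_nerve_face[of as "Suc n" i c] D ij by (auto simp: 1 2)
  have c12: "c1 = c" "c2 = (if i = 0 then Cod C (as ! 0) else c)"
    using fst_nerve_face[of as "Suc n" j c] fst_nerve_face[of as "Suc n" i c] D ij by (auto simp: 1 2)
  have n1: "as1 ! k = (if Suc k < j then as ! k else if Suc k = j then Comp C (as ! Suc k) (as ! k) else as ! Suc k)"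
    and n2: "as2 ! k = (if Suc k < i then as ! k else if Suc k = i then Comp C (as ! Suc k) (as ! k) else as ! Suc k)"
    if "k < Suc n" for k
    using nth_nerve_face[of as "Suc n" j k c] nth_nerve_face[of as "Suc n" i k c] D(2) ij that by (auto simp: 1 2)
  have "nerve_face C i (c1, as1) = nerve_face C (j - 1) (c2, as2)"
  proof (rule nerve_simplex_eqI[where n = n])
    show "fst (nerve_face C i (c1, as1)) = fst (nerve_face C (j - 1) (c2, as2))"
      using ij D by (auto simp: fst_nerve_face len c12 n1 n2 Cod_Comp)
  next
    fix k assume k: "k < n"
    have *: "k < Suc n" "Suc k < Suc n" using k by auto
    have asc: "Comp C (as ! Suc (Suc k)) (Comp C (as ! Suc k) (as ! k)) =
        Comp C (Comp C (as ! Suc (Suc k)) (as ! Suc k)) (as ! k)"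
      using k D by (intro Comp_assoc) auto
    have e: "i \<le> Suc n" "j - 1 \<le> Suc n" using ij by auto
    obtain j' where j': "j = Suc j'" using ij by (cases j) auto
    show "snd (nerve_face C i (c1, as1)) ! k = snd (nerve_face C (j - 1) (c2, as2)) ! k"
      unfolding nth_nerve_face[OF len(1) e(1) k] nth_nerve_face[OF len(2) e(2) k] n1[OF *(1)] n1[OF *(2)]
        n2[OF *(1)] n2[OF *(2)]
      using ij asc unfolding j' by auto
  qed (use ij len in \<open>auto simp: length_nerve_face\<close>)
  then show ?thesis by (simp add: s 1 2)
qed

lemma nerve_face_degen:
  assumes \<sigma>: "\<sigma> \<in> nerve C n" and ij: "j \<le> n" "i \<le> Suc n"
  shows "nerve_face C i (nerve_degen C j \<sigma>) =
    (if i < j then nerve_degen C (j - 1) (nerve_face C i \<sigma>)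
     else if i \<le> Suc j then \<sigma> else nerve_degen C j (nerve_face C (i - 1) \<sigma>))"
proof -
  obtain c as where s: "\<sigma> = (c, as)" by force
  note D = nerveD[OF \<sigma>[unfolded s]]
  obtain c1 as1 where e1: "nerve_degen C j (c, as) = (c1, as1)" by force
  have len1: "length as1 = Suc n" using length_nerve_degen[of as n j c] D ij by (simp add: e1)
  have c1: "c1 = c" using fst_nerve_degen[of j c as] by (simp add: e1)
  have n1: "as1 ! k = (if k < j then as ! k else if k = j then Ide C (nerve_vertex C (c, as) j) else as ! (k - 1))"
    if "k \<le> n" for k
    using nth_nerve_degen[of as n j k c] D ij that by (simp add: e1)
  have v0: "nerve_vertex C (c, as) 0 = c" by (simp add: nerve_vertex_def)
  have vS: "nerve_vertex C (c, as) (Suc k) = Cod C (as ! k)" for k by (simp add: nerve_vertex_def)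
  have v: "nerve_vertex C (c, as) k = Dom C (as ! k)" if "k < n" for k
    using D that by (cases k) (auto simp: nerve_vertex_def)
  have IC: "Comp C (Ide C (Cod C (as ! k))) (as ! k) = as ! k" "Comp C (as ! k) (Ide C (Dom C (as ! k))) = as ! k"
    if "k < n" for k using D that by (auto simp: Comp_Ide Ide_Comp)
  have mid: "snd (nerve_face C i (c1, as1)) ! k = as ! k" if "k < n" "i = j \<or> i = Suc j" for k
  proof -
    have k: "k \<le> n" "Suc k \<le> n" using that by auto
    show ?thesis
      unfolding nth_nerve_face[OF len1 ij(2) that(1)] n1[OF k(1)] n1[OF k(2)]
      using that ij IC[of k] v[of k] vS[of k] by (auto simp: le_Suc_eq)
  qed
  consider "i = j \<or> i = Suc j" | "i < j" | "Suc j < i" by linarith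
  then show ?thesis
  proof cases
    case 1
    have "nerve_face C i (c1, as1) = (c, as)"
    proof (rule nerve_simplex_eqI[where n = n])
      show "fst (nerve_face C i (c1, as1)) = fst (c, as)"
        using 1 D(1) ij by (auto simp: fst_nerve_face[OF len1] c1 n1 v0 Cod_Ide)
    qed (use ij len1 D mid[OF _ 1] in \<open>auto simp: length_nerve_face\<close>)
    then show ?thesis using 1 by (auto simp: s e1)
  next
    case 2
    then obtain m where m: "n = Suc m" using ij by (cases n) auto
    obtain j' where j': "j = Suc j'" using 2 by (cases j) auto
    obtain c2 as2 where e2: "nerve_face C i (c, as) = (c2, as2)" by force
    have ilm: "i \<le> Suc m" "j' \<le> m" using 2 ij m j' by auto
    have len: "length as = Suc m" using D m by simp
    have len2: "length as2 = m" using length_nerve_face[OF len ilm(1), of c] by (simp add: e2)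
    have c2: "c2 = (if i = 0 then Cod C (as ! 0) else c)" using fst_nerve_face[OF len, of i c] by (simp add: e2)
    have n2: "as2 ! k = (if Suc k < i then as ! k else if Suc k = i then Comp C (as ! Suc k) (as ! k) else as ! Suc k)"
      if "k < m" for k using nth_nerve_face[OF len ilm(1) that, of c] by (simp add: e2)
    have vv: "nerve_vertex C (c2, as2) j' = nerve_vertex C (c, as) j"
    proof (cases j')
      case 0
      then show ?thesis using 2 by (simp add: nerve_vertex_def j' c2)
    next
      case (Suc l)
      then have l: "l < m" using ilm by simp
      have "Cod C (Comp C (as ! Suc l) (as ! l)) = Cod C (as ! Suc l)"
        using D l m by (intro Cod_Comp) auto
      then show ?thesis using 2 Suc n2[OF l] by (auto simp: nerve_vertex_def j')
    qed
    have "nerve_face C i (c1, as1) = nerve_degen C j' (c2, as2)"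
    proof (rule nerve_simplex_eqI[where n = n])
      show "fst (nerve_face C i (c1, as1)) = fst (nerve_degen C j' (c2, as2))"
        using 2 by (auto simp: fst_nerve_face[OF len1] fst_nerve_degen c1 c2 n1)
    next
      fix k assume k: "k < n"
      then have k': "k \<le> n" "Suc k \<le> n" "k \<le> m" using m by auto
      consider "k < j'" | "k = j'" | l where "k = Suc l" "j' \<le> l" by (metis Suc_leI less_imp_Suc_add linorder_neqE_nat le_add1)
      then show "snd (nerve_face C i (c1, as1)) ! k = snd (nerve_degen C j' (c2, as2)) ! k"
        unfolding nth_nerve_face[OF len1 ij(2) k] n1[OF k'(1)] n1[OF k'(2)] nth_nerve_degen[OF len2 ilm(2) k'(3)] vv
        using 2 n2[of k] n2[of "k - 1"] k m ilm j' by cases auto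
    qed (use ij len1 len2 m ilm in \<open>auto simp: length_nerve_face length_nerve_degen\<close>)
    then show ?thesis using 2 e1 by (simp add: s j' e2)
  next
    case 3
    then obtain m where m: "n = Suc m" using ij by (cases n) auto
    obtain i' where i': "i = Suc i'" using 3 by (cases i) auto
    obtain c2 as2 where e2: "nerve_face C i' (c, as) = (c2, as2)" by force
    have ilm: "i' \<le> Suc m" "j \<le> m" "0 < i'" "j < i'" using 3 ij m i' by auto
    have len: "length as = Suc m" using D m by simp
    have len2: "length as2 = m" using length_nerve_face[OF len ilm(1), of c] by (simp add: e2)
    have c2: "c2 = c" using fst_nerve_face[OF len, of i' c] ilm by (simp add: e2)
    have n2: "as2 ! k = (if Suc k < i' then as ! k else if Suc k = i' then Comp C (as ! Suc k) (as ! k) else as ! Suc k)"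
      if "k < m" for k using nth_nerve_face[OF len ilm(1) that, of c] by (simp add: e2)
    have vv: "nerve_vertex C (c2, as2) j = nerve_vertex C (c, as) j"
    proof (cases j)
      case 0
      then show ?thesis by (simp add: nerve_vertex_def c2)
    next
      case (Suc l)
      then have "l < m" "Suc l < i'" using ilm by simp_all
      then show ?thesis using n2[of l] by (simp add: nerve_vertex_def Suc)
    qed
    have "nerve_face C i (c1, as1) = nerve_degen C j (c2, as2)"
    proof (rule nerve_simplex_eqI[where n = n])
      show "fst (nerve_face C i (c1, as1)) = fst (nerve_degen C j (c2, as2))"
        using 3 by (auto simp: fst_nerve_face[OF len1] fst_nerve_degen c1 c2)
    next
      fix k assume k: "k < n"
      then have k': "k \<le> n" "Suc k \<le> n" "k \<le> m" using m by auto
      consider "k < j" | "k = j" | l where "k = Suc l" "j \<le> l" by (metis Suc_leI less_imp_Suc_add linorder_neqE_nat le_add1)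
      then show "snd (nerve_face C i (c1, as1)) ! k = snd (nerve_degen C j (c2, as2)) ! k"
        unfolding nth_nerve_face[OF len1 ij(2) k] n1[OF k'(1)] n1[OF k'(2)] nth_nerve_degen[OF len2 ilm(2) k'(3)] vv
        using 3 n2[of k] n2[of "k - 1"] k m ilm i' by cases auto
    qed (use ij len1 len2 m ilm in \<open>auto simp: length_nerve_face length_nerve_degen\<close>)
    then show ?thesis using 3 i' by (simp add: s e1 e2)
  qed
qed

lemma nerve_degen_degen:
  assumes \<sigma>: "\<sigma> \<in> nerve C n" and ij: "i \<le> j" "j \<le> n"
  shows "nerve_degen C i (nerve_degen C j \<sigma>) = nerve_degen C (Suc j) (nerve_degen C i \<sigma>)"
proof -
  obtain c as where s: "\<sigma> = (c, as)" by force
  note D = nerveD[OF \<sigma>[unfolded s]]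
  have i: "i \<le> n" "i \<le> Suc n" "Suc j \<le> Suc n" using ij by auto
  obtain c1 as1 where 1: "nerve_degen C j (c, as) = (c1, as1)" by force
  obtain c2 as2 where 2: "nerve_degen C i (c, as) = (c2, as2)" by force
  have len: "length as1 = Suc n" "length as2 = Suc n"
    using length_nerve_degen[OF D(2), of j c] length_nerve_degen[OF D(2), of i c] i ij by (auto simp: 1 2)
  have c: "c1 = c" "c2 = c" using fst_nerve_degen[of j c as] fst_nerve_degen[of i c as] by (auto simp: 1 2)
  have n1: "as1 ! k = (if k < j then as ! k else if k = j then Ide C (nerve_vertex C (c, as) j) else as ! (k - 1))"
    and n2: "as2 ! k = (if k < i then as ! k else if k = i then Ide C (nerve_vertex C (c, as) i) else as ! (k - 1))"
    if "k \<le> n" for k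
    using nth_nerve_degen[OF D(2) ij(2) that, of c] nth_nerve_degen[OF D(2) i(1) that, of c] by (simp_all add: 1 2)
  have "Cod C (Ide C (nerve_vertex C (c, as) i)) = nerve_vertex C (c, as) i"
    using nerve_vertex_Obj[OF \<sigma>[unfolded s] i(1)] by (rule Cod_Ide)
  then have v2: "nerve_vertex C (c2, as2) (Suc j) = nerve_vertex C (c, as) j"
    using n2[of j] ij unfolding nerve_vertex_def by auto
  have v1: "nerve_vertex C (c1, as1) i = nerve_vertex C (c, as) i"
    using n1[of "i - 1"] ij unfolding nerve_vertex_def by (auto simp: c)
  have "nerve_degen C i (c1, as1) = nerve_degen C (Suc j) (c2, as2)"
  proof (rule nerve_simplex_eqI[where n = "Suc (Suc n)"])
    fix k assume "k < Suc (Suc n)"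
    then have k: "k \<le> Suc n" by simp
    consider "k < i" | "k = i" | l where "k = Suc l" "i \<le> l" by (metis Suc_leI less_imp_Suc_add linorder_neqE_nat le_add1)
    then show "snd (nerve_degen C i (c1, as1)) ! k = snd (nerve_degen C (Suc j) (c2, as2)) ! k"
      unfolding nth_nerve_degen[OF len(1) i(2) k] nth_nerve_degen[OF len(2) i(3) k] v1 v2
    proof cases
      case 1
      then show "(if k < i then as1 ! k else if k = i then Ide C (nerve_vertex C (c, as) i) else as1 ! (k - 1)) =
        (if k < Suc j then as2 ! k else if k = Suc j then Ide C (nerve_vertex C (c, as) j) else as2 ! (k - 1))"
        using n1[of k] n2[of k] ij by auto
    next
      case 2
      then show "(if k < i then as1 ! k else if k = i then Ide C (nerve_vertex C (c, as) i) else as1 ! (k - 1)) =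
        (if k < Suc j then as2 ! k else if k = Suc j then Ide C (nerve_vertex C (c, as) j) else as2 ! (k - 1))"
        using n1[of k] n2[of k] ij by auto
    next
      case (3 l)
      then show "(if k < i then as1 ! k else if k = i then Ide C (nerve_vertex C (c, as) i) else as1 ! (k - 1)) =
        (if k < Suc j then as2 ! k else if k = Suc j then Ide C (nerve_vertex C (c, as) j) else as2 ! (k - 1))"
        using n1[of l] n2[of l] n2[of "Suc l"] ij k by auto
    qed
  qed (use i len in \<open>auto simp: length_nerve_degen fst_nerve_degen c\<close>)
  then show ?thesis by (simp add: s 1 2)
qed

end

locale replacement_data = C: category C + F: group_diagram C F
  for C :: "('o, 'm) cat" and F :: "('o, 'm, 'g) grp_diagram"
begin

abbreviation "nGrp \<equiv> (\<lambda>(c, as :: 'm list). Grp F c)"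
abbreviation "face_letter i \<equiv> (\<lambda>((c, as), x). (nerve_face C i (c, as), if i = 0 then Act F (hd as) x else x))"
abbreviation "degen_letter i \<equiv> (\<lambda>((c, as), x). (nerve_degen C i (c, as), x))"

lemma nGrp_group: "\<sigma> \<in> nerve C n \<Longrightarrow> group (nGrp \<sigma>)"
  by (cases \<sigma>) (simp add: nerve_def F.Grp_group)

lemma nGrp_fst: "nGrp \<sigma> = Grp F (fst \<sigma>)"
  by (cases \<sigma>) simp

lemma face_letter_map:
  assumes "i \<le> Suc n"
  shows "letter_map (nerve C (Suc n)) nGrp {} (nerve C n) nGrp {} (face_letter i) (nerve_face C i)
    (\<lambda>(c, as). if i = 0 then Act F (hd as) else (\<lambda>x. x))"
proof (intro letter_map.intro nGrp_group, goal_cases)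
  case (1 j x)
  show ?case by (cases j) simp
next
  case (2 j)
  then show ?case using assms by (cases j) (simp add: C.nerve_face_in)
next
  case (3 j)
  obtain c as where j: "j = (c, as)" by force
  note D = C.nerveD[OF 3[unfolded j]]
  have "hd as = as ! 0" using D(2) by (intro hd_conv_nth) auto
  then show ?case
    using C.fst_nerve_face[OF D(2), of i c] F.Act_hom[of "as ! 0"] D(3)[of 0] D(4)
    by (auto simp: nGrp_fst j) (simp_all add: hom_def)
qed auto

lemma degen_letter_map:
  assumes "i \<le> n"
  shows "letter_map (nerve C n) nGrp {} (nerve C (Suc n)) nGrp {} (degen_letter i) (nerve_degen C i) (\<lambda>_ x. x)"
proof (intro letter_map.intro nGrp_group, goal_cases)
  case (1 j x)
  show ?case by (cases j) simp
next
  case (2 j)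
  then show ?case using assms by (cases j) (simp add: C.nerve_degen_in)
next
  case (3 j)
  then show ?case by (cases j) (simp add: nGrp_fst C.fst_nerve_degen hom_def)
qed auto

abbreviation "word_class n w \<equiv> word_cong (nerve C n) nGrp {} `` {w}"
abbreviation "nlists n \<equiv> lists (letters (nerve C n) nGrp)"
abbreviation "R \<equiv> simplicial_replacement C F"

lemma Level_R: "Level R n = amalg (nerve C n) nGrp {}"
  by (simp add: simplicial_replacement_def free_prod_def)

lemma Face_R: "Face R (Suc n) i = amalg_map (nerve C n) nGrp {} (face_letter i)"
  by (simp add: simplicial_replacement_def free_prod_map_def)

lemma Degen_R: "Degen R n i = amalg_map (nerve C (Suc n)) nGrp {} (degen_letter i)"
  by (simp add: simplicial_replacement_def free_prod_map_def)

lemma Face_R_class: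
  assumes "i \<le> Suc n" "w \<in> nlists (Suc n)"
  shows "Face R (Suc n) i (word_class (Suc n) w) = word_class n (map (face_letter i) w)"
    "map (face_letter i) w \<in> nlists n"
  unfolding Face_R using letter_map.amalg_map_class[OF face_letter_map[OF assms(1)] assms(2)]
    letter_map.map_f_lists[OF face_letter_map[OF assms(1)] assms(2)] by auto

lemma Degen_R_class:
  assumes "i \<le> n" "w \<in> nlists n"
  shows "Degen R n i (word_class n w) = word_class (Suc n) (map (degen_letter i) w)"
    "map (degen_letter i) w \<in> nlists (Suc n)"
  unfolding Degen_R using letter_map.amalg_map_class[OF degen_letter_map[OF assms(1)] assms(2)]
    letter_map.map_f_lists[OF degen_letter_map[OF assms(1)] assms(2)] by auto

lemma Level_R_E:
  assumes "K \<in> carrier (Level R n)"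
  obtains w where "w \<in> nlists n" "K = word_class n w"
  using assms unfolding Level_R by (rule amalg_classE)

lemma letterE:
  assumes "w \<in> nlists n" "a \<in> set w"
  obtains c as x where "a = ((c, as), x)" "(c, as) \<in> nerve C n" "x \<in> carrier (Grp F c)"
proof -
  have "a \<in> letters (nerve C n) nGrp" using assms by auto
  then show thesis using that by (auto simp: letters_def)
qed

lemma hd_face:
  assumes "length as = Suc (Suc n)" "0 < i" "i \<le> Suc (Suc n)"
  shows "hd (snd (nerve_face C i (c, as))) = (if i = 1 then Comp C (as ! 1) (as ! 0) else as ! 0)"
    and "hd (snd (nerve_face C 0 (c, as))) = as ! 1"
proof -
  have "hd (snd (nerve_face C i (c, as))) = snd (nerve_face C i (c, as)) ! 0" if "i \<le> Suc (Suc n)" for i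
    using C.length_nerve_face[OF assms(1) that, of c] by (intro hd_conv_nth) auto
  then show "hd (snd (nerve_face C i (c, as))) = (if i = 1 then Comp C (as ! 1) (as ! 0) else as ! 0)"
    "hd (snd (nerve_face C 0 (c, as))) = as ! 1"
    using C.nth_nerve_face[OF assms(1), of _ 0 c] assms by auto
qed

lemma hd_degen:
  assumes "length as = n" "i \<le> n"
  shows "hd (snd (nerve_degen C i (c, as))) = (if i = 0 then Ide C c else as ! 0)"
proof -
  have "hd (snd (nerve_degen C i (c, as))) = snd (nerve_degen C i (c, as)) ! 0"
    using C.length_nerve_degen[OF assms, of c] by (intro hd_conv_nth) auto
  then show ?thesis using C.nth_nerve_degen[OF assms, of 0 c] assms by (auto simp: nerve_vertex_def)
qed

lemma face_letter_eq: "face_letter i (\<sigma>, x) = (nerve_face C i \<sigma>, if i = 0 then Act F (hd (snd \<sigma>)) x else x)"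
  by (cases \<sigma>) simp

lemma degen_letter_eq: "degen_letter i (\<sigma>, x) = (nerve_degen C i \<sigma>, x)"
  by (cases \<sigma>) simp

lemma simplicial_group_R: "simplicial_group R"
proof (intro simplicial_group.intro, goal_cases)
  case (1 n)
  show ?case unfolding Level_R by (rule group_amalg) (rule nGrp_group)
next
  case (2 i n)
  show ?case unfolding Level_R Face_R by (rule letter_map.amalg_map_hom[OF face_letter_map[OF 2]])
next
  case (3 i n)
  show ?case unfolding Level_R Degen_R by (rule letter_map.amalg_map_hom[OF degen_letter_map[OF 3]])
next
  case (4 i j n K)
  from 4(3) obtain w where w: "w \<in> nlists (Suc (Suc n))" "K = word_class (Suc (Suc n)) w" by (rule Level_R_E)
  have le: "i \<le> Suc n" "i \<le> Suc (Suc n)" "j - 1 \<le> Suc n" using 4 by auto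
  have "map (face_letter i) (map (face_letter j) w) = map (face_letter (j - 1)) (map (face_letter i) w)"
    unfolding map_map
  proof (rule map_cong[OF HOL.refl])
    fix a assume "a \<in> set w"
    with w(1) obtain c as x where a: "a = ((c, as), x)" "(c, as) \<in> nerve C (Suc (Suc n))" "x \<in> carrier (Grp F c)"
      by (rule letterE)
    note D = C.nerveD[OF a(2)]
    have hd: "hd as = as ! 0" using D(2) by (intro hd_conv_nth) auto
    have "Act F (Comp C (as ! 1) (as ! 0)) x = Act F (as ! 1) (Act F (as ! 0) x)"
      using D(3)[of 0] D(3)[of 1] D(4) D(5)[of 0] a(3) by (intro F.Act_Comp) auto
    then show "(face_letter i \<circ> face_letter j) a = (face_letter (j - 1) \<circ> face_letter i) a"
      unfolding a(1) o_apply face_letter_eq C.nerve_face_face[OF a(2) 4(1,2)]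
      using hd_face[OF D(2), of j c] 4(1,2) hd by auto
  qed
  then show ?case unfolding w(2)
    by (simp only: Face_R_class[OF 4(2) w(1)] Face_R_class[OF le(2) w(1)]
      Face_R_class[OF le(1) Face_R_class(2)[OF 4(2) w(1)]] Face_R_class[OF le(3) Face_R_class(2)[OF le(2) w(1)]])
next
  case (5 i j n K)
  from 5(3) obtain w where w: "w \<in> nlists (Suc n)" "K = word_class (Suc n) w" by (rule Level_R_E)
  have le: "i \<le> Suc n" "i \<le> Suc (Suc n)" "j - 1 \<le> n" using 5 by auto
  have "map (face_letter i) (map (degen_letter j) w) = map (degen_letter (j - 1)) (map (face_letter i) w)"
    unfolding map_map
  proof (rule map_cong[OF HOL.refl])
    fix a assume "a \<in> set w"
    with w(1) obtain c as x where a: "a = ((c, as), x)" "(c, as) \<in> nerve C (Suc n)" "x \<in> carrier (Grp F c)"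
      by (rule letterE)
    note D = C.nerveD[OF a(2)]
    have hd: "hd as = as ! 0" using D(2) by (intro hd_conv_nth) auto
    show "(face_letter i \<circ> degen_letter j) a = (degen_letter (j - 1) \<circ> face_letter i) a"
      unfolding a(1) o_apply face_letter_eq degen_letter_eq C.nerve_face_degen[OF a(2) 5(2) le(2)]
      using hd_degen[OF D(2) 5(2), of c] 5(1) hd by auto
  qed
  then show ?case unfolding w(2)
    by (simp only: Degen_R_class[OF 5(2) w(1)] Face_R_class[OF le(1) w(1)]
      Face_R_class[OF le(2) Degen_R_class(2)[OF 5(2) w(1)]] Degen_R_class[OF le(3) Face_R_class(2)[OF le(1) w(1)]])
next
  case (6 i j n K)
  from 6(3) obtain w where w: "w \<in> nlists n" "K = word_class n w" by (rule Level_R_E)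
  have le: "i \<le> Suc n" using 6 by auto
  have "map (face_letter i) (map (degen_letter j) w) = map id w"
    unfolding map_map
  proof (rule map_cong[OF HOL.refl])
    fix a assume "a \<in> set w"
    with w(1) obtain c as x where a: "a = ((c, as), x)" "(c, as) \<in> nerve C n" "x \<in> carrier (Grp F c)"
      by (rule letterE)
    note D = C.nerveD[OF a(2)]
    show "(face_letter i \<circ> degen_letter j) a = id a"
      unfolding a(1) o_apply face_letter_eq degen_letter_eq C.nerve_face_degen[OF a(2) 6(2) le]
      using hd_degen[OF D(2) 6(2), of c] 6(1) F.Act_Ide[OF D(1) a(3)] by auto
  qed
  then show ?case unfolding w(2)
    by (simp only: Degen_R_class[OF 6(2) w(1)] Face_R_class[OF le Degen_R_class(2)[OF 6(2) w(1)]] list.map_id0 id_apply)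
next
  case (7 j i n K)
  from 7(3) obtain w where w: "w \<in> nlists (Suc n)" "K = word_class (Suc n) w" by (rule Level_R_E)
  have le: "j \<le> Suc n" "i - 1 \<le> Suc n" "j \<le> n" using 7 by auto
  have "map (face_letter i) (map (degen_letter j) w) = map (degen_letter j) (map (face_letter (i - 1)) w)"
    unfolding map_map
  proof (rule map_cong[OF HOL.refl])
    fix a assume "a \<in> set w"
    with w(1) obtain c as x where a: "a = ((c, as), x)" "(c, as) \<in> nerve C (Suc n)" "x \<in> carrier (Grp F c)"
      by (rule letterE)
    show "(face_letter i \<circ> degen_letter j) a = (degen_letter j \<circ> face_letter (i - 1)) a"
      unfolding a(1) o_apply face_letter_eq degen_letter_eq C.nerve_face_degen[OF a(2) le(1) 7(2)]
      using 7(1) by auto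
  qed
  then show ?case unfolding w(2)
    by (simp only: Degen_R_class[OF le(1) w(1)] Face_R_class[OF le(2) w(1)]
      Face_R_class[OF 7(2) Degen_R_class(2)[OF le(1) w(1)]] Degen_R_class[OF le(3) Face_R_class(2)[OF le(2) w(1)]])
next
  case (8 i j n K)
  from 8(3) obtain w where w: "w \<in> nlists n" "K = word_class n w" by (rule Level_R_E)
  have le: "i \<le> n" "i \<le> Suc n" "Suc j \<le> Suc n" using 8 by auto
  have "map (degen_letter i) (map (degen_letter j) w) = map (degen_letter (Suc j)) (map (degen_letter i) w)"
    unfolding map_map
  proof (rule map_cong[OF HOL.refl])
    fix a assume "a \<in> set w"
    with w(1) obtain c as x where a: "a = ((c, as), x)" "(c, as) \<in> nerve C n" "x \<in> carrier (Grp F c)"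
      by (rule letterE)
    show "(degen_letter i \<circ> degen_letter j) a = (degen_letter (Suc j) \<circ> degen_letter i) a"
      unfolding a(1) o_apply degen_letter_eq C.nerve_degen_degen[OF a(2) 8(1,2)] ..
  qed
  then show ?case unfolding w(2)
    by (simp only: Degen_R_class[OF 8(2) w(1)] Degen_R_class[OF le(1) w(1)]
      Degen_R_class[OF le(2) Degen_R_class(2)[OF 8(2) w(1)]] Degen_R_class[OF le(3) Degen_R_class(2)[OF le(1) w(1)]])
qed

end

lemma group_colim_n:
  assumes "category C" "group_diagram C F" shows "group (colim_n n C F)"
  unfolding colim_n_def using assms
  by (intro simplicial_group.group_homotopy_group replacement_data.simplicial_group_R replacement_data.intro)

lemma group_sset_homology:
  assumes "simplicial_set X" "group_diagram (op_cat (simplices X)) F"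
  shows "group (sset_homology n X F)"
  unfolding sset_homology_def lan_Q_def
  by (intro group_colim_n category_op_cat category_delta kan_data.group_diagram_lan kan_data_Q assms)

lemma group_homotopy_group_lan_Q:
  assumes "simplicial_set X" "group_diagram (op_cat (simplices X)) F"
  shows "group (homotopy_group n (sgroup_of (lan_Q X F)))"
  unfolding lan_Q_def
  by (intro simplicial_group.group_homotopy_group simplicial_group_sgroup_of
      kan_data.group_diagram_lan kan_data_Q assms)

end

theory Submission
  imports Defs "HOL-Algebra.Generated_Groups"
begin

text \<open>Both isomorphisms are instances of one statement.  Let \<open>S : C \<rightarrow> \<Delta>\<^sup>o\<^sup>p\<close> be a discrete opfibration (every
arrow starting at \<open>S c\<close> lifts uniquely to an arrow starting at \<open>c\<close>), let \<open>F\<close> be a group diagram on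
\<open>C\<close>, and let \<open>T\<close> be the left Kan extension of \<open>F\<close> along \<open>S\<close>; because of the unique lifts, \<open>T\<^sub>q\<close>
is the free product of the groups \<open>F c\<close> over the fibre \<open>S c = q\<close>.  Then \<open>colim\<^sub>n F\<close> is isomorphic to
\<open>\<pi>\<^sub>n T\<close> (\<open>colim_n_iso\<close>).  The functor \<open>Q\<^sub>X\<close> is such an opfibration, and so is the identity of
\<open>\<Delta>\<^sup>o\<^sup>p\<close>, along which every diagram is its own extension.

The simplicial replacement of \<open>F\<close> and \<open>T\<close> are compared through a bisimplicial group \<open>B\<close>: its group
\<open>B\<^sub>p\<^sub>,\<^sub>q\<close> is the free product of copies of \<open>F c\<^sub>0\<close> over all chains \<open>c\<^sub>0 \<rightarrow> \<dots> \<rightarrow> c\<^sub>p\<close> of \<open>C\<close> together with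
an arrow \<open>\<phi> : S c\<^sub>p \<rightarrow> q\<close> of \<open>\<Delta>\<^sup>o\<^sup>p\<close>, that is, a \<open>q\<close>-simplex of the standard simplex \<open>S c\<^sub>p\<close>.  For fixed
\<open>q\<close>, evaluation maps \<open>B\<^sub>*\<^sub>,\<^sub>q\<close> to \<open>T\<^sub>q\<close>, and appending the lift of \<open>\<phi>\<close> to a chain is an extra degeneracy
(\<open>contracted_to_extension\<close>).  For fixed \<open>p\<close>, forgetting \<open>\<phi>\<close> maps \<open>B\<^sub>p\<^sub>,\<^sub>*\<close> to level \<open>p\<close> of the
replacement, and the standard simplices have an extra degeneracy that repeats the top vertex
(\<open>contracted_to_replacement\<close>).  Neither extra degeneracy is natural in the other index.

Hence a principle is required that passes from the columns of a bisimplicial group to its diagonal.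
A surjective simplicial homomorphism with acyclic kernel induces isomorphisms of homotopy groups
(\<open>homotopy_group_iso\<close>), and the kernel of an augmentation with an extra degeneracy is
a bisimplicial group with acyclic columns, so that it suffices that the diagonal of such
a bisimplicial group \<open>K\<close> is acyclic (\<open>acyclic_diag\<close>).  This is done by dimension shifting.  Take the decalage in
both directions, restricted to paths that end at \<open>1\<close> in the column direction; dropping the last
vertices is a surjection of this bisimplicial group \<open>E\<close> onto \<open>K\<close>, whose kernel has acyclic columns again.  The
diagonal of \<open>E\<close> is acyclic because the last degeneracy \<open>s\<^sub>n\<^sub>+\<^sub>1\<close> of the diagonal of \<open>K\<close> contracts it,
so \<open>\<pi>\<^sub>n\<close> of the diagonal of \<open>K\<close> is \<open>\<pi>\<^sub>n\<^sub>-\<^sub>1\<close> of the diagonal of the kernel, which vanishes by induction.\<close>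

section \<open>Simplicial groups: exactness of the Moore complex\<close>

definition acyclic_at :: "'g sgroup \<Rightarrow> nat \<Rightarrow> bool" where
  "acyclic_at G n \<longleftrightarrow> cycles G n \<subseteq> boundaries G n"

lemma cycles_0: "cycles G 0 = carrier (Level G 0)"
  by (auto simp: cycles_def moore_def)

lemma moore_Suc: "x \<in> moore G (Suc n) \<longleftrightarrow>
    x \<in> carrier (Level G (Suc n)) \<and> (\<forall>i\<le>n. Face G (Suc n) i x = \<one>\<^bsub>Level G n\<^esub>)"
  by (auto simp: moore_def less_Suc_eq_le)

lemma cycles_Suc: "x \<in> cycles G (Suc n) \<longleftrightarrow>
    x \<in> carrier (Level G (Suc n)) \<and> (\<forall>i\<le>Suc n. Face G (Suc n) i x = \<one>\<^bsub>Level G n\<^esub>)"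
  by (auto simp: cycles_def moore_Suc le_Suc_eq)

lemma cycles_carrier: "x \<in> cycles G n \<Longrightarrow> x \<in> carrier (Level G n)"
  by (simp add: cycles_def moore_def)

lemma moore_carrier: "x \<in> moore G n \<Longrightarrow> x \<in> carrier (Level G n)"
  by (simp add: moore_def)

lemma cycles_iff_moore: "x \<in> cycles G (Suc n) \<longleftrightarrow>
    x \<in> moore G (Suc n) \<and> Face G (Suc n) (Suc n) x = \<one>\<^bsub>Level G n\<^esub>"
  by (simp add: cycles_def)

lemma boundariesE:
  assumes "x \<in> boundaries G n"
  obtains z where "z \<in> moore G (Suc n)" "Face G (Suc n) (Suc n) z = x"
  using assms by (auto simp: boundaries_def)

lemma boundariesI: "z \<in> moore G (Suc n) \<Longrightarrow> Face G (Suc n) (Suc n) z = x \<Longrightarrow> x \<in> boundaries G n"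
  by (auto simp: boundaries_def)

context simplicial_group
begin

lemma Face_one: "i \<le> Suc n \<Longrightarrow> Face G (Suc n) i \<one>\<^bsub>Level G (Suc n)\<^esub> = \<one>\<^bsub>Level G n\<^esub>"
  using hom_one[OF Face_hom Level_group Level_group] .

lemma Degen_one: "i \<le> n \<Longrightarrow> Degen G n i \<one>\<^bsub>Level G n\<^esub> = \<one>\<^bsub>Level G (Suc n)\<^esub>"
  using hom_one[OF Degen_hom Level_group Level_group] .

lemma Face_mult: "\<lbrakk>i \<le> Suc n; x \<in> carrier (Level G (Suc n)); y \<in> carrier (Level G (Suc n))\<rbrakk>
    \<Longrightarrow> Face G (Suc n) i (x \<otimes>\<^bsub>Level G (Suc n)\<^esub> y) = Face G (Suc n) i x \<otimes>\<^bsub>Level G n\<^esub> Face G (Suc n) i y"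
  using hom_mult[OF Face_hom] .

lemma Face_inv: "\<lbrakk>i \<le> Suc n; x \<in> carrier (Level G (Suc n))\<rbrakk>
    \<Longrightarrow> Face G (Suc n) i (inv\<^bsub>Level G (Suc n)\<^esub> x) = inv\<^bsub>Level G n\<^esub> Face G (Suc n) i x"
  using group_hom.hom_inv[OF Face_group_hom] .

lemma moore_mult: "\<lbrakk>x \<in> moore G n; y \<in> moore G n\<rbrakk> \<Longrightarrow> x \<otimes>\<^bsub>Level G n\<^esub> y \<in> moore G n"
  using subgroup.m_closed[OF moore_subgroup] .

lemma moore_inv: "x \<in> moore G n \<Longrightarrow> inv\<^bsub>Level G n\<^esub> x \<in> moore G n"
  using subgroup.m_inv_closed[OF moore_subgroup] .

lemma moore_top_cycle: "x \<in> moore G (Suc n) \<Longrightarrow> Face G (Suc n) (Suc n) x \<in> cycles G n"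
  using boundaries_subset[of n] by (auto simp: boundaries_def)

end

section \<open>Simplicial subgroups and decalage\<close>

definition sub_sgroup :: "'g sgroup \<Rightarrow> (nat \<Rightarrow> 'g set) \<Rightarrow> 'g sgroup" where
  "sub_sgroup G H = \<lparr>Level = (\<lambda>n. (Level G n)\<lparr>carrier := H n\<rparr>), Face = Face G, Degen = Degen G\<rparr>"

lemma sub_sgroup_simps [simp]:
  "Level (sub_sgroup G H) n = (Level G n)\<lparr>carrier := H n\<rparr>"
  "Face (sub_sgroup G H) = Face G" "Degen (sub_sgroup G H) = Degen G"
  by (simp_all add: sub_sgroup_def)

lemma cycles_sub_sgroup:
  "H n \<subseteq> carrier (Level G n) \<Longrightarrow> x \<in> cycles (sub_sgroup G H) n \<longleftrightarrow> x \<in> cycles G n \<and> x \<in> H n"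
  by (cases n) (auto simp: cycles_0 cycles_Suc)

lemma moore_sub_sgroup:
  "H n \<subseteq> carrier (Level G n) \<Longrightarrow> x \<in> moore (sub_sgroup G H) n \<longleftrightarrow> x \<in> moore G n \<and> x \<in> H n"
  by (auto simp: moore_def)

lemma (in simplicial_group) simplicial_group_sub_sgroup:
  assumes H: "\<And>n. subgroup (H n) (Level G n)"
    and face: "\<And>n i x. \<lbrakk>i \<le> Suc n; x \<in> H (Suc n)\<rbrakk> \<Longrightarrow> Face G (Suc n) i x \<in> H n"
    and degen: "\<And>n i x. \<lbrakk>i \<le> n; x \<in> H n\<rbrakk> \<Longrightarrow> Degen G n i x \<in> H (Suc n)"
  shows "simplicial_group (sub_sgroup G H)"
proof -
  have sub: "x \<in> carrier (Level G n)" if "x \<in> H n" for n x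
    using subgroup.mem_carrier[OF H that] .
  show ?thesis
    by (intro simplicial_group.intro homI;
        simp add: group.subgroup_imp_group[OF Level_group H] face degen sub Face_mult
          hom_mult[OF Degen_hom] Face_Face Face_Degen_less Face_Degen_eq Face_Degen_greater Degen_Degen
          del: One_nat_def)
qed

text \<open>Decalage drops the last face and the last degeneracy of every level.  What is dropped reappears as
  structure: the last face projects \<open>dec_sgroup G\<close> to \<open>G\<close>, and the last degeneracy is an extra degeneracy of it.\<close>

definition dec_sgroup :: "'g sgroup \<Rightarrow> 'g sgroup" where
  "dec_sgroup G = \<lparr>Level = (\<lambda>n. Level G (Suc n)), Face = (\<lambda>n. Face G (Suc n)), Degen = (\<lambda>n. Degen G (Suc n))\<rparr>"

lemma dec_sgroup_simps [simp]:
  "Level (dec_sgroup G) n = Level G (Suc n)"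
  "Face (dec_sgroup G) n = Face G (Suc n)" "Degen (dec_sgroup G) n = Degen G (Suc n)"
  by (simp_all add: dec_sgroup_def)

lemma (in simplicial_group) simplicial_group_dec: "simplicial_group (dec_sgroup G)"
  by (intro simplicial_group.intro;
      simp add: Level_group Face_hom Degen_hom Face_Face Face_Degen_less Face_Degen_eq
        Face_Degen_greater Degen_Degen)

section \<open>Simplicial maps\<close>

locale simplicial_map = G: simplicial_group G + H: simplicial_group H
  for G :: "'g sgroup" and H :: "'h sgroup" +
  fixes f :: "nat \<Rightarrow> 'g \<Rightarrow> 'h"
  assumes f_hom: "f n \<in> hom (Level G n) (Level H n)"
    and f_Face: "\<lbrakk>i \<le> Suc n; x \<in> carrier (Level G (Suc n))\<rbrakk>
      \<Longrightarrow> f n (Face G (Suc n) i x) = Face H (Suc n) i (f (Suc n) x)"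
    and f_Degen: "\<lbrakk>i \<le> n; x \<in> carrier (Level G n)\<rbrakk>
      \<Longrightarrow> f (Suc n) (Degen G n i x) = Degen H n i (f n x)"
begin

lemma f_group_hom: "group_hom (Level G n) (Level H n) (f n)"
  by (simp add: group_hom_def group_hom_axioms_def f_hom G.Level_group H.Level_group)

lemma f_closed: "x \<in> carrier (Level G n) \<Longrightarrow> f n x \<in> carrier (Level H n)"
  using f_hom[of n] by (auto simp: hom_def)

lemma f_moore: "x \<in> moore G n \<Longrightarrow> f n x \<in> moore H n"
proof (cases n)
  case (Suc m)
  assume "x \<in> moore G n"
  then show ?thesis unfolding Suc moore_Suc
    by (simp add: f_closed f_Face[symmetric] group_hom.hom_one[OF f_group_hom])
qed (simp add: moore_def f_closed)

lemma f_cycles: "x \<in> cycles G n \<Longrightarrow> f n x \<in> cycles H n"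
proof (cases n)
  case (Suc m)
  assume "x \<in> cycles G n"
  then show ?thesis unfolding Suc cycles_Suc
    by (simp add: f_closed f_Face[symmetric] group_hom.hom_one[OF f_group_hom])
qed (simp add: cycles_0 f_closed)

abbreviation "ker n \<equiv> kernel (Level G n) (Level H n) (f n)"
abbreviation "Ker \<equiv> sub_sgroup G ker"

lemma ker_iff: "x \<in> ker n \<longleftrightarrow> x \<in> carrier (Level G n) \<and> f n x = \<one>\<^bsub>Level H n\<^esub>"
  by (simp add: kernel_def)

lemma ker_subgroup: "subgroup (ker n) (Level G n)"
  by (rule group_hom.subgroup_kernel[OF f_group_hom])

lemma simplicial_group_Ker: "simplicial_group Ker"
  by (intro G.simplicial_group_sub_sgroup ker_subgroup)
    (auto simp: ker_iff G.Face_closed G.Degen_closed f_Face f_Degen H.Face_one H.Degen_one)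

lemma cycles_Ker: "x \<in> cycles Ker n \<longleftrightarrow> x \<in> cycles G n \<and> f n x = \<one>\<^bsub>Level H n\<^esub>"
  by (subst cycles_sub_sgroup) (auto simp: ker_iff dest: cycles_carrier)

lemma moore_Ker: "x \<in> moore Ker n \<longleftrightarrow> x \<in> moore G n \<and> f n x = \<one>\<^bsub>Level H n\<^esub>"
  by (subst moore_sub_sgroup) (auto simp: ker_iff dest: moore_carrier)

end

locale simplicial_surjection = simplicial_map +
  assumes f_surj: "y \<in> carrier (Level H n) \<Longrightarrow> \<exists>x\<in>carrier (Level G n). f n x = y"
begin

text \<open>Surjections of simplicial groups are fibrations: starting from any lift, the faces
  \<open>d\<^sub>0, d\<^sub>1, \<dots>\<close> are made trivial one at a time by dividing by \<open>s\<^sub>k d\<^sub>k x\<close>; this keeps the faces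
  already treated, and it does not change the image, whose faces are trivial.\<close>

lemma moore_lift:
  assumes "y \<in> moore H n" shows "\<exists>x\<in>moore G n. f n x = y"
proof (cases n)
  case 0
  then show ?thesis using assms f_surj[of y 0] by (auto simp: moore_def)
next
  case (Suc m)
  interpret Gn: group "Level G (Suc m)" by (rule G.Level_group)
  interpret Hn: group "Level H (Suc m)" by (rule H.Level_group)
  interpret Gm: group "Level G m" by (rule G.Level_group)
  interpret f: group_hom "Level G (Suc m)" "Level H (Suc m)" "f (Suc m)" by (rule f_group_hom)
  from assms have y: "y \<in> carrier (Level H (Suc m))" "\<And>i. i \<le> m \<Longrightarrow> Face H (Suc m) i y = \<one>\<^bsub>Level H m\<^esub>"
    by (simp_all add: Suc moore_Suc)
  have "\<exists>x\<in>carrier (Level G (Suc m)). f (Suc m) x = y \<and> (\<forall>i<k. Face G (Suc m) i x = \<one>\<^bsub>Level G m\<^esub>)"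
    if "k \<le> Suc m" for k
    using that
  proof (induction k)
    case 0
    then show ?case using f_surj[OF y(1)] by simp
  next
    case (Suc k)
    then obtain x where x: "x \<in> carrier (Level G (Suc m))" "f (Suc m) x = y"
      "\<And>i. i < k \<Longrightarrow> Face G (Suc m) i x = \<one>\<^bsub>Level G m\<^esub>" by auto
    have k: "k \<le> m" using Suc.prems by simp
    let ?u = "Face G (Suc m) k x"
    let ?s = "Degen G m k ?u"
    let ?x = "x \<otimes>\<^bsub>Level G (Suc m)\<^esub> inv\<^bsub>Level G (Suc m)\<^esub> ?s"
    have u: "?u \<in> carrier (Level G m)" using x k by (simp add: G.Face_closed)
    then have s: "?s \<in> carrier (Level G (Suc m))" using k by (simp add: G.Degen_closed)
    have F: "Face G (Suc m) i ?x = Face G (Suc m) i x \<otimes>\<^bsub>Level G m\<^esub> inv\<^bsub>Level G m\<^esub> Face G (Suc m) i ?s"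
      if "i \<le> m" for i
      using that x s by (simp add: G.Face_mult G.Face_inv)
    have "Face G (Suc m) i ?x = \<one>\<^bsub>Level G m\<^esub>" if "i < Suc k" for i
    proof (cases "i = k")
      case True
      then show ?thesis using F[of k] k u G.Face_Degen_eq[of k k m ?u] by simp
    next
      case False
      then have i: "i < k" using that by simp
      then obtain l where l: "m = Suc l" using k by (cases m) auto
      have "Face G m i ?u = \<one>\<^bsub>Level G l\<^esub>"
        using G.Face_Face[of i k l x] i k x l by (simp add: G.Face_one)
      then have "Face G (Suc m) i ?s = \<one>\<^bsub>Level G m\<^esub>"
        using G.Face_Degen_less[of i k l ?u] G.Degen_one[of "k - 1" l] i k u l by simp
      then show ?thesis using F[of i] x(3)[OF i] i k by simp
    qed
    moreover have "f (Suc m) ?x = y"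
      using x s k y by (simp add: f_Degen f_Face u H.Degen_one)
    ultimately show ?case using x s by (intro bexI[of _ ?x]) auto
  qed
  from this[of "Suc m"] show ?thesis by (auto simp: Suc moore_Suc less_Suc_eq_le)
qed

text \<open>Cycles lift along the surjection when \<open>\<pi>\<^sub>n\<^sub>-\<^sub>1\<close> of the kernel vanishes: a Moore lift has its last
  face in the kernel, and dividing by a Moore element of the kernel with the same last face makes
  it a cycle.\<close>

lemma cycle_lift:
  assumes ker: "\<And>m. n = Suc m \<Longrightarrow> acyclic_at Ker m" and y: "y \<in> cycles H n"
  shows "\<exists>x\<in>cycles G n. f n x = y"
proof (cases n)
  case 0
  then show ?thesis using y f_surj[of y 0] by (auto simp: cycles_0)
next
  case (Suc m)
  interpret Gn: group "Level G n" by (rule G.Level_group)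
  interpret Gm: group "Level G m" by (rule G.Level_group)
  interpret f: group_hom "Level G n" "Level H n" "f n" by (rule f_group_hom)
  have ym: "y \<in> moore H n" "Face H n n y = \<one>\<^bsub>Level H m\<^esub>"
    using y by (simp_all add: Suc cycles_iff_moore)
  then obtain x where x: "x \<in> moore G n" "f n x = y" using moore_lift by blast
  note xc = moore_carrier[OF x(1)]
  have "Face G n n x \<in> cycles Ker m"
    using G.moore_top_cycle[of x m] x ym xc by (simp add: Suc cycles_Ker f_Face)
  then have "Face G n n x \<in> boundaries Ker m" using ker[OF Suc] by (auto simp: acyclic_at_def)
  then obtain w where "w \<in> moore Ker (Suc m)" "Face Ker (Suc m) (Suc m) w = Face G n n x"
    by (rule boundariesE)
  then have w: "w \<in> moore G n" "f n w = \<one>\<^bsub>Level H n\<^esub>" "Face G n n w = Face G n n x"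
    unfolding moore_Ker Suc by simp_all
  note wc = moore_carrier[OF w(1)]
  let ?z = "x \<otimes>\<^bsub>Level G n\<^esub> inv\<^bsub>Level G n\<^esub> w"
  have "?z \<in> moore G n" using x w by (intro G.moore_mult G.moore_inv)
  moreover have "Face G n n ?z = \<one>\<^bsub>Level G m\<^esub>"
    using G.Face_mult[of n m x "inv\<^bsub>Level G n\<^esub> w"] G.Face_inv[of n m w] w(3) xc wc
      G.Face_closed[of n m x] Gn.inv_closed[OF wc] by (simp add: Suc)
  ultimately have "?z \<in> cycles G n" by (simp add: Suc cycles_iff_moore)
  moreover have "f n ?z = y" using x w xc wc f_closed[OF xc] by simp
  ultimately show ?thesis by blast
qed

text \<open>Exactness of \<open>\<pi>\<^sub>n\<^sub>+\<^sub>1 H \<rightarrow> \<pi>\<^sub>n Ker \<rightarrow> \<pi>\<^sub>n G\<close>.\<close>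

lemma acyclic_Ker:
  assumes "acyclic_at G n" "acyclic_at H (Suc n)"
  shows "acyclic_at Ker n"
  unfolding acyclic_at_def
proof
  fix x assume "x \<in> cycles Ker n"
  then have x: "x \<in> cycles G n" "f n x = \<one>\<^bsub>Level H n\<^esub>" by (simp_all only: cycles_Ker)
  interpret Gn: group "Level G n" by (rule G.Level_group)
  interpret G1: group "Level G (Suc n)" by (rule G.Level_group)
  interpret H1: group "Level H (Suc n)" by (rule H.Level_group)
  interpret f: group_hom "Level G (Suc n)" "Level H (Suc n)" "f (Suc n)" by (rule f_group_hom)
  from x(1) assms(1) have "x \<in> boundaries G n" by (auto simp: acyclic_at_def)
  then obtain y where y: "y \<in> moore G (Suc n)" "Face G (Suc n) (Suc n) y = x" by (rule boundariesE)
  note yc = moore_carrier[OF y(1)]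
  have "f (Suc n) y \<in> cycles H (Suc n)"
    using f_moore[OF y(1)] f_Face[of "Suc n" n y] x(2) y(2) yc by (simp add: cycles_iff_moore)
  then have "f (Suc n) y \<in> boundaries H (Suc n)" using assms(2) by (auto simp: acyclic_at_def)
  then obtain z where z: "z \<in> moore H (Suc (Suc n))" "Face H (Suc (Suc n)) (Suc (Suc n)) z = f (Suc n) y"
    by (rule boundariesE)
  obtain z' where z': "z' \<in> moore G (Suc (Suc n))" "f (Suc (Suc n)) z' = z" using moore_lift[OF z(1)] by blast
  let ?b = "Face G (Suc (Suc n)) (Suc (Suc n)) z'"
  have b: "?b \<in> cycles G (Suc n)" using z'(1) by (rule G.moore_top_cycle)
  note bc = cycles_carrier[OF b]
  have fb: "f (Suc n) ?b = f (Suc n) y" using z z' f_Face[of "Suc (Suc n)" "Suc n" z'] moore_carrier[OF z'(1)] by simp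
  let ?w = "y \<otimes>\<^bsub>Level G (Suc n)\<^esub> inv\<^bsub>Level G (Suc n)\<^esub> ?b"
  have "f (Suc n) ?w = \<one>\<^bsub>Level H (Suc n)\<^esub>" using yc bc fb f_closed[OF yc] by simp
  moreover have "?w \<in> moore G (Suc n)" using y b by (intro G.moore_mult G.moore_inv) (simp_all add: cycles_iff_moore)
  moreover have "Face G (Suc n) (Suc n) ?w = x"
    using yc bc y(2) b cycles_carrier[OF x(1)] by (simp add: G.Face_mult G.Face_inv cycles_Suc)
  ultimately show "x \<in> boundaries Ker n" by (intro boundariesI[of ?w]) (simp_all add: moore_Ker)
qed

text \<open>Exactness of \<open>\<pi>\<^sub>n G \<rightarrow> \<pi>\<^sub>n H \<rightarrow> \<pi>\<^sub>n\<^sub>-\<^sub>1 Ker\<close>; for \<open>n = 0\<close> the last term is trivial.\<close>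

lemma acyclic_base:
  assumes "acyclic_at G n" "\<And>m. n = Suc m \<Longrightarrow> acyclic_at Ker m"
  shows "acyclic_at H n"
  unfolding acyclic_at_def
proof
  fix y assume "y \<in> cycles H n"
  then obtain x where x: "x \<in> cycles G n" "f n x = y" using cycle_lift[OF assms(2)] by blast
  then have "x \<in> boundaries G n" using assms(1) by (auto simp: acyclic_at_def)
  then obtain z where z: "z \<in> moore G (Suc n)" "Face G (Suc n) (Suc n) z = x" by (rule boundariesE)
  then have "Face H (Suc n) (Suc n) (f (Suc n) z) = y"
    using f_Face[of "Suc n" n z] moore_carrier[OF z(1)] x(2) by simp
  with f_moore[OF z(1)] show "y \<in> boundaries H n" by (rule boundariesI)
qed

theorem homotopy_group_iso:
  assumes "\<And>m. acyclic_at Ker m"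
  shows "homotopy_group n G \<cong> homotopy_group n H"
proof -
  let ?ZG = "(Level G n)\<lparr>carrier := cycles G n\<rparr>" and ?ZH = "(Level H n)\<lparr>carrier := cycles H n\<rparr>"
  let ?BH = "boundaries H n"
  interpret Gn: group "Level G n" by (rule G.Level_group)
  interpret Hn: group "Level H n" by (rule H.Level_group)
  interpret fn: group_hom "Level G n" "Level H n" "f n" by (rule f_group_hom)
  interpret ZG: group ?ZG by (rule Gn.subgroup_imp_group[OF G.cycles_subgroup])
  interpret ZH: group ?ZH by (rule Hn.subgroup_imp_group[OF H.cycles_subgroup])
  interpret B: normal ?BH ?ZH by (rule H.boundaries_normal)
  let ?\<phi> = "\<lambda>x. ?BH #>\<^bsub>?ZH\<^esub> f n x"
  have fZ: "f n \<in> hom ?ZG ?ZH"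
    by (rule homI) (simp_all add: f_cycles cycles_carrier)
  have \<phi>: "group_hom ?ZG (?ZH Mod ?BH) ?\<phi>"
    using hom_compose[OF fZ B.r_coset_hom_Mod]
    by (simp add: group_hom_def group_hom_axioms_def ZG.is_group B.factorgroup_is_group comp_def)
  have "?\<phi> ` carrier ?ZG = carrier (?ZH Mod ?BH)"
  proof
    show "?\<phi> ` carrier ?ZG \<subseteq> carrier (?ZH Mod ?BH)" using group_hom.hom_closed[OF \<phi>] by blast
    show "carrier (?ZH Mod ?BH) \<subseteq> ?\<phi> ` carrier ?ZG"
    proof
      fix K assume "K \<in> carrier (?ZH Mod ?BH)"
      then obtain y where y: "y \<in> cycles H n" "K = ?BH #>\<^bsub>?ZH\<^esub> y" by (auto simp: FactGroup_def RCOSETS_def)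
      obtain x where "x \<in> cycles G n" "f n x = y" using cycle_lift[OF assms y(1)] by blast
      then show "K \<in> ?\<phi> ` carrier ?ZG" using y by auto
    qed
  qed
  moreover have "kernel ?ZG (?ZH Mod ?BH) ?\<phi> = boundaries G n"
  proof (intro equalityI subsetI)
    fix x assume "x \<in> kernel ?ZG (?ZH Mod ?BH) ?\<phi>"
    then have x: "x \<in> cycles G n" "?BH #>\<^bsub>?ZH\<^esub> f n x = ?BH" by (simp_all add: kernel_def FactGroup_def)
    note xc = cycles_carrier[OF x(1)]
    have "f n x \<in> ?BH" using ZH.coset_join1[OF x(2)] f_cycles[OF x(1)] B.subgroup_axioms by simp
    then obtain z where z: "z \<in> moore H (Suc n)" "Face H (Suc n) (Suc n) z = f n x" by (rule boundariesE)
    obtain z' where z': "z' \<in> moore G (Suc n)" "f (Suc n) z' = z" using moore_lift[OF z(1)] by blast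
    let ?b = "Face G (Suc n) (Suc n) z'"
    have b: "?b \<in> cycles G n" using z'(1) by (rule G.moore_top_cycle)
    note bc = cycles_carrier[OF b]
    have fb: "f n ?b = f n x" using z z' f_Face[of "Suc n" n z'] moore_carrier[OF z'(1)] by simp
    have "x \<otimes>\<^bsub>Level G n\<^esub> inv\<^bsub>Level G n\<^esub> ?b \<in> cycles G n"
      using x b subgroup.m_closed[OF G.cycles_subgroup] subgroup.m_inv_closed[OF G.cycles_subgroup] by blast
    then have "x \<otimes>\<^bsub>Level G n\<^esub> inv\<^bsub>Level G n\<^esub> ?b \<in> cycles Ker n"
      unfolding cycles_Ker using xc bc fb f_closed[OF xc] by simp
    then have "x \<otimes>\<^bsub>Level G n\<^esub> inv\<^bsub>Level G n\<^esub> ?b \<in> boundaries Ker n" using assms by (auto simp: acyclic_at_def)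
    then obtain w where "w \<in> moore Ker (Suc n)"
      "Face Ker (Suc n) (Suc n) w = x \<otimes>\<^bsub>Level G n\<^esub> inv\<^bsub>Level G n\<^esub> ?b" by (rule boundariesE)
    then have w: "w \<in> moore G (Suc n)" "Face G (Suc n) (Suc n) w = x \<otimes>\<^bsub>Level G n\<^esub> inv\<^bsub>Level G n\<^esub> ?b"
      unfolding moore_Ker by simp_all
    have "Face G (Suc n) (Suc n) (w \<otimes>\<^bsub>Level G (Suc n)\<^esub> z') = x"
      using w z' xc bc moore_carrier[OF w(1)] moore_carrier[OF z'(1)] by (simp add: G.Face_mult Gn.m_assoc)
    with G.moore_mult[OF w(1) z'(1)] show "x \<in> boundaries G n" by (rule boundariesI)
  next
    fix x assume x: "x \<in> boundaries G n"
    then obtain z where z: "z \<in> moore G (Suc n)" "Face G (Suc n) (Suc n) z = x" by (rule boundariesE)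
    then have "Face H (Suc n) (Suc n) (f (Suc n) z) = f n x"
      using f_Face[of "Suc n" n z] moore_carrier[OF z(1)] by simp
    with f_moore[OF z(1)] have "f n x \<in> ?BH" by (rule boundariesI)
    moreover have "x \<in> cycles G n" using x G.boundaries_subset by blast
    ultimately show "x \<in> kernel ?ZG (?ZH Mod ?BH) ?\<phi>"
      using ZH.coset_join2[of "f n x" ?BH] f_cycles[of x] B.subgroup_axioms
      by (simp add: kernel_def FactGroup_def)
  qed
  ultimately show ?thesis
    using group_hom.FactGroup_iso[OF \<phi>] by (simp add: homotopy_group_def)
qed

end

section \<open>Last vertices and path objects\<close>

text \<open>Every \<open>d\<^sub>0\<close> discards the first vertex, so that \<open>n\<close> of them leave the last one.\<close>

primrec last_vertex :: "'g sgroup \<Rightarrow> nat \<Rightarrow> 'g \<Rightarrow> 'g" where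
  "last_vertex G 0 = (\<lambda>x. x)"
| "last_vertex G (Suc n) = (\<lambda>x. last_vertex G n (Face G (Suc n) 0 x))"

text \<open>The path object: simplices of the decalage whose added vertex is the base point \<open>1\<close>.\<close>

definition path_set :: "'g sgroup \<Rightarrow> nat \<Rightarrow> 'g set" where
  "path_set G n = {x \<in> carrier (Level G (Suc n)). last_vertex G (Suc n) x = \<one>\<^bsub>Level G 0\<^esub>}"

abbreviation path_sgroup :: "'g sgroup \<Rightarrow> 'g sgroup" where
  "path_sgroup G \<equiv> sub_sgroup (dec_sgroup G) (path_set G)"

context simplicial_group
begin

lemma last_vertex_hom: "last_vertex G n \<in> hom (Level G n) (Level G 0)"
proof (induction n)
  case (Suc n)
  then show ?case using hom_compose[OF Face_hom[of 0 n] Suc] by (simp add: comp_def)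
qed (simp add: hom_def)

lemma last_vertex_closed: "x \<in> carrier (Level G n) \<Longrightarrow> last_vertex G n x \<in> carrier (Level G 0)"
  using last_vertex_hom[of n] by (auto simp: hom_def)

lemma last_vertex_Face:
  "\<lbrakk>i \<le> n; x \<in> carrier (Level G (Suc n))\<rbrakk> \<Longrightarrow> last_vertex G n (Face G (Suc n) i x) = last_vertex G (Suc n) x"
proof (induction n arbitrary: i x)
  case (Suc n)
  show ?case
  proof (cases i)
    case (Suc j)
    have "last_vertex G (Suc n) (Face G (Suc (Suc n)) i x) = last_vertex G n (Face G (Suc n) j (Face G (Suc (Suc n)) 0 x))"
      using Face_Face[of 0 i n x] Suc.prems Suc by simp
    also have "\<dots> = last_vertex G (Suc n) (Face G (Suc (Suc n)) 0 x)"
      using Suc.IH[of j "Face G (Suc (Suc n)) 0 x"] Suc.prems Suc by (simp add: Face_closed)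
    finally show ?thesis by simp
  qed simp
qed simp

lemma last_vertex_Degen:
  "\<lbrakk>i \<le> n; x \<in> carrier (Level G n)\<rbrakk> \<Longrightarrow> last_vertex G (Suc n) (Degen G n i x) = last_vertex G n x"
proof (induction n arbitrary: i x)
  case 0
  then show ?case using Face_Degen_eq[of 0 0 0 x] by simp
next
  case (Suc n)
  show ?case
  proof (cases i)
    case 0
    then show ?thesis using Face_Degen_eq[of 0 0 "Suc n" x] Suc.prems by simp
  next
    case (Suc j)
    have "last_vertex G (Suc (Suc n)) (Degen G (Suc n) i x) = last_vertex G (Suc n) (Degen G n j (Face G (Suc n) 0 x))"
      using Face_Degen_less[of 0 i n x] Suc.prems Suc by simp
    also have "\<dots> = last_vertex G n (Face G (Suc n) 0 x)"
      using Suc.IH[of j "Face G (Suc n) 0 x"] Suc.prems Suc Face_closed[of 0 n x] by simp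
    finally show ?thesis by simp
  qed
qed

lemma last_vertex_surj:
  "v \<in> carrier (Level G 0) \<Longrightarrow> \<exists>x\<in>carrier (Level G n). last_vertex G n x = v"
proof (induction n)
  case (Suc n)
  then obtain x where "x \<in> carrier (Level G n)" "last_vertex G n x = v" by blast
  then show ?case
    by (intro bexI[of _ "Degen G n 0 x"]) (simp_all add: last_vertex_Degen Degen_closed del: last_vertex.simps)
qed simp

lemma path_set_subgroup: "subgroup (path_set G n) (Level G (Suc n))"
proof -
  have "path_set G n = kernel (Level G (Suc n)) (Level G 0) (last_vertex G (Suc n))"
    by (auto simp: path_set_def kernel_def)
  moreover have "group_hom (Level G (Suc n)) (Level G 0) (last_vertex G (Suc n))"
    using last_vertex_hom Level_group by (simp add: group_hom_def group_hom_axioms_def del: last_vertex.simps)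
  ultimately show ?thesis using group_hom.subgroup_kernel by metis
qed

lemma path_set_Face: "\<lbrakk>i \<le> Suc n; x \<in> path_set G (Suc n)\<rbrakk> \<Longrightarrow> Face G (Suc (Suc n)) i x \<in> path_set G n"
  using last_vertex_Face[of i "Suc n" x] by (simp add: path_set_def Face_closed del: last_vertex.simps)

lemma path_set_Degen: "\<lbrakk>i \<le> Suc n; x \<in> path_set G n\<rbrakk> \<Longrightarrow> Degen G (Suc n) i x \<in> path_set G (Suc n)"
  using last_vertex_Degen[of i "Suc n" x] by (simp add: path_set_def Degen_closed del: last_vertex.simps)

lemma simplicial_group_path: "simplicial_group (path_sgroup G)"
  using simplicial_group.simplicial_group_sub_sgroup[OF simplicial_group_dec, of "path_set G"]
  by (simp add: path_set_subgroup path_set_Face path_set_Degen)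

text \<open>For a cycle \<open>x\<close> of level \<open>n\<close>, the element \<open>s\<^sub>n\<^sub>+\<^sub>1 x\<close> is a Moore element with boundary \<open>x\<close>.  In
  level \<open>0\<close> its face \<open>d\<^sub>0\<close> is degenerate on the added vertex, and is trivial because the path ends at \<open>1\<close>.\<close>

lemma acyclic_path: "acyclic_at (path_sgroup G) n"
  unfolding acyclic_at_def
proof
  let ?P = "path_sgroup G"
  fix x assume x: "x \<in> cycles ?P n"
  then have xp: "x \<in> path_set G n" using cycles_carrier by fastforce
  then have xc: "x \<in> carrier (Level G (Suc n))" by (simp add: path_set_def)
  let ?s = "Degen G (Suc n) (Suc n) x"
  have "Face G (Suc (Suc n)) i ?s = \<one>\<^bsub>Level G (Suc n)\<^esub>" if "i \<le> n" for i
  proof -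
    have "Face G (Suc n) i x = \<one>\<^bsub>Level G n\<^esub>"
    proof (cases n)
      case 0
      then show ?thesis using xp that by (simp add: path_set_def)
    next
      case (Suc m)
      then show ?thesis using x that by (simp add: cycles_Suc)
    qed
    then show ?thesis using Face_Degen_less[of i "Suc n" n x] that xc by (simp add: Degen_one)
  qed
  moreover have "Face G (Suc (Suc n)) (Suc n) ?s = x" using Face_Degen_eq[of "Suc n" "Suc n" "Suc n" x] xc by simp
  ultimately show "x \<in> boundaries ?P n"
    by (intro boundariesI[of ?s]) (simp_all add: moore_Suc path_set_Degen xp)
qed

text \<open>As \<open>\<pi>\<^sub>0\<close> vanishes, there is a path \<open>e\<close> from \<open>v\<close> to \<open>1\<close>.  Then \<open>e\<^sup>-\<^sup>1 s\<^sub>0 v\<close> is a path from \<open>1\<close> to \<open>v\<close>, and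
  iterated \<open>s\<^sub>0\<close> repeats its first vertex.\<close>

lemma move_last_vertex:
  assumes ac: "acyclic_at G 0" and v: "v \<in> carrier (Level G 0)"
  shows "\<exists>z\<in>carrier (Level G (Suc n)). Face G (Suc n) (Suc n) z = \<one>\<^bsub>Level G n\<^esub> \<and> last_vertex G (Suc n) z = v"
proof (induction n)
  case 0
  interpret G0: group "Level G 0" by (rule Level_group)
  interpret G1: group "Level G (Suc 0)" by (rule Level_group)
  have "v \<in> boundaries G 0" using ac v by (auto simp: acyclic_at_def cycles_0)
  then obtain e where e: "e \<in> moore G (Suc 0)" "Face G (Suc 0) (Suc 0) e = v" by (rule boundariesE)
  then have e': "e \<in> carrier (Level G (Suc 0))" "Face G (Suc 0) 0 e = \<one>\<^bsub>Level G 0\<^esub>" by (simp_all add: moore_Suc)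
  let ?d = "Degen G 0 0 v"
  have d: "?d \<in> carrier (Level G (Suc 0))" using v by (simp add: Degen_closed)
  have "Face G (Suc 0) i ?d = v" if "i \<le> Suc 0" for i
    using Face_Degen_eq[of i 0 0 v] v that by (auto simp: le_Suc_eq)
  then show ?case using e e' d v
    by (intro bexI[of _ "inv\<^bsub>Level G (Suc 0)\<^esub> e \<otimes>\<^bsub>Level G (Suc 0)\<^esub> ?d"])
      (simp_all add: Face_mult Face_inv)
next
  case (Suc n)
  then obtain z where z: "z \<in> carrier (Level G (Suc n))" "Face G (Suc n) (Suc n) z = \<one>\<^bsub>Level G n\<^esub>"
    "last_vertex G (Suc n) z = v" by blast
  then show ?case
    using Face_Degen_greater[of 0 "Suc (Suc n)" n z] Degen_one[of 0 n] last_vertex_Degen[of 0 "Suc n" z]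
    by (intro bexI[of _ "Degen G (Suc n) 0 z"]) (simp_all add: Degen_closed del: last_vertex.simps)
qed

text \<open>The degenerate simplex \<open>s\<^sub>n y\<close> projects to \<open>y\<close>, but its added vertex is that of \<open>y\<close>; the previous
  lemma corrects it without changing the projection.\<close>

lemma path_lift:
  assumes ac: "acyclic_at G 0" and y: "y \<in> carrier (Level G n)"
  shows "\<exists>x\<in>path_set G n. Face G (Suc n) (Suc n) x = y"
proof -
  interpret G0: group "Level G 0" by (rule Level_group)
  interpret Gn: group "Level G n" by (rule Level_group)
  interpret G1: group "Level G (Suc n)" by (rule Level_group)
  interpret lv: group_hom "Level G (Suc n)" "Level G 0" "last_vertex G (Suc n)"
    using last_vertex_hom Level_group by (simp add: group_hom_def group_hom_axioms_def del: last_vertex.simps)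
  obtain z where z: "z \<in> carrier (Level G (Suc n))" "Face G (Suc n) (Suc n) z = \<one>\<^bsub>Level G n\<^esub>"
    "last_vertex G (Suc n) z = last_vertex G n y"
    using move_last_vertex[OF ac last_vertex_closed[OF y]] by blast
  let ?s = "Degen G n n y"
  have s: "?s \<in> carrier (Level G (Suc n))" "Face G (Suc n) (Suc n) ?s = y" "last_vertex G (Suc n) ?s = last_vertex G n y"
    using y Face_Degen_eq[of "Suc n" n n y] by (simp_all add: Degen_closed last_vertex_Degen del: last_vertex.simps)
  show ?thesis
    using z s y last_vertex_closed[OF y]
    by (intro bexI[of _ "?s \<otimes>\<^bsub>Level G (Suc n)\<^esub> inv\<^bsub>Level G (Suc n)\<^esub> z"])
      (simp_all add: Face_mult Face_inv path_set_def del: last_vertex.simps)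
qed

end

section \<open>Bisimplicial groups\<close>

text \<open>A bisimplicial group is given by its columns \<open>K q\<close> and its rows \<open>R p\<close>, which share the groups
  \<open>Level (K q) p\<close>.\<close>

locale bisimplicial_group =
  fixes K :: "nat \<Rightarrow> 'g sgroup" and R :: "nat \<Rightarrow> 'g sgroup"
  assumes col: "simplicial_group (K q)"
    and row: "simplicial_group (R p)"
    and Level_row: "Level (R p) q = Level (K q) p"
    and face_face_comm: "\<lbrakk>i \<le> Suc p; j \<le> Suc q; x \<in> carrier (Level (K (Suc q)) (Suc p))\<rbrakk> \<Longrightarrow>
      Face (K q) (Suc p) i (Face (R (Suc p)) (Suc q) j x) = Face (R p) (Suc q) j (Face (K (Suc q)) (Suc p) i x)"
    and face_degen_comm: "\<lbrakk>i \<le> Suc p; j \<le> q; x \<in> carrier (Level (K q) (Suc p))\<rbrakk> \<Longrightarrow>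
      Face (K (Suc q)) (Suc p) i (Degen (R (Suc p)) q j x) = Degen (R p) q j (Face (K q) (Suc p) i x)"
    and degen_face_comm: "\<lbrakk>i \<le> p; j \<le> Suc q; x \<in> carrier (Level (K (Suc q)) p)\<rbrakk> \<Longrightarrow>
      Degen (K q) p i (Face (R p) (Suc q) j x) = Face (R (Suc p)) (Suc q) j (Degen (K (Suc q)) p i x)"
    and degen_degen_comm: "\<lbrakk>i \<le> p; j \<le> q; x \<in> carrier (Level (K q) p)\<rbrakk> \<Longrightarrow>
      Degen (K (Suc q)) p i (Degen (R p) q j x) = Degen (R (Suc p)) q j (Degen (K q) p i x)"

definition diag_sgroup :: "(nat \<Rightarrow> 'g sgroup) \<Rightarrow> (nat \<Rightarrow> 'g sgroup) \<Rightarrow> 'g sgroup" where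
  "diag_sgroup K R = \<lparr>Level = (\<lambda>n. Level (K n) n),
     Face = (\<lambda>n i x. Face (K (n - 1)) n i (Face (R n) n i x)),
     Degen = (\<lambda>n i x. Degen (K (Suc n)) n i (Degen (R n) n i x))\<rparr>"

lemma diag_sgroup_simps [simp]:
  "Level (diag_sgroup K R) n = Level (K n) n"
  "Face (diag_sgroup K R) (Suc n) i x = Face (K n) (Suc n) i (Face (R (Suc n)) (Suc n) i x)"
  "Degen (diag_sgroup K R) n i x = Degen (K (Suc n)) n i (Degen (R n) n i x)"
  by (simp_all add: diag_sgroup_def)

lemma diag_sub_sgroup:
  "diag_sgroup (\<lambda>q. sub_sgroup (K q) (\<lambda>p. H p q)) (\<lambda>p. sub_sgroup (R p) (H p)) =
    sub_sgroup (diag_sgroup K R) (\<lambda>n. H n n)"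
  by (simp add: diag_sgroup_def sub_sgroup_def)

context bisimplicial_group
begin

lemma swap: "bisimplicial_group R K"
  by (rule bisimplicial_group.intro) (simp_all add: col row Level_row face_face_comm face_degen_comm degen_face_comm degen_degen_comm)

lemma col_Face: "\<lbrakk>i \<le> Suc p; x \<in> carrier (Level (K q) (Suc p))\<rbrakk> \<Longrightarrow> Face (K q) (Suc p) i x \<in> carrier (Level (K q) p)"
  using simplicial_group.Face_closed[OF col] .

lemma col_Degen: "\<lbrakk>i \<le> p; x \<in> carrier (Level (K q) p)\<rbrakk> \<Longrightarrow> Degen (K q) p i x \<in> carrier (Level (K q) (Suc p))"
  using simplicial_group.Degen_closed[OF col] .

lemma row_Face: "\<lbrakk>i \<le> Suc q; x \<in> carrier (Level (K (Suc q)) p)\<rbrakk> \<Longrightarrow> Face (R p) (Suc q) i x \<in> carrier (Level (K q) p)"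
  using simplicial_group.Face_closed[OF row] Level_row by metis

lemma row_Degen: "\<lbrakk>i \<le> q; x \<in> carrier (Level (K q) p)\<rbrakk> \<Longrightarrow> Degen (R p) q i x \<in> carrier (Level (K (Suc q)) p)"
  using simplicial_group.Degen_closed[OF row] Level_row by metis

lemma row_Face_hom: "i \<le> Suc q \<Longrightarrow> Face (R p) (Suc q) i \<in> hom (Level (K (Suc q)) p) (Level (K q) p)"
  using simplicial_group.Face_hom[OF row] Level_row by metis

lemma row_Degen_hom: "i \<le> q \<Longrightarrow> Degen (R p) q i \<in> hom (Level (K q) p) (Level (K (Suc q)) p)"
  using simplicial_group.Degen_hom[OF row] Level_row by metis

lemma row_Face_one: "i \<le> Suc q \<Longrightarrow> Face (R p) (Suc q) i \<one>\<^bsub>Level (K (Suc q)) p\<^esub> = \<one>\<^bsub>Level (K q) p\<^esub>"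
  using simplicial_group.Face_one[OF row] Level_row by metis

lemma row_Degen_one: "i \<le> q \<Longrightarrow> Degen (R p) q i \<one>\<^bsub>Level (K q) p\<^esub> = \<one>\<^bsub>Level (K (Suc q)) p\<^esub>"
  using simplicial_group.Degen_one[OF row] Level_row by metis

lemmas row_Face_Face = simplicial_group.Face_Face[OF row, unfolded Level_row]
lemmas row_Face_Degen_less = simplicial_group.Face_Degen_less[OF row, unfolded Level_row]
lemmas row_Face_Degen_eq = simplicial_group.Face_Degen_eq[OF row, unfolded Level_row]
lemmas row_Face_Degen_greater = simplicial_group.Face_Degen_greater[OF row, unfolded Level_row]
lemmas row_Degen_Degen = simplicial_group.Degen_Degen[OF row, unfolded Level_row]

lemma simplicial_group_diag: "simplicial_group (diag_sgroup K R)"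
proof -
  let ?D = "diag_sgroup K R"
  have ff: "Face ?D (Suc n) i (Face ?D (Suc (Suc n)) j x) =
      Face (K n) (Suc n) i (Face (K n) (Suc (Suc n)) j
        (Face (R (Suc (Suc n))) (Suc n) i (Face (R (Suc (Suc n))) (Suc (Suc n)) j x)))"
    if "i \<le> Suc n" "j \<le> Suc (Suc n)" "x \<in> carrier (Level (K (Suc (Suc n))) (Suc (Suc n)))" for i j n x
    using that by (simp add: face_face_comm row_Face)
  have fd: "Face ?D (Suc n) i (Degen ?D n j x) =
      Face (K n) (Suc n) i (Degen (K n) n j (Face (R n) (Suc n) i (Degen (R n) n j x)))"
    if "i \<le> Suc n" "j \<le> n" "x \<in> carrier (Level (K n) n)" for i j n x
    using that by (simp add: degen_face_comm row_Degen)
  have df: "Degen ?D n i (Face ?D (Suc n) j x) =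
      Degen (K (Suc n)) n i (Face (K (Suc n)) (Suc n) j (Degen (R (Suc n)) n i (Face (R (Suc n)) (Suc n) j x)))"
    if "i \<le> n" "j \<le> Suc n" "x \<in> carrier (Level (K (Suc n)) (Suc n))" for i j n x
    using that by (simp add: face_degen_comm row_Face)
  have dd: "Degen ?D (Suc n) i (Degen ?D n j x) =
      Degen (K (Suc (Suc n))) (Suc n) i (Degen (K (Suc (Suc n))) n j (Degen (R n) (Suc n) i (Degen (R n) n j x)))"
    if "i \<le> Suc n" "j \<le> n" "x \<in> carrier (Level (K n) n)" for i j n x
    using that by (simp add: degen_degen_comm row_Degen)
  show ?thesis
  proof (intro simplicial_group.intro, goal_cases)
    case (1 n)
    show ?case by (simp add: simplicial_group.Level_group[OF col])
  next
    case (2 i n)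
    show ?case
      using hom_compose[OF row_Face_hom[OF 2, of "Suc n"] simplicial_group.Face_hom[OF col 2, of n]]
      by (simp add: diag_sgroup_def comp_def)
  next
    case (3 i n)
    show ?case
      using hom_compose[OF row_Degen_hom[OF 3, of n] simplicial_group.Degen_hom[OF col 3, of "Suc n"]]
      by (simp add: diag_sgroup_def comp_def)
  next
    case (4 i j n x)
    then have x: "i \<le> Suc n" "j - 1 \<le> Suc n" "i \<le> Suc (Suc n)" "x \<in> carrier (Level (K (Suc (Suc n))) (Suc (Suc n)))"
      by auto
    show ?case unfolding ff[OF x(1) 4(2) x(4)] ff[OF x(2) x(3) x(4)]
      using row_Face_Face[OF 4(1,2) x(4)]
        simplicial_group.Face_Face[OF col 4(1,2), of "Face (R (Suc (Suc n))) (Suc n) i (Face (R (Suc (Suc n))) (Suc (Suc n)) j x)" n]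
        x 4(2) by (simp add: row_Face)
  next
    case (5 i j n x)
    then have x: "i \<le> Suc n" "j - 1 \<le> n" "i \<le> Suc (Suc n)" "x \<in> carrier (Level (K (Suc n)) (Suc n))"
      by auto
    show ?case unfolding fd[OF x(3) 5(2) x(4)] df[OF x(2) x(1) x(4)]
      using row_Face_Degen_less[OF 5(1,2) x(4)]
        simplicial_group.Face_Degen_less[OF col 5(1,2), of "Face (R (Suc n)) (Suc (Suc n)) i (Degen (R (Suc n)) (Suc n) j x)" "Suc n"]
        x 5(2) by (simp add: row_Face row_Degen)
  next
    case (6 i j n x)
    then have x: "i \<le> Suc n" "x \<in> carrier (Level (K n) n)" by auto
    show ?case unfolding fd[OF x(1) 6(2) x(2)]
      using row_Face_Degen_eq[OF 6(1,2) x(2)] simplicial_group.Face_Degen_eq[OF col 6(1,2) x(2)] by simp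
  next
    case (7 j i n x)
    then have x: "j \<le> Suc n" "j \<le> n" "i - 1 \<le> Suc n" "x \<in> carrier (Level (K (Suc n)) (Suc n))"
      by auto
    show ?case unfolding fd[OF 7(2) x(1) x(4)] df[OF x(2) x(3) x(4)]
      using row_Face_Degen_greater[OF 7(1,2) x(4)]
        simplicial_group.Face_Degen_greater[OF col 7(1,2), of "Face (R (Suc n)) (Suc (Suc n)) i (Degen (R (Suc n)) (Suc n) j x)" "Suc n"]
        x 7(2) by (simp add: row_Face row_Degen)
  next
    case (8 i j n x)
    then have x: "i \<le> Suc n" "Suc j \<le> Suc n" "i \<le> n" "x \<in> carrier (Level (K n) n)"
      by auto
    show ?case unfolding dd[OF x(1) 8(2) x(4)] dd[OF x(2) x(3) x(4)]
      using row_Degen_Degen[OF 8(1,2) x(4)]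
        simplicial_group.Degen_Degen[OF col 8(1,2), of "Degen (R n) (Suc n) i (Degen (R n) n j x)" "Suc (Suc n)"]
        x 8(2) by (simp add: row_Degen)
  qed
qed

lemma bisimplicial_sub:
  assumes H: "\<And>p q. subgroup (H p q) (Level (K q) p)"
    and cF: "\<And>p q i x. \<lbrakk>i \<le> Suc p; x \<in> H (Suc p) q\<rbrakk> \<Longrightarrow> Face (K q) (Suc p) i x \<in> H p q"
    and cD: "\<And>p q i x. \<lbrakk>i \<le> p; x \<in> H p q\<rbrakk> \<Longrightarrow> Degen (K q) p i x \<in> H (Suc p) q"
    and rF: "\<And>p q i x. \<lbrakk>i \<le> Suc q; x \<in> H p (Suc q)\<rbrakk> \<Longrightarrow> Face (R p) (Suc q) i x \<in> H p q"
    and rD: "\<And>p q i x. \<lbrakk>i \<le> q; x \<in> H p q\<rbrakk> \<Longrightarrow> Degen (R p) q i x \<in> H p (Suc q)"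
  shows "bisimplicial_group (\<lambda>q. sub_sgroup (K q) (\<lambda>p. H p q)) (\<lambda>p. sub_sgroup (R p) (H p))"
proof -
  have sub: "x \<in> carrier (Level (K q) p)" if "x \<in> H p q" for p q x
    using subgroup.mem_carrier[OF H that] .
  have "simplicial_group (sub_sgroup (K q) (\<lambda>p. H p q))" for q
    by (intro simplicial_group.simplicial_group_sub_sgroup[OF col] H cF cD)
  moreover have "simplicial_group (sub_sgroup (R p) (H p))" for p
    by (intro simplicial_group.simplicial_group_sub_sgroup[OF row] rF rD) (simp add: H Level_row)
  ultimately show ?thesis
    by (intro bisimplicial_group.intro) (simp_all add: Level_row face_face_comm face_degen_comm degen_face_comm degen_degen_comm sub)
qed

lemma bisimplicial_dec: "bisimplicial_group (\<lambda>q. dec_sgroup (K (Suc q))) (\<lambda>p. dec_sgroup (R (Suc p)))"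
  by (intro bisimplicial_group.intro simplicial_group.simplicial_group_dec col row)
    (simp_all add: Level_row face_face_comm face_degen_comm degen_face_comm degen_degen_comm)

text \<open>Row operations commute with the column operator \<open>d\<^sub>0\<close>, hence with last vertices in the columns.  This
  makes the column paths closed under the row operations.\<close>

lemma last_vertex_row_Face:
  "\<lbrakk>j \<le> Suc q; x \<in> carrier (Level (K (Suc q)) p)\<rbrakk> \<Longrightarrow>
    last_vertex (K q) p (Face (R p) (Suc q) j x) = Face (R 0) (Suc q) j (last_vertex (K (Suc q)) p x)"
  by (induction p arbitrary: x) (simp_all add: face_face_comm col_Face)

lemma last_vertex_row_Degen:
  "\<lbrakk>j \<le> q; x \<in> carrier (Level (K q) p)\<rbrakk> \<Longrightarrow>
    last_vertex (K (Suc q)) p (Degen (R p) q j x) = Degen (R 0) q j (last_vertex (K q) p x)"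
  by (induction p arbitrary: x) (simp_all add: face_degen_comm col_Face)

abbreviation "path_col \<equiv> (\<lambda>q. path_sgroup (K (Suc q)))"
abbreviation "path_row \<equiv> (\<lambda>p. sub_sgroup (dec_sgroup (R (Suc p))) (\<lambda>q. path_set (K (Suc q)) p))"
abbreviation "path_end \<equiv> (\<lambda>q p x. Face (K q) (Suc p) (Suc p) (Face (R (Suc p)) (Suc q) (Suc q) x))"

lemma bisimplicial_path: "bisimplicial_group path_col path_row"
proof (rule bisimplicial_group.bisimplicial_sub[OF bisimplicial_dec, where H = "\<lambda>p q. path_set (K (Suc q)) p"])
  show "subgroup (path_set (K (Suc q)) p) (Level (dec_sgroup (K (Suc q))) p)" for p q
    using simplicial_group.path_set_subgroup[OF col] by simp
  show "Face (dec_sgroup (K (Suc q))) (Suc p) i x \<in> path_set (K (Suc q)) p"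
    if "i \<le> Suc p" "x \<in> path_set (K (Suc q)) (Suc p)" for p q i x
    using simplicial_group.path_set_Face[OF col that] by simp
  show "Degen (dec_sgroup (K (Suc q))) p i x \<in> path_set (K (Suc q)) (Suc p)"
    if "i \<le> p" "x \<in> path_set (K (Suc q)) p" for p q i x
    using simplicial_group.path_set_Degen[OF col _ that(2)] that(1) by simp
  show "Face (dec_sgroup (R (Suc p))) (Suc q) i x \<in> path_set (K (Suc q)) p"
    if "i \<le> Suc q" "x \<in> path_set (K (Suc (Suc q))) p" for p q i x
    using that last_vertex_row_Face[of i "Suc q" x "Suc p"]
    by (simp add: path_set_def row_Face row_Face_one del: last_vertex.simps)
  show "Degen (dec_sgroup (R (Suc p))) q i x \<in> path_set (K (Suc (Suc q))) p"
    if "i \<le> q" "x \<in> path_set (K (Suc q)) p" for p q i x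
    using that last_vertex_row_Degen[of i "Suc q" x "Suc p"]
    by (simp add: path_set_def row_Degen row_Degen_one del: last_vertex.simps)
qed

lemma path_set_carrier: "x \<in> path_set (K q) p \<Longrightarrow> x \<in> carrier (Level (K q) (Suc p))"
  by (simp add: path_set_def)

lemma path_end_hom: "path_end q p \<in> hom (Level (path_col q) p) (Level (K q) p)"
proof -
  have "path_end q p \<in> hom (Level (K (Suc q)) (Suc p)) (Level (K q) p)"
    using hom_compose[OF row_Face_hom[of "Suc q" q "Suc p"] simplicial_group.Face_hom[OF col, of "Suc p" p q]]
    by (simp add: comp_def)
  then show ?thesis by (auto simp: hom_def path_set_carrier)
qed

text \<open>A lift is found one direction at a time: the row degeneracy \<open>s\<^sub>q\<close> splits the row projection, and
  \<open>path_lift\<close> serves the column.\<close>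

lemma path_end_surj:
  assumes "acyclic_at (K (Suc q)) 0" "y \<in> carrier (Level (K q) p)"
  shows "\<exists>x\<in>path_set (K (Suc q)) p. path_end q p x = y"
proof -
  let ?s = "Degen (R p) q q y"
  have s: "?s \<in> carrier (Level (K (Suc q)) p)" using assms by (simp add: row_Degen)
  obtain x where x: "x \<in> path_set (K (Suc q)) p" "Face (K (Suc q)) (Suc p) (Suc p) x = ?s"
    using simplicial_group.path_lift[OF col assms(1) s] by blast
  have "path_end q p x = y"
    using face_face_comm[of "Suc p" p "Suc q" q x] path_set_carrier[OF x(1)] x(2) row_Face_Degen_eq[of "Suc q" q q y p] assms(2)
    by simp
  then show ?thesis using x(1) by blast
qed

lemma path_end_col:
  assumes "acyclic_at (K (Suc q)) 0"
  shows "simplicial_surjection (path_col q) (K q) (path_end q)"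
proof (intro simplicial_surjection.intro simplicial_map.intro simplicial_map_axioms.intro
    simplicial_surjection_axioms.intro simplicial_group.simplicial_group_path col path_end_hom)
  fix n i x assume "i \<le> Suc n" "x \<in> carrier (Level (path_col q) (Suc n))"
  then show "path_end q n (Face (path_col q) (Suc n) i x) = Face (K q) (Suc n) i (path_end q (Suc n) x)"
    using simplicial_group.Face_Face[OF col, of i "Suc (Suc n)" n "Face (R (Suc (Suc n))) (Suc q) (Suc q) x" q]
    by (simp add: path_set_carrier row_Face face_face_comm[symmetric])
next
  fix n i x assume "i \<le> n" "x \<in> carrier (Level (path_col q) n)"
  then show "path_end q (Suc n) (Degen (path_col q) n i x) = Degen (K q) n i (path_end q n x)"
    using simplicial_group.Face_Degen_greater[OF col, of i "Suc (Suc n)" n "Face (R (Suc n)) (Suc q) (Suc q) x" q]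
    by (simp add: path_set_carrier row_Face degen_face_comm[symmetric])
next
  fix n y assume "y \<in> carrier (Level (K q) n)"
  then show "\<exists>x\<in>carrier (Level (path_col q) n). path_end q n x = y"
    using path_end_surj[OF assms] by simp
qed

lemma path_end_diag:
  assumes "\<And>q. acyclic_at (K q) 0"
  shows "simplicial_surjection (diag_sgroup path_col path_row) (diag_sgroup K R) (\<lambda>n. path_end n n)"
proof -
  interpret D: simplicial_group "diag_sgroup K R" by (rule simplicial_group_diag)
  interpret P: bisimplicial_group path_col path_row by (rule bisimplicial_path)
  show ?thesis
  proof (intro simplicial_surjection.intro simplicial_map.intro simplicial_map_axioms.intro
      simplicial_surjection_axioms.intro D.simplicial_group_axioms P.simplicial_group_diag)
    fix n show "path_end n n \<in> hom (Level (diag_sgroup path_col path_row) n) (Level (diag_sgroup K R) n)"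
      using path_end_hom[of n n] by simp
  next
    fix n i x assume "i \<le> Suc n" "x \<in> carrier (Level (diag_sgroup path_col path_row) (Suc n))"
    then show "path_end n n (Face (diag_sgroup path_col path_row) (Suc n) i x) =
        Face (diag_sgroup K R) (Suc n) i (path_end (Suc n) (Suc n) x)"
      using D.Face_Face[of i "Suc (Suc n)" n x] by (simp add: path_set_carrier)
  next
    fix n i x assume "i \<le> n" "x \<in> carrier (Level (diag_sgroup path_col path_row) n)"
    then show "path_end (Suc n) (Suc n) (Degen (diag_sgroup path_col path_row) n i x) =
        Degen (diag_sgroup K R) n i (path_end n n x)"
      using D.Face_Degen_greater[of i "Suc (Suc n)" n x] by (simp add: path_set_carrier)
  next
    fix n y assume "y \<in> carrier (Level (diag_sgroup K R) n)"
    then show "\<exists>x\<in>carrier (Level (diag_sgroup path_col path_row) n). path_end n n x = y"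
      using path_end_surj[OF assms] by simp
  qed
qed

text \<open>The diagonal of the path object lies in the decalage of the diagonal, and the last degeneracy of the
  diagonal preserves it; so the argument of \<open>acyclic_path\<close> applies verbatim.\<close>

lemma acyclic_path_diag: "acyclic_at (diag_sgroup path_col path_row) n"
  unfolding acyclic_at_def
proof
  interpret D: simplicial_group "diag_sgroup K R" by (rule simplicial_group_diag)
  interpret P: bisimplicial_group path_col path_row by (rule bisimplicial_path)
  let ?D = "diag_sgroup K R" and ?P = "diag_sgroup path_col path_row"
  fix x assume x: "x \<in> cycles ?P n"
  then have xp: "x \<in> path_set (K (Suc n)) n" using cycles_carrier by fastforce
  then have xc: "x \<in> carrier (Level ?D (Suc n))" by (simp add: path_set_carrier)
  let ?s = "Degen ?D (Suc n) (Suc n) x"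
  have s: "?s \<in> path_set (K (Suc (Suc n))) (Suc n)"
  proof -
    have "Degen (R (Suc n)) (Suc n) (Suc n) x \<in> path_set (K (Suc (Suc n))) n"
      using xp last_vertex_row_Degen[of "Suc n" "Suc n" x "Suc n"]
      by (simp add: path_set_def row_Degen row_Degen_one del: last_vertex.simps)
    then show ?thesis using simplicial_group.path_set_Degen[OF col, of "Suc n" n _ "Suc (Suc n)"] by simp
  qed
  have "Face ?D (Suc (Suc n)) i ?s = \<one>\<^bsub>Level ?D (Suc n)\<^esub>" if "i \<le> n" for i
  proof -
    have "Face ?D (Suc n) i x = \<one>\<^bsub>Level ?D n\<^esub>"
    proof (cases n)
      case 0
      then show ?thesis using xp that face_face_comm[of 0 0 0 0 x] row_Face_one[of 0 0 0] by (simp add: path_set_def)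
    next
      case (Suc m)
      then show ?thesis using x that by (simp add: cycles_Suc)
    qed
    then show ?thesis using D.Face_Degen_less[of i "Suc n" n x] D.Degen_one[of n n] that xc by simp
  qed
  moreover have "Face ?D (Suc (Suc n)) (Suc n) ?s = x"
    using D.Face_Degen_eq[of "Suc n" "Suc n" "Suc n" x] xc by simp
  ultimately show "x \<in> boundaries ?P n"
    using s by (intro boundariesI[of ?s]) (simp_all add: moore_Suc)
qed

end

text \<open>Dimension shifting along \<open>path_end\<close>, whose source has an acyclic diagonal: its kernel has acyclic
  columns by the exact sequence applied in each column, so the induction hypothesis covers the
  diagonal of the kernel.\<close>

theorem acyclic_diag:
  assumes "bisimplicial_group K R" "\<And>q m. acyclic_at (K q) m"
  shows "acyclic_at (diag_sgroup K R) n"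
  using assms
proof (induction n arbitrary: K R)
  case 0
  interpret bisimplicial_group K R by (rule 0(1))
  interpret s: simplicial_surjection "diag_sgroup path_col path_row" "diag_sgroup K R" "\<lambda>n. path_end n n"
    by (rule path_end_diag) (rule 0(2))
  show ?case by (rule s.acyclic_base[OF acyclic_path_diag]) simp
next
  case (Suc n)
  interpret bisimplicial_group K R by (rule Suc.prems(1))
  interpret P: bisimplicial_group path_col path_row by (rule bisimplicial_path)
  interpret s: simplicial_surjection "diag_sgroup path_col path_row" "diag_sgroup K R" "\<lambda>n. path_end n n"
    by (rule path_end_diag) (rule Suc.prems(2))
  interpret c: simplicial_surjection "path_col q" "K q" "path_end q" for q
    by (rule path_end_col) (rule Suc.prems(2))
  let ?H = "\<lambda>p q. c.ker q p"
  let ?ker_col = "\<lambda>q. sub_sgroup (path_col q) (\<lambda>p. ?H p q)" and ?ker_row = "\<lambda>p. sub_sgroup (path_row p) (?H p)"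
  have "bisimplicial_group ?ker_col ?ker_row"
  proof (rule P.bisimplicial_sub)
    show "subgroup (?H p q) (Level (path_col q) p)" for p q by (rule c.ker_subgroup)
    show "Face (path_col q) (Suc p) i x \<in> ?H p q" if "i \<le> Suc p" "x \<in> ?H (Suc p) q" for p q i x
      using simplicial_group.Face_closed[OF c.simplicial_group_Ker that(1), of x q] that(2) by simp
    show "Degen (path_col q) p i x \<in> ?H (Suc p) q" if "i \<le> p" "x \<in> ?H p q" for p q i x
      using simplicial_group.Degen_closed[OF c.simplicial_group_Ker that(1), of x q] that(2) by simp
    show "Face (path_row p) (Suc q) i x \<in> ?H p q" if "i \<le> Suc q" "x \<in> ?H p (Suc q)" for p q i x
    proof -
      have x: "x \<in> path_set (K (Suc (Suc q))) p" "path_end (Suc q) p x = \<one>\<^bsub>Level (K (Suc q)) p\<^esub>"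
        using that(2) unfolding c.ker_iff by simp_all
      note xc = path_set_carrier[OF x(1)]
      have "path_end q p (Face (R (Suc p)) (Suc (Suc q)) i x) = Face (R p) (Suc q) i (path_end (Suc q) p x)"
        using row_Face_Face[of i "Suc (Suc q)" q "Face (K (Suc (Suc q))) (Suc p) (Suc p) x" p] that(1) xc
        by (simp add: face_face_comm row_Face col_Face)
      then show ?thesis using P.row_Face[OF that(1), of x p] x that(1)
        unfolding c.ker_iff by (simp add: row_Face_one)
    qed
    show "Degen (path_row p) q i x \<in> ?H p (Suc q)" if "i \<le> q" "x \<in> ?H p q" for p q i x
    proof -
      have x: "x \<in> path_set (K (Suc q)) p" "path_end q p x = \<one>\<^bsub>Level (K q) p\<^esub>"
        using that(2) unfolding c.ker_iff by simp_all
      note xc = path_set_carrier[OF x(1)]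
      have "path_end (Suc q) p (Degen (R (Suc p)) (Suc q) i x) = Degen (R p) q i (path_end q p x)"
        using row_Face_Degen_greater[of i "Suc (Suc q)" q x "Suc p"] that(1) xc
        by (simp add: face_degen_comm row_Face)
      then show ?thesis using P.row_Degen[OF that(1), of x p] x that(1)
        unfolding c.ker_iff by (simp add: row_Degen_one)
    qed
  qed
  moreover have "acyclic_at (?ker_col q) m" for q m
    by (rule c.acyclic_Ker[OF simplicial_group.acyclic_path[OF col] Suc.prems(2)])
  ultimately have "acyclic_at (diag_sgroup ?ker_col ?ker_row) n" by (rule Suc.IH)
  also have "diag_sgroup ?ker_col ?ker_row = sub_sgroup (diag_sgroup path_col path_row) s.ker"
    unfolding diag_sub_sgroup by simp
  finally show ?case by (intro s.acyclic_base acyclic_path_diag) simp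
qed

section \<open>Augmented bisimplicial groups\<close>

context bisimplicial_group
begin

text \<open>The two diagonals differ only in the order of the two commuting operations, so the identity is a
  simplicial isomorphism between them.\<close>

lemma diag_swap_iso: "homotopy_group n (diag_sgroup K R) \<cong> homotopy_group n (diag_sgroup R K)"
proof -
  interpret sw: bisimplicial_group R K by (rule swap)
  interpret D: simplicial_group "diag_sgroup K R" by (rule simplicial_group_diag)
  interpret s: simplicial_surjection "diag_sgroup K R" "diag_sgroup R K" "\<lambda>_ x. x"
    by (intro simplicial_surjection.intro simplicial_map.intro simplicial_map_axioms.intro
        simplicial_surjection_axioms.intro simplicial_group_diag sw.simplicial_group_diag)
      (auto simp: Level_row face_face_comm degen_degen_comm hom_def group.is_monoid[OF D.Level_group, simplified])
  have "acyclic_at s.Ker m" for m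
    unfolding acyclic_at_def
  proof
    interpret Ker: simplicial_group s.Ker by (rule s.simplicial_group_Ker)
    fix x assume "x \<in> cycles s.Ker m"
    then have "x = \<one>\<^bsub>Level s.Ker m\<^esub>" unfolding s.cycles_Ker by (simp add: Level_row)
    then show "x \<in> boundaries s.Ker m"
      using Ker.Face_one subgroup.one_closed[OF Ker.moore_subgroup]
      by (intro boundariesI[of "\<one>\<^bsub>Level s.Ker (Suc m)\<^esub>"]) auto
  qed
  then show ?thesis by (rule s.homotopy_group_iso)
qed

end

text \<open>Every column \<open>K q\<close> is augmented by \<open>\<epsilon> q\<close> over the group \<open>Level T q\<close>, naturally in \<open>q\<close>, and carries
  an extra degeneracy \<open>\<sigma> q\<close> in last position, whose
  remaining face on level \<open>0\<close> is the augmentation followed by a map \<open>s q\<close> back from \<open>Level T q\<close>.  The maps \<open>\<sigma> q\<close> and \<open>s q\<close> are chosen separately in every column.\<close>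

locale contracted_bisimplicial = bisimplicial_group K R + T: simplicial_group T
  for K R :: "nat \<Rightarrow> 'g sgroup" and T :: "'h sgroup" +
  fixes \<epsilon> :: "nat \<Rightarrow> 'g \<Rightarrow> 'h" and s :: "nat \<Rightarrow> 'h \<Rightarrow> 'g" and \<sigma> :: "nat \<Rightarrow> nat \<Rightarrow> 'g \<Rightarrow> 'g"
  assumes \<epsilon>_hom: "\<epsilon> q \<in> hom (Level (K q) 0) (Level T q)"
    and \<epsilon>_surj: "y \<in> carrier (Level T q) \<Longrightarrow> \<exists>x\<in>carrier (Level (K q) 0). \<epsilon> q x = y"
    and \<epsilon>_coequal: "x \<in> carrier (Level (K q) (Suc 0)) \<Longrightarrow>
      \<epsilon> q (Face (K q) (Suc 0) 0 x) = \<epsilon> q (Face (K q) (Suc 0) (Suc 0) x)"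
    and \<epsilon>_Face: "\<lbrakk>i \<le> Suc q; x \<in> carrier (Level (K (Suc q)) 0)\<rbrakk> \<Longrightarrow>
      \<epsilon> q (Face (R 0) (Suc q) i x) = Face T (Suc q) i (\<epsilon> (Suc q) x)"
    and \<epsilon>_Degen: "\<lbrakk>i \<le> q; x \<in> carrier (Level (K q) 0)\<rbrakk> \<Longrightarrow>
      \<epsilon> (Suc q) (Degen (R 0) q i x) = Degen T q i (\<epsilon> q x)"
    and s_one: "s q \<one>\<^bsub>Level T q\<^esub> = \<one>\<^bsub>Level (K q) 0\<^esub>"
    and \<sigma>_closed: "x \<in> carrier (Level (K q) p) \<Longrightarrow> \<sigma> q p x \<in> carrier (Level (K q) (Suc p))"
    and \<sigma>_one: "\<sigma> q p \<one>\<^bsub>Level (K q) p\<^esub> = \<one>\<^bsub>Level (K q) (Suc p)\<^esub>"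
    and \<sigma>_top: "x \<in> carrier (Level (K q) p) \<Longrightarrow> Face (K q) (Suc p) (Suc p) (\<sigma> q p x) = x"
    and \<sigma>_Face: "\<lbrakk>i \<le> Suc p; x \<in> carrier (Level (K q) (Suc p))\<rbrakk> \<Longrightarrow>
      Face (K q) (Suc (Suc p)) i (\<sigma> q (Suc p) x) = \<sigma> q p (Face (K q) (Suc p) i x)"
    and \<sigma>_0: "x \<in> carrier (Level (K q) 0) \<Longrightarrow> Face (K q) (Suc 0) 0 (\<sigma> q 0 x) = s q (\<epsilon> q x)"
begin

abbreviation "aug q p x \<equiv> \<epsilon> q (last_vertex (K q) p x)"

text \<open>Iterated \<open>d\<^sub>0\<close> absorbs all faces but the last; the last one becomes \<open>d\<^sub>1\<close> on level \<open>1\<close>, which \<open>\<epsilon>\<close>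
  identifies with \<open>d\<^sub>0\<close>.\<close>

lemma aug_Face: "\<lbrakk>i \<le> Suc p; x \<in> carrier (Level (K q) (Suc p))\<rbrakk> \<Longrightarrow> aug q p (Face (K q) (Suc p) i x) = aug q (Suc p) x"
proof (induction p arbitrary: i x)
  case 0
  then show ?case using \<epsilon>_coequal[of x q] by (auto simp: le_Suc_eq)
next
  case (Suc p)
  show ?case
  proof (cases "i = Suc (Suc p)")
    case True
    have "aug q (Suc p) (Face (K q) (Suc (Suc p)) i x) = aug q p (Face (K q) (Suc p) (Suc p) (Face (K q) (Suc (Suc p)) 0 x))"
      using simplicial_group.Face_Face[OF col, of 0 i p x q] Suc.prems True by simp
    also have "\<dots> = aug q (Suc p) (Face (K q) (Suc (Suc p)) 0 x)"
      using Suc.IH[of "Suc p" "Face (K q) (Suc (Suc p)) 0 x"] Suc.prems by (simp add: col_Face)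
    finally show ?thesis by simp
  next
    case False
    then show ?thesis
      using simplicial_group.last_vertex_Face[OF col, of i "Suc p" x q] Suc.prems by (simp del: last_vertex.simps)
  qed
qed

lemma aug_Degen: "\<lbrakk>i \<le> p; x \<in> carrier (Level (K q) p)\<rbrakk> \<Longrightarrow> aug q (Suc p) (Degen (K q) p i x) = aug q p x"
  using simplicial_group.last_vertex_Degen[OF col] by (simp del: last_vertex.simps)

lemma aug_row_Face: "\<lbrakk>i \<le> Suc q; x \<in> carrier (Level (K (Suc q)) p)\<rbrakk> \<Longrightarrow>
    aug q p (Face (R p) (Suc q) i x) = Face T (Suc q) i (aug (Suc q) p x)"
  by (simp add: last_vertex_row_Face \<epsilon>_Face simplicial_group.last_vertex_closed[OF col])

lemma aug_row_Degen: "\<lbrakk>i \<le> q; x \<in> carrier (Level (K q) p)\<rbrakk> \<Longrightarrow>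
    aug (Suc q) p (Degen (R p) q i x) = Degen T q i (aug q p x)"
  by (simp add: last_vertex_row_Degen \<epsilon>_Degen simplicial_group.last_vertex_closed[OF col])

lemma aug_hom: "aug q p \<in> hom (Level (K q) p) (Level T q)"
  using hom_compose[OF simplicial_group.last_vertex_hom[OF col] \<epsilon>_hom] by (simp add: comp_def)

lemma aug_surj: "y \<in> carrier (Level T q) \<Longrightarrow> \<exists>x\<in>carrier (Level (K q) p). aug q p x = y"
  using \<epsilon>_surj simplicial_group.last_vertex_surj[OF col] by metis

lemma aug_group_hom: "group_hom (Level (K q) p) (Level T q) (aug q p)"
  by (simp add: group_hom_def group_hom_axioms_def aug_hom T.Level_group simplicial_group.Level_group[OF col])

abbreviation "aug_ker p q \<equiv> kernel (Level (K q) p) (Level T q) (aug q p)"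
abbreviation "ker_col \<equiv> (\<lambda>q. sub_sgroup (K q) (\<lambda>p. aug_ker p q))"
abbreviation "ker_row \<equiv> (\<lambda>p. sub_sgroup (R p) (aug_ker p))"

lemma aug_ker_iff: "x \<in> aug_ker p q \<longleftrightarrow> x \<in> carrier (Level (K q) p) \<and> aug q p x = \<one>\<^bsub>Level T q\<^esub>"
  by (simp add: kernel_def)

lemma bisimplicial_ker: "bisimplicial_group ker_col ker_row"
proof (rule bisimplicial_sub)
  show "subgroup (aug_ker p q) (Level (K q) p)" for p q
    by (rule group_hom.subgroup_kernel[OF aug_group_hom])
  show "Face (K q) (Suc p) i x \<in> aug_ker p q" if "i \<le> Suc p" "x \<in> aug_ker (Suc p) q" for p q i x
    using that unfolding aug_ker_iff by (simp add: aug_Face col_Face)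
  show "Degen (K q) p i x \<in> aug_ker (Suc p) q" if "i \<le> p" "x \<in> aug_ker p q" for p q i x
    using that unfolding aug_ker_iff by (simp add: aug_Degen col_Degen del: last_vertex.simps)
  show "Face (R p) (Suc q) i x \<in> aug_ker p q" if "i \<le> Suc q" "x \<in> aug_ker p (Suc q)" for p q i x
    using that unfolding aug_ker_iff by (simp add: aug_row_Face row_Face T.Face_one)
  show "Degen (R p) q i x \<in> aug_ker p (Suc q)" if "i \<le> q" "x \<in> aug_ker p q" for p q i x
    using that unfolding aug_ker_iff by (simp add: aug_row_Degen row_Degen T.Degen_one)
qed

text \<open>On the kernel of the augmentation \<open>\<sigma>\<close> contracts onto \<open>1\<close>, so that \<open>\<sigma> x\<close> bounds \<open>x\<close>.\<close>

lemma acyclic_ker_col: "acyclic_at (ker_col q) p"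
  unfolding acyclic_at_def
proof
  fix x assume x: "x \<in> cycles (ker_col q) p"
  then have "x \<in> carrier (Level (ker_col q) p)" by (rule cycles_carrier)
  then have xk: "x \<in> carrier (Level (K q) p)" "aug q p x = \<one>\<^bsub>Level T q\<^esub>" by (simp_all add: aug_ker_iff)
  have "aug q (Suc p) (\<sigma> q p x) = \<one>\<^bsub>Level T q\<^esub>"
    using aug_Face[of "Suc p" p "\<sigma> q p x" q] xk by (simp add: \<sigma>_top \<sigma>_closed del: last_vertex.simps)
  then have "\<sigma> q p x \<in> aug_ker (Suc p) q"
    using xk \<sigma>_closed unfolding aug_ker_iff by blast
  moreover have "Face (K q) (Suc p) i (\<sigma> q p x) = \<one>\<^bsub>Level (K q) p\<^esub>" if "i \<le> p" for i
  proof (cases p)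
    case 0
    then show ?thesis using \<sigma>_0[of x q] xk that by (simp add: s_one)
  next
    case (Suc m)
    then show ?thesis using \<sigma>_Face[of i m x q] x xk that \<sigma>_one by (simp add: cycles_Suc)
  qed
  ultimately show "x \<in> boundaries (ker_col q) p"
    using xk by (intro boundariesI[of "\<sigma> q p x"]) (simp_all add: moore_Suc \<sigma>_top)
qed

theorem diag_iso: "homotopy_group n (diag_sgroup K R) \<cong> homotopy_group n T"
proof -
  interpret a: simplicial_surjection "diag_sgroup K R" T "\<lambda>n. aug n n"
  proof (intro simplicial_surjection.intro simplicial_map.intro simplicial_map_axioms.intro
      simplicial_surjection_axioms.intro simplicial_group_diag T.simplicial_group_axioms)
    fix n show "aug n n \<in> hom (Level (diag_sgroup K R) n) (Level T n)" using aug_hom by simp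
  next
    fix i n x assume "i \<le> Suc n" "x \<in> carrier (Level (diag_sgroup K R) (Suc n))"
    then show "aug n n (Face (diag_sgroup K R) (Suc n) i x) = Face T (Suc n) i (aug (Suc n) (Suc n) x)"
      by (simp add: aug_Face row_Face aug_row_Face del: last_vertex.simps)
  next
    fix i n x assume "i \<le> n" "x \<in> carrier (Level (diag_sgroup K R) n)"
    then show "aug (Suc n) (Suc n) (Degen (diag_sgroup K R) n i x) = Degen T n i (aug n n x)"
      by (simp add: aug_Degen row_Degen aug_row_Degen del: last_vertex.simps)
  next
    fix n y assume "y \<in> carrier (Level T n)"
    then show "\<exists>x\<in>carrier (Level (diag_sgroup K R) n). aug n n x = y" using aug_surj by simp
  qed
  have "acyclic_at (diag_sgroup ker_col ker_row) m" for m
    by (rule acyclic_diag[OF bisimplicial_ker acyclic_ker_col])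
  then have "acyclic_at a.Ker m" for m
    unfolding diag_sub_sgroup by simp
  then show ?thesis by (rule a.homotopy_group_iso)
qed

end

lemma contracted_both_iso:
  assumes T: "contracted_bisimplicial K R T \<epsilon> s \<sigma>" and A: "contracted_bisimplicial R K A \<epsilon>' s' \<sigma>'"
  shows "homotopy_group n A \<cong> homotopy_group n T"
proof -
  interpret T: contracted_bisimplicial K R T \<epsilon> s \<sigma> by (rule T)
  interpret A: contracted_bisimplicial R K A \<epsilon>' s' \<sigma>' by (rule A)
  have "homotopy_group n A \<cong> homotopy_group n (diag_sgroup R K)"
    using group.iso_sym[OF simplicial_group.group_homotopy_group[OF A.simplicial_group_diag] A.diag_iso] .
  also have "\<dots> \<cong> homotopy_group n (diag_sgroup K R)"
    by (rule A.diag_swap_iso)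
  also have "\<dots> \<cong> homotopy_group n T" by (rule T.diag_iso)
  finally show ?thesis .
qed

section \<open>Maps between free products\<close>

text \<open>All maps between free products below send letters to letters, so that identities between
  composites need only be checked on letters.\<close>

definition letter_hom :: "'j set \<Rightarrow> ('j \<Rightarrow> 'h monoid) \<Rightarrow> 'i set \<Rightarrow> ('i \<Rightarrow> 'g monoid) \<Rightarrow> ('j \<times> 'h \<Rightarrow> 'i \<times> 'g) \<Rightarrow> bool" where
  "letter_hom J H I G f \<longleftrightarrow> (\<exists>p q. letter_map J H {} I G {} f p q)"

lemma letter_homI:
  assumes "\<And>j x. f (j, x) = (p j, q j x)" "\<And>j. j \<in> J \<Longrightarrow> p j \<in> I"
    "\<And>j. j \<in> J \<Longrightarrow> q j \<in> hom (H j) (G (p j))"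
    "\<And>j. j \<in> J \<Longrightarrow> group (H j)" "\<And>i. i \<in> I \<Longrightarrow> group (G i)"
  shows "letter_hom J H I G f"
  unfolding letter_hom_def using assms by (intro exI[of _ p] exI[of _ q] letter_map.intro) auto

lemma letter_hom_letters: "\<lbrakk>letter_hom J H I G f; a \<in> letters J H\<rbrakk> \<Longrightarrow> f a \<in> letters I G"
  unfolding letter_hom_def using letter_map.f_letters by metis

lemma free_prod_map_hom: "letter_hom J H I G f \<Longrightarrow> free_prod_map I G f \<in> hom (free_prod J H) (free_prod I G)"
  unfolding letter_hom_def free_prod_map_def free_prod_def using letter_map.amalg_map_hom by metis

lemma free_prod_map_class:
  assumes "letter_hom J H I G f" "w \<in> lists (letters J H)"
  shows "free_prod_map I G f (word_cong J H {} `` {w}) = word_cong I G {} `` {map f w}"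
    and "map f w \<in> lists (letters I G)"
  using assms letter_map.amalg_map_class letter_map.map_f_lists
  unfolding letter_hom_def free_prod_map_def by metis+

lemma free_prod_map_letter:
  assumes "letter_hom J H I G f" "a \<in> letters J H"
  shows "free_prod_map I G f (word_cong J H {} `` {[a]}) = word_cong I G {} `` {[f a]}"
  using free_prod_map_class(1)[OF assms(1), of "[a]"] assms(2) by simp

lemma letter_in_free_prod: "a \<in> letters J H \<Longrightarrow> word_cong J H {} `` {[a]} \<in> carrier (free_prod J H)"
  unfolding free_prod_def by (rule amalg_class_closed) simp

lemma group_free_prod: "(\<And>i. i \<in> I \<Longrightarrow> group (G i)) \<Longrightarrow> group (free_prod I G)"
  unfolding free_prod_def by (rule group_amalg)

lemma free_prod_map_comp_eq:
  assumes f: "letter_hom J H I G f" "letter_hom I G L M g"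
    and f': "letter_hom J H I' G' f'" "letter_hom I' G' L M g'"
    and eq: "\<And>a. a \<in> letters J H \<Longrightarrow> g (f a) = g' (f' a)"
    and K: "K \<in> carrier (free_prod J H)"
  shows "free_prod_map L M g (free_prod_map I G f K) = free_prod_map L M g' (free_prod_map I' G' f' K)"
proof -
  from K obtain w where w: "w \<in> lists (letters J H)" "K = word_cong J H {} `` {w}"
    unfolding free_prod_def by (rule amalg_classE)
  have "map g (map f w) = map g' (map f' w)" using eq w(1) by auto
  then show ?thesis
    unfolding w(2) free_prod_map_class(1)[OF f(1) w(1)] free_prod_map_class(1)[OF f'(1) w(1)]
      free_prod_map_class(1)[OF f(2) free_prod_map_class(2)[OF f(1) w(1)]]
      free_prod_map_class(1)[OF f'(2) free_prod_map_class(2)[OF f'(1) w(1)]] by (simp only:)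
qed

lemma free_prod_map_comp:
  assumes f: "letter_hom J H I G f" "letter_hom I G L M g" and f': "letter_hom J H L M f'"
    and eq: "\<And>a. a \<in> letters J H \<Longrightarrow> g (f a) = f' a"
    and K: "K \<in> carrier (free_prod J H)"
  shows "free_prod_map L M g (free_prod_map I G f K) = free_prod_map L M f' K"
proof -
  from K obtain w where w: "w \<in> lists (letters J H)" "K = word_cong J H {} `` {w}"
    unfolding free_prod_def by (rule amalg_classE)
  have "map g (map f w) = map f' w" using eq w(1) by auto
  then show ?thesis
    unfolding w(2) free_prod_map_class(1)[OF f(1) w(1)] free_prod_map_class(1)[OF f'(1) w(1)]
      free_prod_map_class(1)[OF f(2) free_prod_map_class(2)[OF f(1) w(1)]] by (simp only:)
qed

lemma free_prod_map_id:
  assumes f: "letter_hom J H J H f"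
    and eq: "\<And>a. a \<in> letters J H \<Longrightarrow> f a = a"
    and K: "K \<in> carrier (free_prod J H)"
  shows "free_prod_map J H f K = K"
proof -
  from K obtain w where w: "w \<in> lists (letters J H)" "K = word_cong J H {} `` {w}"
    unfolding free_prod_def by (rule amalg_classE)
  have "map f w = w" using eq w(1) by (intro map_idI) auto
  then show ?thesis unfolding w(2) free_prod_map_class(1)[OF f(1) w(1)] by simp
qed

lemma free_prod_map_inverse:
  assumes f: "letter_hom J H I G f" "letter_hom I G J H g"
    and eq: "\<And>a. a \<in> letters J H \<Longrightarrow> g (f a) = a"
    and K: "K \<in> carrier (free_prod J H)"
  shows "free_prod_map J H g (free_prod_map I G f K) = K"
proof -
  from K obtain w where w: "w \<in> lists (letters J H)" "K = word_cong J H {} `` {w}"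
    unfolding free_prod_def by (rule amalg_classE)
  have "map g (map f w) = w" unfolding map_map using eq w(1) by (intro map_idI) auto
  then show ?thesis
    unfolding w(2) free_prod_map_class(1)[OF f(1) w(1)]
      free_prod_map_class(1)[OF f(2) free_prod_map_class(2)[OF f(1) w(1)]] by (simp only:)
qed

lemma hom_free_prod_unique:
  assumes "group H" "\<And>i. i \<in> I \<Longrightarrow> group (G i)"
    "f \<in> hom (free_prod I G) H" "g \<in> hom (free_prod I G) H"
    "\<And>a. a \<in> letters I G \<Longrightarrow> f (word_cong I G {} `` {[a]}) = g (word_cong I G {} `` {[a]})"
    "K \<in> carrier (free_prod I G)"
  shows "f K = g K"
  using hom_amalg_unique[of H I G f "{}" g K] assms unfolding free_prod_def by blast

section \<open>The bisimplicial replacement\<close>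

context category
begin

lemma nerve_vertex_face:
  assumes "(c, as) \<in> nerve C (Suc n)" "i \<le> Suc n"
  shows "nerve_vertex C (nerve_face C i (c, as)) n = nerve_vertex C (c, as) (if i = Suc n then n else Suc n)"
proof -
  note D = nerveD[OF assms(1)]
  obtain c' as' where e: "nerve_face C i (c, as) = (c', as')" by force
  show ?thesis
  proof (cases n)
    case 0
    then show ?thesis using fst_nerve_face[OF D(2), of i c] assms(2) by (auto simp: e nerve_vertex_def)
  next
    case (Suc m)
    then show ?thesis using nth_nerve_face[OF D(2) assms(2), of m c] D(3)[of m] D(3)[of "Suc m"] D(5)[of m] assms(2)
      by (auto simp: e nerve_vertex_def Cod_Comp)
  qed
qed

lemma nerve_vertex_degen:
  assumes "(c, as) \<in> nerve C n" "i \<le> n"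
  shows "nerve_vertex C (nerve_degen C i (c, as)) (Suc n) = nerve_vertex C (c, as) n"
proof -
  note D = nerveD[OF assms(1)]
  obtain c' as' where e: "nerve_degen C i (c, as) = (c', as')" by force
  show ?thesis using nth_nerve_degen[OF D(2) assms(2), of n c] nerve_vertex_Obj[OF assms(1), of n] assms(2)
    by (auto simp: e nerve_vertex_def Cod_Ide)
qed

lemma last_nerve_face:
  assumes "length as = Suc (Suc n)" "i \<le> Suc n"
  shows "last (snd (nerve_face C i (c, as))) = (if i = Suc n then Comp C (as ! Suc n) (as ! n) else as ! Suc n)"
proof -
  have "i \<le> Suc (Suc n)" using assms(2) by simp
  note l = length_nerve_face[OF assms(1) this, of c] nth_nerve_face[OF assms(1) this, of n c]
  have "last (snd (nerve_face C i (c, as))) = snd (nerve_face C i (c, as)) ! n"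
    using l(1) by (subst last_conv_nth) auto
  then show ?thesis using l(2) assms(2) by auto
qed

lemma last_nerve_degen:
  assumes "length as = n" "i \<le> n"
  shows "last (snd (nerve_degen C i (c, as))) = (if i = n then Ide C (nerve_vertex C (c, as) n) else as ! (n - 1))"
proof -
  have "last (snd (nerve_degen C i (c, as))) = snd (nerve_degen C i (c, as)) ! n"
    using length_nerve_degen[OF assms, of c] by (subst last_conv_nth) auto
  then show ?thesis using nth_nerve_degen[OF assms, of n c] assms(2) by auto
qed

end

context kan_data
begin

interpretation R: replacement_data C F ..

text \<open>The indices of \<open>B\<^sub>p\<^sub>,\<^sub>d\<close>: a chain of length \<open>p\<close> and an arrow from the image of its last vertex to \<open>d\<close>.
  Equivalently, these are the \<open>p\<close>-simplices of the nerve of the comma category \<open>S \<down> d\<close>, the arrows from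
  the other vertices being determined as composites.\<close>

definition chain_index :: "nat \<Rightarrow> 'p \<Rightarrow> (('o \<times> 'm list) \<times> 'q) set" where
  "chain_index p d = {(\<sigma>, \<phi>). \<sigma> \<in> nerve C p \<and> \<phi> \<in> Arr D \<and> Dom D \<phi> = FObj S (nerve_vertex C \<sigma> p) \<and> Cod D \<phi> = d}"

abbreviation chain_grp :: "(('o \<times> 'm list) \<times> 'q) \<Rightarrow> 'g monoid" where
  "chain_grp \<equiv> (\<lambda>(\<sigma>, \<phi>). Grp F (fst \<sigma>))"

text \<open>The arrow \<open>\<phi>\<close> is attached to the last vertex, so it changes only when that vertex is dropped.\<close>

definition chain_face :: "nat \<Rightarrow> (('o \<times> 'm list) \<times> 'q) \<times> 'g \<Rightarrow> (('o \<times> 'm list) \<times> 'q) \<times> 'g" where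
  "chain_face i = (\<lambda>((\<sigma>, \<phi>), x).
     ((nerve_face C i \<sigma>, if i = length (snd \<sigma>) then Comp D \<phi> (FArr S (last (snd \<sigma>))) else \<phi>),
      if i = 0 then Act F (hd (snd \<sigma>)) x else x))"

definition chain_degen :: "nat \<Rightarrow> (('o \<times> 'm list) \<times> 'q) \<times> 'g \<Rightarrow> (('o \<times> 'm list) \<times> 'q) \<times> 'g" where
  "chain_degen i = (\<lambda>((\<sigma>, \<phi>), x). ((nerve_degen C i \<sigma>, \<phi>), x))"

definition chain_push :: "'q \<Rightarrow> (('o \<times> 'm list) \<times> 'q) \<times> 'g \<Rightarrow> (('o \<times> 'm list) \<times> 'q) \<times> 'g" where
  "chain_push \<beta> = (\<lambda>((\<sigma>, \<phi>), x). ((\<sigma>, Comp D \<beta> \<phi>), x))"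

definition rep_col :: "'p \<Rightarrow> ((('o \<times> 'm list) \<times> 'q) \<times> 'g) list set sgroup" where
  "rep_col d = \<lparr>Level = (\<lambda>p. free_prod (chain_index p d) chain_grp),
     Face = (\<lambda>p i. free_prod_map (chain_index (p - 1) d) chain_grp (chain_face i)),
     Degen = (\<lambda>p i. free_prod_map (chain_index (Suc p) d) chain_grp (chain_degen i))\<rparr>"

definition rep_row :: "nat \<Rightarrow> ('p, 'q, ((('o \<times> 'm list) \<times> 'q) \<times> 'g) list set) grp_diagram" where
  "rep_row p = \<lparr>Grp = (\<lambda>d. free_prod (chain_index p d) chain_grp),
     Act = (\<lambda>\<beta>. free_prod_map (chain_index p (Cod D \<beta>)) chain_grp (chain_push \<beta>))\<rparr>"

lemma rep_col_simps:
  "Level (rep_col d) p = free_prod (chain_index p d) chain_grp"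
  "Face (rep_col d) (Suc p) i = free_prod_map (chain_index p d) chain_grp (chain_face i)"
  "Degen (rep_col d) p i = free_prod_map (chain_index (Suc p) d) chain_grp (chain_degen i)"
  by (simp_all add: rep_col_def)

lemma rep_row_simps:
  "Grp (rep_row p) d = free_prod (chain_index p d) chain_grp"
  "Act (rep_row p) \<beta> = free_prod_map (chain_index p (Cod D \<beta>)) chain_grp (chain_push \<beta>)"
  by (simp_all add: rep_row_def)

lemma chain_index_iff: "(\<sigma>, \<phi>) \<in> chain_index p d \<longleftrightarrow>
    \<sigma> \<in> nerve C p \<and> \<phi> \<in> Arr D \<and> Dom D \<phi> = FObj S (nerve_vertex C \<sigma> p) \<and> Cod D \<phi> = d"
  by (simp add: chain_index_def)

lemma chain_grp_group: "i \<in> chain_index p d \<Longrightarrow> group (chain_grp i)"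
  by (cases i) (auto simp: chain_index_iff F.Grp_group nerve_def)

lemma chain_letterE:
  assumes "a \<in> letters (chain_index p d) chain_grp"
  obtains c as \<phi> x where "a = (((c, as), \<phi>), x)" "(c, as) \<in> nerve C p" "\<phi> \<in> Arr D"
    "Dom D \<phi> = FObj S (nerve_vertex C (c, as) p)" "Cod D \<phi> = d" "x \<in> carrier (Grp F c)"
proof -
  obtain c as \<phi> x where a: "a = (((c, as), \<phi>), x)" by (metis prod.exhaust)
  show thesis by (rule that[OF a]) (use assms in \<open>auto simp: a letters_def chain_index_iff\<close>)
qed

lemma chain_letterI:
  "\<lbrakk>(c, as) \<in> nerve C p; \<phi> \<in> Arr D; Dom D \<phi> = FObj S (nerve_vertex C (c, as) p); Cod D \<phi> = d; x \<in> carrier (Grp F c)\<rbrakk>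
    \<Longrightarrow> (((c, as), \<phi>), x) \<in> letters (chain_index p d) chain_grp"
  by (simp add: letters_def chain_index_iff)

lemma last_arrow:
  assumes "(c, as) \<in> nerve C (Suc p)"
  shows "last as = as ! p" "last as \<in> Arr C" "Dom C (last as) = nerve_vertex C (c, as) p"
    "Cod C (last as) = nerve_vertex C (c, as) (Suc p)"
proof -
  note D = C.nerveD[OF assms]
  show l: "last as = as ! p" using D(2) by (subst last_conv_nth) auto
  show "last as \<in> Arr C" "Cod C (last as) = nerve_vertex C (c, as) (Suc p)"
    unfolding l using D(3)[of p] by (auto simp: nerve_vertex_def)
  show "Dom C (last as) = nerve_vertex C (c, as) p"
    unfolding l using assms by (simp add: nerve_def)
qed

lemma chain_face_hom:
  assumes "i \<le> Suc p"
  shows "letter_hom (chain_index (Suc p) d) chain_grp (chain_index p d) chain_grp (chain_face i)"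
proof (rule letter_homI[where p = "\<lambda>(\<sigma>, \<phi>). (nerve_face C i \<sigma>,
      if i = length (snd \<sigma>) then Comp D \<phi> (FArr S (last (snd \<sigma>))) else \<phi>)"
      and q = "\<lambda>(\<sigma>, \<phi>). if i = 0 then Act F (hd (snd \<sigma>)) else (\<lambda>x. x)"])
  fix j assume "j \<in> chain_index (Suc p) d"
  moreover obtain c as \<phi> where j: "j = ((c, as), \<phi>)" by (metis prod.exhaust)
  ultimately have b: "(c, as) \<in> nerve C (Suc p)" "\<phi> \<in> Arr D" "Dom D \<phi> = FObj S (nerve_vertex C (c, as) (Suc p))" "Cod D \<phi> = d"
    by (auto simp: chain_index_iff)
  note N = C.nerveD[OF b(1)] and l = last_arrow[OF b(1)]
  show "(case j of (\<sigma>, \<phi>) \<Rightarrow> (nerve_face C i \<sigma>,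
      if i = length (snd \<sigma>) then Comp D \<phi> (FArr S (last (snd \<sigma>))) else \<phi>)) \<in> chain_index p d"
    unfolding j using C.nerve_face_in[OF b(1) assms] C.nerve_vertex_face[OF b(1) assms] b l N(2)
    by (auto simp: chain_index_iff D.Comp_Arr D.Dom_Comp D.Cod_Comp S.FArr_Arr S.Dom_FArr S.Cod_FArr)
  have "hd as = as ! 0" using N(2) by (intro hd_conv_nth) auto
  then show "(case j of (\<sigma>, \<phi>) \<Rightarrow> if i = 0 then Act F (hd (snd \<sigma>)) else (\<lambda>x. x)) \<in> hom (chain_grp j) (chain_grp (case j of (\<sigma>, \<phi>) \<Rightarrow> (nerve_face C i \<sigma>,
      if i = length (snd \<sigma>) then Comp D \<phi> (FArr S (last (snd \<sigma>))) else \<phi>)))"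
    unfolding j using C.fst_nerve_face[OF N(2), of i c] F.Act_hom[of "as ! 0"] N(3)[of 0] N(4)
    by (auto simp: hom_def)
qed (erule chain_grp_group | simp add: chain_face_def split: prod.split)+

lemma chain_degen_hom:
  assumes "i \<le> p"
  shows "letter_hom (chain_index p d) chain_grp (chain_index (Suc p) d) chain_grp (chain_degen i)"
proof (rule letter_homI[where p = "\<lambda>(\<sigma>, \<phi>). (nerve_degen C i \<sigma>, \<phi>)" and q = "\<lambda>_ x. x"])
  fix j assume "j \<in> chain_index p d"
  moreover obtain c as \<phi> where j: "j = ((c, as), \<phi>)" by (metis prod.exhaust)
  ultimately have b: "(c, as) \<in> nerve C p" "\<phi> \<in> Arr D" "Dom D \<phi> = FObj S (nerve_vertex C (c, as) p)" "Cod D \<phi> = d"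
    by (auto simp: chain_index_iff)
  show "(case j of (\<sigma>, \<phi>) \<Rightarrow> (nerve_degen C i \<sigma>, \<phi>)) \<in> chain_index (Suc p) d"
    unfolding j using C.nerve_degen_in[OF b(1) assms] C.nerve_vertex_degen[OF b(1) assms] b
    by (simp add: chain_index_iff)
  show "(\<lambda>x. x) \<in> hom (chain_grp j) (chain_grp (case j of (\<sigma>, \<phi>) \<Rightarrow> (nerve_degen C i \<sigma>, \<phi>)))"
    by (simp add: j C.fst_nerve_degen hom_def)
qed (erule chain_grp_group | simp add: chain_degen_def split: prod.split)+

lemma chain_push_hom:
  assumes "\<beta> \<in> Arr D"
  shows "letter_hom (chain_index p (Dom D \<beta>)) chain_grp (chain_index p (Cod D \<beta>)) chain_grp (chain_push \<beta>)"
proof (rule letter_homI[where p = "\<lambda>(\<sigma>, \<phi>). (\<sigma>, Comp D \<beta> \<phi>)" and q = "\<lambda>_ x. x"])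
  fix j assume "j \<in> chain_index p (Dom D \<beta>)"
  then show "(case j of (\<sigma>, \<phi>) \<Rightarrow> (\<sigma>, Comp D \<beta> \<phi>)) \<in> chain_index p (Cod D \<beta>)"
    using assms by (cases j) (auto simp: chain_index_iff D.Comp_Arr D.Dom_Comp D.Cod_Comp)
  show "(\<lambda>x. x) \<in> hom (chain_grp j) (chain_grp (case j of (\<sigma>, \<phi>) \<Rightarrow> (\<sigma>, Comp D \<beta> \<phi>)))"
    by (cases j) (simp add: hom_def)
qed (erule chain_grp_group | simp add: chain_push_def split: prod.split)+

lemma simplicial_group_rep_col: "simplicial_group (rep_col d)"
proof (intro simplicial_group.intro, unfold rep_col_simps, goal_cases)
  case (1 n)
  show ?case by (rule group_free_prod) (rule chain_grp_group)
next
  case (2 i n)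
  show ?case by (rule free_prod_map_hom[OF chain_face_hom[OF 2]])
next
  case (3 i n)
  show ?case by (rule free_prod_map_hom[OF chain_degen_hom[OF 3]])
next
  case (4 i j n K)
  show ?case
  proof (rule free_prod_map_comp_eq[OF chain_face_hom chain_face_hom chain_face_hom chain_face_hom _ 4(3)])
    fix a assume "a \<in> letters (chain_index (Suc (Suc n)) d) chain_grp"
    then obtain c as \<phi> x where a: "a = (((c, as), \<phi>), x)" "(c, as) \<in> nerve C (Suc (Suc n))" "\<phi> \<in> Arr D"
      "Dom D \<phi> = FObj S (nerve_vertex C (c, as) (Suc (Suc n)))" "x \<in> carrier (Grp F c)"
      by (rule chain_letterE)
    note N = C.nerveD[OF a(2)]
    have hd: "hd as = as ! 0" using N(2) by (intro hd_conv_nth) auto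
    have la: "last as = as ! Suc n" using N(2) by (subst last_conv_nth) auto
    have x: "Act F (Comp C (as ! 1) (as ! 0)) x = Act F (as ! 1) (Act F (as ! 0) x)"
      using N(3)[of 0] N(3)[of 1] N(4) N(5)[of 0] a(5) by (intro F.Act_Comp) auto
    have p: "Comp D (Comp D \<phi> (FArr S (as ! Suc n))) (FArr S (as ! n)) = Comp D \<phi> (FArr S (Comp C (as ! Suc n) (as ! n)))"
      using N(3)[of n] N(3)[of "Suc n"] N(5)[of n] a(3,4)
      by (simp add: S.FArr_Comp D.Comp_assoc S.FArr_Arr S.Dom_FArr S.Cod_FArr nerve_vertex_def)
    have len: "length (snd (nerve_face C k (c, as))) = Suc n" if "k \<le> Suc (Suc n)" for k
      using C.length_nerve_face[OF N(2) that] .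
    have lf: "last (snd (nerve_face C k (c, as))) = (if k = Suc n then Comp C (as ! Suc n) (as ! n) else as ! Suc n)"
      if "k \<le> Suc n" for k using C.last_nerve_face[OF N(2) that] .
    have ll: "last (snd (nerve_face C (Suc (Suc n)) (c, as))) = as ! n"
      using len[of "Suc (Suc n)"] C.nth_nerve_face[OF N(2), of "Suc (Suc n)" n c] by (subst last_conv_nth) auto
    show "chain_face i (chain_face j a) = chain_face (j - 1) (chain_face i a)"
      unfolding a(1) chain_face_def prod.case C.nerve_face_face[OF a(2) 4(1,2)]
      using R.hd_face[OF N(2), of j c] 4(1,2) hd la x p len[of i] len[of j] lf[of i] ll N(2)
      by auto
  qed (use 4 in auto)
next
  case (5 i j n K)
  show ?case
  proof (rule free_prod_map_comp_eq[OF chain_degen_hom chain_face_hom chain_face_hom chain_degen_hom _ 5(3)])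
    fix a assume "a \<in> letters (chain_index (Suc n) d) chain_grp"
    then obtain c as \<phi> x where a: "a = (((c, as), \<phi>), x)" "(c, as) \<in> nerve C (Suc n)" "x \<in> carrier (Grp F c)"
      by (rule chain_letterE)
    note N = C.nerveD[OF a(2)]
    have hd: "hd as = as ! 0" using N(2) by (intro hd_conv_nth) auto
    have le: "i \<le> Suc (Suc n)" using 5 by auto
    show "chain_face i (chain_degen j a) = chain_degen (j - 1) (chain_face i a)"
      unfolding a(1) chain_face_def chain_degen_def prod.case C.nerve_face_degen[OF a(2) 5(2) le]
      using R.hd_degen[OF N(2) 5(2), of c] C.length_nerve_degen[OF N(2) 5(2), of c] 5(1,2) hd N(2) by auto
  qed (use 5 in auto)
next
  case (6 i j n K)
  show ?case
  proof (rule free_prod_map_inverse[OF chain_degen_hom chain_face_hom _ 6(3)])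
    fix a assume "a \<in> letters (chain_index n d) chain_grp"
    then obtain c as \<phi> x where a: "a = (((c, as), \<phi>), x)" "(c, as) \<in> nerve C n" "\<phi> \<in> Arr D"
      "Dom D \<phi> = FObj S (nerve_vertex C (c, as) n)" "x \<in> carrier (Grp F c)"
      by (rule chain_letterE)
    note N = C.nerveD[OF a(2)]
    have le: "i \<le> Suc n" using 6 by auto
    have "Comp D \<phi> (FArr S (Ide C (nerve_vertex C (c, as) n))) = \<phi>"
      using D.Comp_Ide[OF a(3)] C.nerve_vertex_Obj[OF a(2), of n] by (simp add: S.FArr_Ide a(4))
    then show "chain_face i (chain_degen j a) = a"
      unfolding a(1) chain_face_def chain_degen_def prod.case C.nerve_face_degen[OF a(2) 6(2) le]
      using R.hd_degen[OF N(2) 6(2), of c] C.length_nerve_degen[OF N(2) 6(2), of c]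
        C.last_nerve_degen[OF N(2) 6(2), of c] 6(1,2) N(2) F.Act_Ide[OF N(1) a(5)] by auto
  qed (use 6 in auto)
next
  case (7 j i n K)
  have le: "j \<le> Suc n" using 7 by auto
  show ?case
  proof (rule free_prod_map_comp_eq[OF chain_degen_hom chain_face_hom chain_face_hom chain_degen_hom _ 7(3)])
    fix a assume "a \<in> letters (chain_index (Suc n) d) chain_grp"
    then obtain c as \<phi> x where a: "a = (((c, as), \<phi>), x)" "(c, as) \<in> nerve C (Suc n)" "x \<in> carrier (Grp F c)"
      by (rule chain_letterE)
    note N = C.nerveD[OF a(2)]
    have la: "last as = as ! n" using N(2) by (subst last_conv_nth) auto
    show "chain_face i (chain_degen j a) = chain_degen j (chain_face (i - 1) a)"
      unfolding a(1) chain_face_def chain_degen_def prod.case C.nerve_face_degen[OF a(2) le 7(2)]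
      using C.length_nerve_degen[OF N(2) le, of c] C.last_nerve_degen[OF N(2) le, of c] 7(1,2) la N(2) by auto
  qed (use 7 in auto)
next
  case (8 i j n K)
  show ?case
  proof (rule free_prod_map_comp_eq[OF chain_degen_hom chain_degen_hom chain_degen_hom chain_degen_hom _ 8(3)])
    fix a assume "a \<in> letters (chain_index n d) chain_grp"
    then obtain c as \<phi> x where a: "a = (((c, as), \<phi>), x)" "(c, as) \<in> nerve C n"
      by (rule chain_letterE)
    show "chain_degen i (chain_degen j a) = chain_degen (Suc j) (chain_degen i a)"
      unfolding a(1) chain_degen_def prod.case C.nerve_degen_degen[OF a(2) 8(1,2)] ..
  qed (use 8 in auto)
qed

lemma group_diagram_rep_row: "group_diagram D (rep_row p)"
proof (intro group_diagram.intro, unfold rep_row_simps, goal_cases)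
  case (1 d)
  show ?case by (rule group_free_prod) (rule chain_grp_group)
next
  case (2 \<beta>)
  show ?case by (rule free_prod_map_hom[OF chain_push_hom[OF 2]])
next
  case (3 d K)
  note ide = D.Ide_Arr[OF 3(1)] D.Dom_Ide[OF 3(1)] D.Cod_Ide[OF 3(1)]
  have "letter_hom (chain_index p d) chain_grp (chain_index p d) chain_grp (chain_push (Ide D d))"
    using chain_push_hom[OF ide(1)] by (simp only: ide)
  then show ?case unfolding ide
  proof (rule free_prod_map_id[OF _ _ 3(2)])
    fix a assume "a \<in> letters (chain_index p d) chain_grp"
    then show "chain_push (Ide D d) a = a"
      by (rule chain_letterE) (auto simp: chain_push_def D.Ide_Comp)
  qed
next
  case (4 f g K)
  have gf: "letter_hom (chain_index p (Dom D f)) chain_grp (chain_index p (Cod D g)) chain_grp (chain_push (Comp D g f))"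
    using chain_push_hom[OF D.Comp_Arr[OF 4(1-3)]] by (simp only: D.Dom_Comp[OF 4(1-3)] D.Cod_Comp[OF 4(1-3)])
  have g: "letter_hom (chain_index p (Cod D f)) chain_grp (chain_index p (Cod D g)) chain_grp (chain_push g)"
    using chain_push_hom[OF 4(2)] by (simp only: 4(3))
  show ?case unfolding D.Cod_Comp[OF 4(1-3)]
  proof (rule free_prod_map_comp[OF chain_push_hom[OF 4(1)] g gf _ 4(4), symmetric])
    fix a assume "a \<in> letters (chain_index p (Dom D f)) chain_grp"
    then show "chain_push g (chain_push f a) = chain_push (Comp D g f) a"
      using 4(1-3) by (elim chain_letterE) (simp add: chain_push_def D.Comp_assoc)
  qed
qed

lemma chain_push_face:
  assumes \<beta>: "\<beta> \<in> Arr D" and i: "i \<le> Suc p" and K: "K \<in> carrier (Grp (rep_row (Suc p)) (Dom D \<beta>))"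
  shows "Face (rep_col (Cod D \<beta>)) (Suc p) i (Act (rep_row (Suc p)) \<beta> K) = Act (rep_row p) \<beta> (Face (rep_col (Dom D \<beta>)) (Suc p) i K)"
  unfolding rep_col_simps rep_row_simps
proof (rule free_prod_map_comp_eq[OF chain_push_hom[OF \<beta>] chain_face_hom[OF i] chain_face_hom[OF i] chain_push_hom[OF \<beta>]])
  show "K \<in> carrier (free_prod (chain_index (Suc p) (Dom D \<beta>)) chain_grp)" using K by (simp only: rep_row_simps)
  fix a assume "a \<in> letters (chain_index (Suc p) (Dom D \<beta>)) chain_grp"
  then obtain c as \<phi> x where a: "a = (((c, as), \<phi>), x)" "(c, as) \<in> nerve C (Suc p)" "\<phi> \<in> Arr D"
    "Dom D \<phi> = FObj S (nerve_vertex C (c, as) (Suc p))" "Cod D \<phi> = Dom D \<beta>"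
    by (rule chain_letterE)
  then show "chain_face i (chain_push \<beta> a) = chain_push \<beta> (chain_face i a)"
    using \<beta> last_arrow[OF a(2)] by (auto simp: chain_face_def chain_push_def D.Comp_assoc S.FArr_Arr S.Cod_FArr)
qed

lemma chain_push_degen:
  assumes \<beta>: "\<beta> \<in> Arr D" and i: "i \<le> p" and K: "K \<in> carrier (Grp (rep_row p) (Dom D \<beta>))"
  shows "Degen (rep_col (Cod D \<beta>)) p i (Act (rep_row p) \<beta> K) = Act (rep_row (Suc p)) \<beta> (Degen (rep_col (Dom D \<beta>)) p i K)"
  unfolding rep_col_simps rep_row_simps
proof (rule free_prod_map_comp_eq[OF chain_push_hom[OF \<beta>] chain_degen_hom[OF i] chain_degen_hom[OF i] chain_push_hom[OF \<beta>]])
  show "K \<in> carrier (free_prod (chain_index p (Dom D \<beta>)) chain_grp)" using K by (simp only: rep_row_simps)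
  fix a show "chain_degen i (chain_push \<beta> a) = chain_push \<beta> (chain_degen i a)"
    by (simp add: chain_degen_def chain_push_def split: prod.split)
qed

end

section \<open>The extra degeneracy of the standard simplices\<close>

lemma op_delta_simps [simp]:
  "Obj (op_cat delta) = UNIV" "Arr (op_cat delta) = Arr delta" "Dom (op_cat delta) = Cod delta"
  "Cod (op_cat delta) = Dom delta" "Ide (op_cat delta) = Ide delta"
  "Comp (op_cat delta) g f = Comp delta f g"
  by (simp_all add: op_cat_def delta_def)

text \<open>An \<open>m\<close>-simplex \<open>\<beta> : [m] \<rightarrow> [n]\<close> of the standard simplex is extended to \<open>[m+1]\<close> by sending the new last
  element to the top vertex \<open>n\<close>: the contraction of the standard simplex to that vertex.\<close>

definition repeat_top :: "delta_arr \<Rightarrow> delta_arr" where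
  "repeat_top = (\<lambda>(m, f, n). (Suc m, (\<lambda>k\<in>{..Suc m}. if k \<le> m then f k else n), n))"

definition top_vertex :: "nat \<Rightarrow> delta_arr" where
  "top_vertex n = (0, (\<lambda>k\<in>{..0}. n), n)"

lemma delta_ArrE:
  assumes "\<beta> \<in> Arr delta"
  obtains m f n where "\<beta> = (m, f, n)" "f \<in> {..m} \<rightarrow>\<^sub>E {..n}" "mono_on {..m} f"
  using assms by (auto simp: delta_def)

lemma repeat_top_Arr:
  assumes "\<beta> \<in> Arr delta"
  shows "repeat_top \<beta> \<in> Arr delta" "Dom delta (repeat_top \<beta>) = Suc (Dom delta \<beta>)"
    "Cod delta (repeat_top \<beta>) = Cod delta \<beta>"
proof -
  obtain m f n where b: "\<beta> = (m, f, n)" "f \<in> {..m} \<rightarrow>\<^sub>E {..n}" "mono_on {..m} f"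
    using assms by (rule delta_ArrE)
  have f: "f k \<le> n" if "k \<le> m" for k using b(2) that by auto
  have "f i \<le> f j" if "i \<le> j" "j \<le> m" for i j using mono_onD[OF b(3), of i j] that by simp
  then show "repeat_top \<beta> \<in> Arr delta" "Dom delta (repeat_top \<beta>) = Suc (Dom delta \<beta>)"
    "Cod delta (repeat_top \<beta>) = Cod delta \<beta>"
    using f by (auto simp: b(1) repeat_top_def delta_def mono_on_def)
qed

lemma top_vertex_Arr: "top_vertex n \<in> Arr delta" "Dom delta (top_vertex n) = 0" "Cod delta (top_vertex n) = n"
  by (auto simp: top_vertex_def delta_def mono_on_def)

lemma repeat_top_coface_top:
  assumes "\<beta> \<in> Arr delta" "Dom delta \<beta> = m"
  shows "Comp delta (repeat_top \<beta>) (coface (Suc m) (Suc m)) = \<beta>"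
proof -
  obtain m' f n where b: "\<beta> = (m', f, n)" "f \<in> {..m'} \<rightarrow>\<^sub>E {..n}" using assms(1) by (rule delta_ArrE)
  have "m' = m" using assms(2) by (simp add: b(1) delta_def)
  then show ?thesis using b(2)
    by (auto simp: b(1) delta_def repeat_top_def coface_def compose_def PiE_def extensional_def fun_eq_iff)
qed

lemma repeat_top_coface:
  assumes "\<beta> \<in> Arr delta" "Dom delta \<beta> = Suc m" "i \<le> Suc m"
  shows "Comp delta (repeat_top \<beta>) (coface (Suc (Suc m)) i) = repeat_top (Comp delta \<beta> (coface (Suc m) i))"
proof -
  obtain m' f n where b: "\<beta> = (m', f, n)" using assms(1) by (rule delta_ArrE)
  have "m' = Suc m" using assms(2) by (simp add: b delta_def)
  then show ?thesis using assms(3)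
    by (auto simp: b delta_def repeat_top_def coface_def compose_def fun_eq_iff)
qed

lemma repeat_top_coface_0:
  assumes "\<beta> \<in> Arr delta" "Dom delta \<beta> = 0"
  shows "Comp delta (repeat_top \<beta>) (coface (Suc 0) 0) = top_vertex (Cod delta \<beta>)"
proof -
  obtain m' f n where b: "\<beta> = (m', f, n)" using assms(1) by (rule delta_ArrE)
  have "m' = 0" using assms(2) by (simp add: b delta_def)
  then show ?thesis
    by (auto simp: b delta_def repeat_top_def coface_def compose_def top_vertex_def fun_eq_iff)
qed

section \<open>Both augmentations of the bisimplicial replacement\<close>

locale simplicial_kan_data = kan_data C "op_cat delta" S F
  for C :: "('o, 'm) cat" and S and F :: "('o, 'm, 'g) grp_diagram"
begin

interpretation R: replacement_data C F ..

abbreviation "rep_srow p \<equiv> sgroup_of (rep_row p)"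

lemma rep_srow_simps:
  "Level (rep_srow p) q = free_prod (chain_index p q) chain_grp"
  "Face (rep_srow p) (Suc q) i = Act (rep_row p) (coface (Suc q) i)"
  "Degen (rep_srow p) q i = Act (rep_row p) (codegen q i)"
  by (simp_all add: sgroup_of_def rep_row_simps)

lemma bisimplicial_replacement: "bisimplicial_group rep_col rep_srow"
proof (intro bisimplicial_group.intro simplicial_group_rep_col simplicial_group_sgroup_of group_diagram_rep_row, goal_cases)
  case (1 p q)
  show ?case by (simp only: rep_srow_simps rep_col_simps)
next
  case (2 i p j q x)
  then show ?case using chain_push_face[of "coface (Suc q) j" i p x]
    by (simp add: rep_srow_simps coface_Arr Dom_Cod_coface rep_row_simps rep_col_simps(1))
next
  case (3 i p j q x)
  then show ?case using chain_push_face[of "codegen q j" i p x]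
    by (simp add: rep_srow_simps codegen_Arr Dom_Cod_codegen rep_row_simps rep_col_simps(1))
next
  case (4 i p j q x)
  then show ?case using chain_push_degen[of "coface (Suc q) j" i p x]
    by (simp add: rep_srow_simps coface_Arr Dom_Cod_coface rep_row_simps rep_col_simps(1))
next
  case (5 i p j q x)
  then show ?case using chain_push_degen[of "codegen q j" i p x]
    by (simp add: rep_srow_simps codegen_Arr Dom_Cod_codegen rep_row_simps rep_col_simps(1))
qed

lemma rep_srow_Face: "Face (rep_srow p) (Suc q) i = free_prod_map (chain_index p q) chain_grp (chain_push (coface (Suc q) i))"
  by (simp add: rep_srow_simps rep_row_simps Dom_Cod_coface)

lemma rep_srow_Degen: "Degen (rep_srow p) q i = free_prod_map (chain_index p (Suc q)) chain_grp (chain_push (codegen q i))"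
  by (simp add: rep_srow_simps rep_row_simps Dom_Cod_codegen)

lemma coface_push: "i \<le> Suc q \<Longrightarrow> letter_hom (chain_index p (Suc q)) chain_grp (chain_index p q) chain_grp (chain_push (coface (Suc q) i))"
  using chain_push_hom[of "coface (Suc q) i" p] by (simp add: coface_Arr Dom_Cod_coface)

section \<open>Forgetting the map to the simplex\<close>

abbreviation "nGrp \<equiv> (\<lambda>(c, as :: 'm list). Grp F c)"

definition forget :: "(('o \<times> 'm list) \<times> delta_arr) \<times> 'g \<Rightarrow> ('o \<times> 'm list) \<times> 'g" where
  "forget = (\<lambda>((\<sigma>, \<beta>), x). (\<sigma>, x))"

definition at_top :: "nat \<Rightarrow> ('o \<times> 'm list) \<times> 'g \<Rightarrow> (('o \<times> 'm list) \<times> delta_arr) \<times> 'g" where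
  "at_top p = (\<lambda>(\<sigma>, x). ((\<sigma>, top_vertex (FObj S (nerve_vertex C \<sigma> p))), x))"

definition to_top :: "(('o \<times> 'm list) \<times> delta_arr) \<times> 'g \<Rightarrow> (('o \<times> 'm list) \<times> delta_arr) \<times> 'g" where
  "to_top = (\<lambda>((\<sigma>, \<beta>), x). ((\<sigma>, repeat_top \<beta>), x))"

lemma forget_hom: "letter_hom (chain_index p q) chain_grp (nerve C p) nGrp forget"
  by (rule letter_homI[where p = fst and q = "\<lambda>_ x. x"];
      (erule chain_grp_group R.nGrp_group)?; auto simp: forget_def chain_index_iff hom_def)

lemma at_top_hom: "letter_hom (nerve C p) nGrp (chain_index p 0) chain_grp (at_top p)"
  by (rule letter_homI[where p = "\<lambda>\<sigma>. (\<sigma>, top_vertex (FObj S (nerve_vertex C \<sigma> p)))" and q = "\<lambda>_ x. x"];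
      (erule chain_grp_group R.nGrp_group)?; auto simp: at_top_def chain_index_iff hom_def top_vertex_Arr)

lemma to_top_hom: "letter_hom (chain_index p q) chain_grp (chain_index p (Suc q)) chain_grp to_top"
  by (rule letter_homI[where p = "\<lambda>(\<sigma>, \<beta>). (\<sigma>, repeat_top \<beta>)" and q = "\<lambda>_ x. x"];
      (erule chain_grp_group)?; auto simp: to_top_def chain_index_iff hom_def repeat_top_Arr)

lemma Level_R: "Level (simplicial_replacement C F) p = free_prod (nerve C p) nGrp"
  by (simp add: simplicial_replacement_def)

lemma Face_R: "Face (simplicial_replacement C F) (Suc p) i = free_prod_map (nerve C p) nGrp (R.face_letter i)"
  by (simp add: simplicial_replacement_def)

lemma Degen_R: "Degen (simplicial_replacement C F) p i = free_prod_map (nerve C (Suc p)) nGrp (R.degen_letter i)"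
  by (simp add: simplicial_replacement_def)

lemma face_letter_hom: "i \<le> Suc p \<Longrightarrow> letter_hom (nerve C (Suc p)) nGrp (nerve C p) nGrp (R.face_letter i)"
  unfolding letter_hom_def using R.face_letter_map by blast

lemma degen_letter_hom: "i \<le> p \<Longrightarrow> letter_hom (nerve C p) nGrp (nerve C (Suc p)) nGrp (R.degen_letter i)"
  unfolding letter_hom_def using R.degen_letter_map by blast

text \<open>Here the chain is fixed and the standard simplex attached to its last vertex is contracted.\<close>

theorem contracted_to_replacement:
  "contracted_bisimplicial rep_srow rep_col (simplicial_replacement C F)
     (\<lambda>p. free_prod_map (nerve C p) nGrp forget)
     (\<lambda>p. free_prod_map (chain_index p 0) chain_grp (at_top p))
     (\<lambda>p q. free_prod_map (chain_index p (Suc q)) chain_grp to_top)"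
proof (intro contracted_bisimplicial.intro contracted_bisimplicial_axioms.intro
    bisimplicial_group.swap[OF bisimplicial_replacement] R.simplicial_group_R,
    unfold Level_R rep_srow_simps(1) rep_col_simps rep_srow_Face rep_srow_Degen Face_R Degen_R, goal_cases)
  case (1 p)
  show ?case by (rule free_prod_map_hom[OF forget_hom])
next
  case (2 y p)
  have "free_prod_map (nerve C p) nGrp forget (free_prod_map (chain_index p 0) chain_grp (at_top p) y) = y"
    by (rule free_prod_map_inverse[OF at_top_hom forget_hom _ 2]) (auto simp: forget_def at_top_def)
  moreover have "free_prod_map (chain_index p 0) chain_grp (at_top p) y \<in> carrier (free_prod (chain_index p 0) chain_grp)"
    using free_prod_map_hom[OF at_top_hom] 2 by (auto simp: hom_def)
  ultimately show ?case by blast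
next
  case (3 x p)
  show ?case
    by (rule free_prod_map_comp_eq[OF coface_push forget_hom coface_push forget_hom _ 3])
      (auto simp: forget_def chain_push_def)
next
  case (4 i p x)
  show ?case
  proof (rule free_prod_map_comp_eq[OF chain_face_hom[OF 4(1)] forget_hom forget_hom face_letter_hom[OF 4(1)] _ 4(2)])
    fix a show "forget (chain_face i a) = R.face_letter i (forget a)"
      by (cases a) (auto simp: forget_def chain_face_def split: prod.split)
  qed
next
  case (5 i p x)
  show ?case
  proof (rule free_prod_map_comp_eq[OF chain_degen_hom[OF 5(1)] forget_hom forget_hom degen_letter_hom[OF 5(1)] _ 5(2)])
    fix a show "forget (chain_degen i a) = R.degen_letter i (forget a)"
      by (cases a) (auto simp: forget_def chain_degen_def split: prod.split)
  qed
next
  case (6 p)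
  show ?case
    by (rule hom_one[OF free_prod_map_hom[OF at_top_hom]]; rule group_free_prod; erule chain_grp_group R.nGrp_group)
next
  case (7 x p q)
  then show ?case using free_prod_map_hom[OF to_top_hom] by (auto simp: hom_def)
next
  case (8 p q)
  show ?case
    by (rule hom_one[OF free_prod_map_hom[OF to_top_hom]]; rule group_free_prod; erule chain_grp_group)
next
  case (9 x p q)
  show ?case
    by (rule free_prod_map_inverse[OF to_top_hom coface_push _ 9])
      (auto elim!: chain_letterE simp: to_top_def chain_push_def repeat_top_coface_top)
next
  case (10 i q x p)
  show ?case
    by (rule free_prod_map_comp_eq[OF to_top_hom coface_push coface_push to_top_hom _ 10(2)])
      (use 10(1) in \<open>auto elim!: chain_letterE simp: to_top_def chain_push_def repeat_top_coface\<close>)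
next
  case (11 x p)
  show ?case
    by (rule free_prod_map_comp_eq[OF to_top_hom coface_push forget_hom at_top_hom _ 11])
      (auto elim!: chain_letterE simp: to_top_def chain_push_def repeat_top_coface_0 forget_def at_top_def)
qed

end

section \<open>Discrete opfibrations over the opposite simplex category\<close>

text \<open>Unique lifting of arrows of \<open>\<Delta>\<^sup>o\<^sup>p\<close> that start at \<open>S c\<close>; the two assumptions say that \<open>lift c\<close> is
  inverse to \<open>S\<close> on the arrows starting at \<open>c\<close>.\<close>

locale opfibred_kan_data = simplicial_kan_data C S F
  for C :: "('o, 'm) cat" and S and F :: "('o, 'm, 'g) grp_diagram" +
  fixes lift :: "'o \<Rightarrow> delta_arr \<Rightarrow> 'm"
  assumes lift: "\<lbrakk>c \<in> Obj C; \<phi> \<in> Arr delta; Cod delta \<phi> = FObj S c\<rbrakk> \<Longrightarrow>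
      lift c \<phi> \<in> Arr C \<and> Dom C (lift c \<phi>) = c \<and> FArr S (lift c \<phi>) = \<phi>"
    and lift_unique: "f \<in> Arr C \<Longrightarrow> lift (Dom C f) (FArr S f) = f"
begin

abbreviation "fibre d \<equiv> {c \<in> Obj C. FObj S c = d}"

lemma Ide_delta: "Ide delta d \<in> Arr delta" "Dom delta (Ide delta d) = d" "Cod delta (Ide delta d) = d"
  using D.Ide_Arr[of d] D.Dom_Ide[of d] D.Cod_Ide[of d] by simp_all

lemma lift_Cod:
  assumes "c \<in> Obj C" "\<phi> \<in> Arr delta" "Cod delta \<phi> = FObj S c"
  shows "Cod C (lift c \<phi>) \<in> fibre (Dom delta \<phi>)"
  using lift[OF assms] C.Cod_Obj[of "lift c \<phi>"] S.Cod_FArr[of "lift c \<phi>"] by simp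

end

text \<open>\<open>T d\<close> is the free product of the groups over the fibre of \<open>d\<close>: \<open>decomp d\<close> is a homomorphism to the
  free product which inverts the maps \<open>\<theta> c\<close> on generators.  This form applies both to the Kan
  extension, whose groups are colimits, and to a diagram over \<open>\<Delta>\<^sup>o\<^sup>p\<close> itself.\<close>

locale fibrewise_free_extension = opfibred_kan_data C S F lift + T: group_diagram "op_cat delta" T
  for C :: "('o, 'm) cat" and S and F :: "('o, 'm, 'g) grp_diagram" and lift
    and T :: "(nat, delta_arr, 'h) grp_diagram" +
  fixes \<theta> :: "'o \<Rightarrow> 'g \<Rightarrow> 'h"
    and decomp :: "nat \<Rightarrow> 'h \<Rightarrow> ('o \<times> 'g) list set"
  assumes \<theta>_natural: "grp_natural C F (grp_pullback S T) \<theta>"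
    and T_generated: "carrier (Grp T d) \<subseteq> generate (Grp T d) {\<theta> c x |c x. c \<in> fibre d \<and> x \<in> carrier (Grp F c)}"
    and decomp_hom: "decomp d \<in> hom (Grp T d) (free_prod (fibre d) (Grp F))"
    and decomp_\<theta>: "\<lbrakk>c \<in> fibre d; x \<in> carrier (Grp F c)\<rbrakk> \<Longrightarrow>
      decomp d (\<theta> c x) = word_cong (fibre d) (Grp F) {} `` {[(c, x)]}"
begin

interpretation R: replacement_data C F ..

lemma \<theta>_hom: "c \<in> Obj C \<Longrightarrow> \<theta> c \<in> hom (Grp F c) (Grp T (FObj S c))"
  using \<theta>_natural by (simp add: grp_natural_def grp_pullback_def)

lemma \<theta>_closed: "\<lbrakk>c \<in> Obj C; x \<in> carrier (Grp F c)\<rbrakk> \<Longrightarrow> \<theta> c x \<in> carrier (Grp T (FObj S c))"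
  using \<theta>_hom by (auto simp: hom_def)

lemma \<theta>_Act: "\<lbrakk>f \<in> Arr C; x \<in> carrier (Grp F (Dom C f))\<rbrakk> \<Longrightarrow>
    \<theta> (Cod C f) (Act F f x) = Act T (FArr S f) (\<theta> (Dom C f) x)"
  using \<theta>_natural by (simp add: grp_natural_def grp_pullback_def)

definition eval_letter :: "(('o \<times> 'm list) \<times> delta_arr) \<times> 'g \<Rightarrow> 'h" where
  "eval_letter = (\<lambda>(((c, as), \<phi>), x). Act T \<phi> (\<theta> c x))"

definition eval_to :: "nat \<Rightarrow> ((('o \<times> 'm list) \<times> delta_arr) \<times> 'g) list set \<Rightarrow> 'h" where
  "eval_to d = amalg_target.amalg_lift (Grp T d) eval_letter"

definition at_id :: "nat \<Rightarrow> 'o \<times> 'g \<Rightarrow> (('o \<times> 'm list) \<times> delta_arr) \<times> 'g" where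
  "at_id d = (\<lambda>(c, x). (((c, []), Ide delta d), x))"

text \<open>The chain is prolonged to the endpoint of the lift of \<open>\<phi>\<close>, where the attached arrow becomes an identity.
  That endpoint is a terminal object of its component of \<open>S \<down> d\<close>.\<close>

definition append_lift :: "nat \<Rightarrow> (('o \<times> 'm list) \<times> delta_arr) \<times> 'g \<Rightarrow> (('o \<times> 'm list) \<times> delta_arr) \<times> 'g" where
  "append_lift d = (\<lambda>(((c, as), \<phi>), x).
     (((c, as @ [lift (nerve_vertex C (c, as) (length as)) \<phi>]), Ide delta d), x))"

lemma nerve_0: "(c, as) \<in> nerve C 0 \<longleftrightarrow> c \<in> Obj C \<and> as = []"
  by (auto simp: nerve_def)

lemma eval_target: "amalg_target (Grp T d) (chain_index 0 d) chain_grp {} eval_letter"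
proof (intro amalg_target.intro amalg_target_axioms.intro T.Grp_group, goal_cases)
  case (2 i)
  then obtain c \<phi> where i: "i = ((c, []), \<phi>)" "c \<in> Obj C" "\<phi> \<in> Arr delta" "Cod delta \<phi> = FObj S c" "Dom delta \<phi> = d"
    by (cases i) (auto simp: chain_index_iff nerve_0 nerve_vertex_def)
  have "Act T \<phi> \<circ> \<theta> c \<in> hom (Grp F c) (Grp T d)"
    using hom_compose[OF \<theta>_hom[OF i(2)]] T.Act_hom[of \<phi>] i by auto
  then show ?case by (simp add: eval_letter_def i comp_def)
qed (erule chain_grp_group | simp)+

lemma eval_to_hom: "eval_to d \<in> hom (free_prod (chain_index 0 d) chain_grp) (Grp T d)"
  unfolding eval_to_def free_prod_def by (rule amalg_target.amalg_lift_hom[OF eval_target])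

lemma eval_to_letter:
  "a \<in> letters (chain_index 0 d) chain_grp \<Longrightarrow> eval_to d (word_cong (chain_index 0 d) chain_grp {} `` {[a]}) = eval_letter a"
  unfolding eval_to_def using amalg_target.amalg_lift_class[OF eval_target, of "[a]" d]
    amalg_target.word_eval_singleton[OF eval_target] by simp

lemma vertex_chain: "nerve_vertex C (c, []) 0 = c"
  by (simp add: nerve_vertex_def)

lemma chain_letter0E:
  assumes "a \<in> letters (chain_index 0 d) chain_grp"
  obtains c \<phi> x where "a = (((c, []), \<phi>), x)" "c \<in> Obj C" "\<phi> \<in> Arr delta"
    "Cod delta \<phi> = FObj S c" "Dom delta \<phi> = d" "x \<in> carrier (Grp F c)"
  using assms by (rule chain_letterE) (auto simp: nerve_0 vertex_chain intro: that)

lemma at_id_hom: "letter_hom (fibre d) (Grp F) (chain_index 0 d) chain_grp (at_id d)"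
  by (rule letter_homI[where p = "\<lambda>c. ((c, []), Ide delta d)" and q = "\<lambda>_ x. x"];
      (erule chain_grp_group)?; auto simp: at_id_def chain_index_iff hom_def nerve_0 vertex_chain Ide_delta F.Grp_group)

lemma append_lift_nerve:
  assumes "(c, as) \<in> nerve C p" "\<phi> \<in> Arr delta" "Cod delta \<phi> = FObj S (nerve_vertex C (c, as) p)"
  shows "(c, as @ [lift (nerve_vertex C (c, as) p) \<phi>]) \<in> nerve C (Suc p)"
proof -
  note N = C.nerveD[OF assms(1)]
  note l = lift[OF C.nerve_vertex_Obj[OF assms(1)] assms(2,3)]
  have v: "nerve_vertex C (c, as) p = (if p = 0 then c else Cod C (as ! (p - 1)))"
    by (simp add: nerve_vertex_def)
  show ?thesis
  proof (rule C.nerveI)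
    fix k assume "k < Suc p"
    then show "(as @ [lift (nerve_vertex C (c, as) p) \<phi>]) ! k \<in> Arr C"
      using N l by (auto simp: nth_append)
  next
    show "Dom C ((as @ [lift (nerve_vertex C (c, as) p) \<phi>]) ! 0) = c"
      using N l v by (auto simp: nth_append)
  next
    fix k assume k: "Suc k < Suc p"
    show "Dom C ((as @ [lift (nerve_vertex C (c, as) p) \<phi>]) ! Suc k) = Cod C ((as @ [lift (nerve_vertex C (c, as) p) \<phi>]) ! k)"
    proof (cases "Suc k < p")
      case True
      then show ?thesis using N by (auto simp: nth_append)
    next
      case False
      then have "p = Suc k" using k by simp
      then show ?thesis using N l v by (auto simp: nth_append)
    qed
  qed (use N in auto)
qed

lemma append_lift_hom: "letter_hom (chain_index p d) chain_grp (chain_index (Suc p) d) chain_grp (append_lift d)"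
proof (rule letter_homI[where p = "\<lambda>((c, as), \<phi>). ((c, as @ [lift (nerve_vertex C (c, as) (length as)) \<phi>]), Ide delta d)"
      and q = "\<lambda>_ x. x"])
  fix j assume "j \<in> chain_index p d"
  moreover obtain c as \<phi> where j: "j = ((c, as), \<phi>)" by (metis prod.exhaust)
  ultimately have b: "(c, as) \<in> nerve C p" "\<phi> \<in> Arr delta" "Cod delta \<phi> = FObj S (nerve_vertex C (c, as) p)" "Dom delta \<phi> = d"
    by (auto simp: chain_index_iff)
  note N = C.nerveD[OF b(1)]
  note l = lift[OF C.nerve_vertex_Obj[OF b(1) order_refl] b(2,3)]
  have "FObj S (Cod C (lift (nerve_vertex C (c, as) p) \<phi>)) = d"
    using S.Cod_FArr[of "lift (nerve_vertex C (c, as) p) \<phi>"] l b(4) by simp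
  moreover have "nerve_vertex C (c, as @ [f]) (Suc p) = Cod C f" for f
    using N(2) by (simp add: nerve_vertex_def nth_append)
  ultimately show "((\<lambda>((c, as), \<phi>). ((c, as @ [lift (nerve_vertex C (c, as) (length as)) \<phi>]), Ide delta d)) j) \<in> chain_index (Suc p) d"
    using append_lift_nerve[OF b(1-3)] N(2) by (simp add: j chain_index_iff Ide_delta)
  show "(\<lambda>x. x) \<in> hom (chain_grp j) (chain_grp ((\<lambda>((c, as), \<phi>). ((c, as @ [lift (nerve_vertex C (c, as) (length as)) \<phi>]), Ide delta d)) j))"
    by (simp add: j hom_def)
qed (erule chain_grp_group | simp add: append_lift_def split: prod.split)+

lemma chain_face_append_lift_top:
  assumes "a \<in> letters (chain_index p d) chain_grp"
  shows "chain_face (Suc p) (append_lift d a) = a"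
  using assms
proof (rule chain_letterE, goal_cases)
  case (1 c as \<phi> x)
  note N = C.nerveD[OF 1(2)]
  have l: "FArr S (lift (nerve_vertex C (c, as) p) \<phi>) = \<phi>"
    using lift[OF C.nerve_vertex_Obj[OF 1(2) order_refl]] 1 by simp
  have "Comp delta \<phi> (Ide delta d) = \<phi>" using D.Ide_Comp[of \<phi>] 1 by simp
  then show ?case using N(2) l by (simp add: 1(1) chain_face_def append_lift_def nerve_face_def)
qed

text \<open>The case \<open>i = p + 1\<close> is where unique lifting enters: the lift of \<open>\<phi>\<close> composed with the last arrow \<open>f\<close>
  of the chain is the lift of the composite of \<open>\<phi>\<close> and \<open>S f\<close>.\<close>

lemma chain_face_append_lift:
  assumes "a \<in> letters (chain_index (Suc p) d) chain_grp" "i \<le> Suc p"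
  shows "chain_face i (append_lift d a) = append_lift d (chain_face i a)"
  using assms(1)
proof (rule chain_letterE, goal_cases)
  case (1 c as \<phi> x)
  note L = 1
  note N = C.nerveD[OF L(2)] and la = last_arrow[OF L(2)]
  let ?l = "lift (nerve_vertex C (c, as) (Suc p)) \<phi>"
  have l: "?l \<in> Arr C" "Dom C ?l = nerve_vertex C (c, as) (Suc p)" "FArr S ?l = \<phi>"
    using lift[OF C.nerve_vertex_Obj[OF L(2) order_refl]] L by simp_all
  have ne: "as \<noteq> []" using N(2) by auto
  consider "i = 0" | "0 < i" "i \<le> p" | "i = Suc p" using assms(2) by linarith
  then show ?case
  proof cases
    case 3
    have "lift (nerve_vertex C (c, as) p) (Comp delta (FArr S (last as)) \<phi>) = Comp C ?l (last as)"
      using lift_unique[of "Comp C ?l (last as)"] la l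
      by (simp add: C.Comp_Arr C.Dom_Comp S.FArr_Comp)
    moreover have "nerve_vertex C (c, butlast as) p = nerve_vertex C (c, as) p"
      using N(2) by (auto simp: nerve_vertex_def nth_butlast)
    moreover have "take p as = butlast as" using N(2) by (simp add: butlast_conv_take)
    ultimately show ?thesis using N(2) la(1) 3
      by (simp add: L(1) chain_face_def append_lift_def nerve_face_def nth_append)
  next
    case 2
    have "nerve_vertex C (nerve_face C i (c, as)) p = nerve_vertex C (c, as) (Suc p)"
      using C.nerve_vertex_face[OF L(2), of i] 2 by simp
    moreover have "i - 1 < Suc p" using 2 by simp
    ultimately show ?thesis using N(2) 2
      by (simp add: L(1) chain_face_def append_lift_def nerve_face_def nth_append)
  next
    case 1
    have "nerve_vertex C (nerve_face C 0 (c, as)) p = nerve_vertex C (c, as) (Suc p)"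
      using C.nerve_vertex_face[OF L(2), of 0] by simp
    then show ?thesis using N(2) ne 1
      by (simp add: L(1) chain_face_def append_lift_def nerve_face_def)
  qed
qed

lemma T_group: "group (Grp T d)"
  using T.Grp_group[of d] by simp

lemma eval_to_surj:
  assumes "y \<in> carrier (Grp T d)"
  shows "\<exists>x\<in>carrier (free_prod (chain_index 0 d) chain_grp). eval_to d x = y"
proof -
  let ?B = "free_prod (chain_index 0 d) chain_grp"
  interpret T: group "Grp T d" by (rule T_group)
  interpret e: group_hom ?B "Grp T d" "eval_to d"
    by (intro group_hom.intro group_hom_axioms.intro eval_to_hom T_group group_free_prod) (erule chain_grp_group)
  have "\<theta> c x \<in> eval_to d ` carrier ?B" if c: "c \<in> Obj C" "FObj S c = d" "x \<in> carrier (Grp F c)" for c x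
  proof -
    have a: "(((c, []), Ide delta d), x) \<in> letters (chain_index 0 d) chain_grp"
      using c by (intro chain_letterI) (simp_all add: nerve_0 Ide_delta vertex_chain)
    moreover have "eval_letter (((c, []), Ide delta d), x) = \<theta> c x"
      using T.Act_Ide[of d "\<theta> c x"] \<theta>_closed[of c x] c by (simp add: eval_letter_def)
    ultimately have "\<theta> c x = eval_to d (word_cong (chain_index 0 d) chain_grp {} `` {[(((c, []), Ide delta d), x)]})"
      using eval_to_letter by simp
    then show ?thesis using letter_in_free_prod[OF a] by (rule image_eqI)
  qed
  then have "generate (Grp T d) {\<theta> c x |c x. c \<in> fibre d \<and> x \<in> carrier (Grp F c)} \<subseteq> eval_to d ` carrier ?B"
    by (intro T.generate_subgroup_incl e.img_is_subgroup) auto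
  then show ?thesis using T_generated[of d] assms by blast
qed

lemma eval_to_push:
  assumes \<beta>: "\<beta> \<in> Arr delta" and K: "K \<in> carrier (free_prod (chain_index 0 (Cod delta \<beta>)) chain_grp)"
  shows "eval_to (Dom delta \<beta>) (free_prod_map (chain_index 0 (Dom delta \<beta>)) chain_grp (chain_push \<beta>) K) = Act T \<beta> (eval_to (Cod delta \<beta>) K)"
proof -
  have p: "letter_hom (chain_index 0 (Cod delta \<beta>)) chain_grp (chain_index 0 (Dom delta \<beta>)) chain_grp (chain_push \<beta>)"
    using chain_push_hom[of \<beta> 0] \<beta> by simp
  have "(eval_to (Dom delta \<beta>) \<circ> free_prod_map (chain_index 0 (Dom delta \<beta>)) chain_grp (chain_push \<beta>)) K = (Act T \<beta> \<circ> eval_to (Cod delta \<beta>)) K"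
  proof (rule hom_free_prod_unique[OF T_group chain_grp_group _ _ _ K])
    show "eval_to (Dom delta \<beta>) \<circ> free_prod_map (chain_index 0 (Dom delta \<beta>)) chain_grp (chain_push \<beta>) \<in>
        hom (free_prod (chain_index 0 (Cod delta \<beta>)) chain_grp) (Grp T (Dom delta \<beta>))"
      by (rule hom_compose[OF free_prod_map_hom[OF p] eval_to_hom])
    show "Act T \<beta> \<circ> eval_to (Cod delta \<beta>) \<in> hom (free_prod (chain_index 0 (Cod delta \<beta>)) chain_grp) (Grp T (Dom delta \<beta>))"
      using hom_compose[OF eval_to_hom T.Act_hom[of \<beta>]] \<beta> by simp
    fix a assume a: "a \<in> letters (chain_index 0 (Cod delta \<beta>)) chain_grp"
    then obtain c \<phi> x where a': "a = (((c, []), \<phi>), x)" "c \<in> Obj C" "\<phi> \<in> Arr delta"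
      "Cod delta \<phi> = FObj S c" "Dom delta \<phi> = Cod delta \<beta>" "x \<in> carrier (Grp F c)"
      by (rule chain_letter0E)
    have "eval_letter (chain_push \<beta> a) = Act T \<beta> (eval_letter a)"
      using T.Act_Comp[of \<phi> \<beta> "\<theta> c x"] a' \<beta> \<theta>_closed by (simp add: eval_letter_def chain_push_def)
    then show "(eval_to (Dom delta \<beta>) \<circ> free_prod_map (chain_index 0 (Dom delta \<beta>)) chain_grp (chain_push \<beta>)) (word_cong (chain_index 0 (Cod delta \<beta>)) chain_grp {} `` {[a]}) =
        (Act T \<beta> \<circ> eval_to (Cod delta \<beta>)) (word_cong (chain_index 0 (Cod delta \<beta>)) chain_grp {} `` {[a]})"
      by (simp add: free_prod_map_letter[OF p a] eval_to_letter[OF a] eval_to_letter[OF letter_hom_letters[OF p a]])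
  qed auto
  then show ?thesis by simp
qed

lemma eval_to_coequal:
  assumes K: "K \<in> carrier (free_prod (chain_index (Suc 0) d) chain_grp)"
  shows "eval_to d (free_prod_map (chain_index 0 d) chain_grp (chain_face 0) K) = eval_to d (free_prod_map (chain_index 0 d) chain_grp (chain_face (Suc 0)) K)"
proof -
  have f: "letter_hom (chain_index (Suc 0) d) chain_grp (chain_index 0 d) chain_grp (chain_face i)" if "i \<le> Suc 0" for i
    using chain_face_hom[OF that] .
  have "(eval_to d \<circ> free_prod_map (chain_index 0 d) chain_grp (chain_face 0)) K = (eval_to d \<circ> free_prod_map (chain_index 0 d) chain_grp (chain_face (Suc 0))) K"
  proof (rule hom_free_prod_unique[OF T_group chain_grp_group _ _ _ K])
    show "eval_to d \<circ> free_prod_map (chain_index 0 d) chain_grp (chain_face 0) \<in> hom (free_prod (chain_index (Suc 0) d) chain_grp) (Grp T d)"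
      "eval_to d \<circ> free_prod_map (chain_index 0 d) chain_grp (chain_face (Suc 0)) \<in> hom (free_prod (chain_index (Suc 0) d) chain_grp) (Grp T d)"
      by (rule hom_compose[OF free_prod_map_hom[OF f] eval_to_hom]; simp)+
    fix a assume a: "a \<in> letters (chain_index (Suc 0) d) chain_grp"
    then obtain c as \<phi> x where a': "a = (((c, as), \<phi>), x)" "(c, as) \<in> nerve C (Suc 0)" "\<phi> \<in> Arr (op_cat delta)"
      "Dom (op_cat delta) \<phi> = FObj S (nerve_vertex C (c, as) (Suc 0))" "Cod (op_cat delta) \<phi> = d" "x \<in> carrier (Grp F c)"
      by (rule chain_letterE)
    note N = C.nerveD[OF a'(2)]
    obtain f where as: "as = [f]" using N(2) by (cases as) auto
    have ff: "f \<in> Arr C" "Dom C f = c" using N(3)[of 0] N(4) by (simp_all add: as)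
    have "eval_letter (chain_face 0 a) = eval_letter (chain_face (Suc 0) a)"
      using \<theta>_Act[OF ff(1)] T.Act_Comp[of "FArr S f" \<phi> "\<theta> c x"] S.FArr_Arr[OF ff(1)] S.Dom_FArr[OF ff(1)] S.Cod_FArr[OF ff(1)]
        a' ff \<theta>_closed[of c x] N(1)
      by (simp add: eval_letter_def chain_face_def as nerve_face_def nerve_vertex_def)
    then show "(eval_to d \<circ> free_prod_map (chain_index 0 d) chain_grp (chain_face 0)) (word_cong (chain_index (Suc 0) d) chain_grp {} `` {[a]}) =
       (eval_to d \<circ> free_prod_map (chain_index 0 d) chain_grp (chain_face (Suc 0))) (word_cong (chain_index (Suc 0) d) chain_grp {} `` {[a]})"
      using letter_hom_letters[OF f a]
      by (simp add: free_prod_map_letter[OF f a] eval_to_letter)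
  qed auto
  then show ?thesis by simp
qed

text \<open>On the letter \<open>((c, \<phi>), x)\<close> both sides give \<open>x\<close> pushed along the lift of \<open>\<phi>\<close>, by naturality of \<open>\<theta>\<close>.\<close>

lemma decomp_eval:
  assumes K: "K \<in> carrier (free_prod (chain_index 0 d) chain_grp)"
  shows "free_prod_map (chain_index 0 d) chain_grp (chain_face 0) (free_prod_map (chain_index (Suc 0) d) chain_grp (append_lift d) K) =
    free_prod_map (chain_index 0 d) chain_grp (at_id d) (decomp d (eval_to d K))"
proof -
  have f: "letter_hom (chain_index (Suc 0) d) chain_grp (chain_index 0 d) chain_grp (chain_face 0)"
    by (rule chain_face_hom) simp
  have "(free_prod_map (chain_index 0 d) chain_grp (chain_face 0) \<circ> free_prod_map (chain_index (Suc 0) d) chain_grp (append_lift d)) K =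
    (free_prod_map (chain_index 0 d) chain_grp (at_id d) \<circ> (decomp d \<circ> eval_to d)) K"
  proof (rule hom_free_prod_unique[OF group_free_prod[OF chain_grp_group] chain_grp_group _ _ _ K])
    show "free_prod_map (chain_index 0 d) chain_grp (chain_face 0) \<circ> free_prod_map (chain_index (Suc 0) d) chain_grp (append_lift d)
        \<in> hom (free_prod (chain_index 0 d) chain_grp) (free_prod (chain_index 0 d) chain_grp)"
      by (rule hom_compose[OF free_prod_map_hom[OF append_lift_hom] free_prod_map_hom[OF f]])
    show "free_prod_map (chain_index 0 d) chain_grp (at_id d) \<circ> (decomp d \<circ> eval_to d)
        \<in> hom (free_prod (chain_index 0 d) chain_grp) (free_prod (chain_index 0 d) chain_grp)"
      by (rule hom_compose[OF hom_compose[OF eval_to_hom decomp_hom] free_prod_map_hom[OF at_id_hom]])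
    fix a assume a: "a \<in> letters (chain_index 0 d) chain_grp"
    then obtain c \<phi> x where a': "a = (((c, []), \<phi>), x)" "c \<in> Obj C" "\<phi> \<in> Arr delta"
      "Cod delta \<phi> = FObj S c" "Dom delta \<phi> = d" "x \<in> carrier (Grp F c)"
      by (rule chain_letter0E)
    let ?l = "lift c \<phi>"
    have l: "?l \<in> Arr C" "Dom C ?l = c" "FArr S ?l = \<phi>" using lift a' by auto
    have t: "Cod C ?l \<in> Obj C" "FObj S (Cod C ?l) = d" "Act F ?l x \<in> carrier (Grp F (Cod C ?l))"
      using C.Cod_Obj[OF l(1)] S.Cod_FArr[OF l(1)] F.Act_hom[OF l(1)] l a' by (auto simp: hom_def)
    have tl: "(Cod C ?l, Act F ?l x) \<in> letters (fibre d) (Grp F)"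
      using t by (simp add: letters_def)
    have "eval_letter a = \<theta> (Cod C ?l) (Act F ?l x)"
      using \<theta>_Act[OF l(1), of x] l a' by (simp add: eval_letter_def)
    then have "decomp d (eval_letter a) = word_cong (fibre d) (Grp F) {} `` {[(Cod C ?l, Act F ?l x)]}"
      using decomp_\<theta>[OF _ t(3)] t by simp
    moreover have "chain_face 0 (append_lift d a) = at_id d (Cod C ?l, Act F ?l x)"
      by (simp add: a'(1) chain_face_def append_lift_def at_id_def nerve_face_def nerve_vertex_def)
    ultimately show "(free_prod_map (chain_index 0 d) chain_grp (chain_face 0) \<circ> free_prod_map (chain_index (Suc 0) d) chain_grp (append_lift d))
          (word_cong (chain_index 0 d) chain_grp {} `` {[a]}) =
        (free_prod_map (chain_index 0 d) chain_grp (at_id d) \<circ> (decomp d \<circ> eval_to d)) (word_cong (chain_index 0 d) chain_grp {} `` {[a]})"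
      by (simp add: free_prod_map_letter[OF append_lift_hom a]
          free_prod_map_letter[OF f letter_hom_letters[OF append_lift_hom a]] eval_to_letter[OF a]
          free_prod_map_letter[OF at_id_hom tl])
  qed auto
  then show ?thesis by simp
qed

theorem contracted_to_extension:
  "contracted_bisimplicial rep_col rep_srow (sgroup_of T) eval_to
     (\<lambda>d y. free_prod_map (chain_index 0 d) chain_grp (at_id d) (decomp d y))
     (\<lambda>d p. free_prod_map (chain_index (Suc p) d) chain_grp (append_lift d))"
proof -
  have sT: "Level (sgroup_of T) = Grp T" "Face (sgroup_of T) n i = Act T (coface n i)"
    "Degen (sgroup_of T) n i = Act T (codegen n i)" for n i by (simp_all add: sgroup_of_def)
  show ?thesis
  proof (intro contracted_bisimplicial.intro contracted_bisimplicial_axioms.intro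
      bisimplicial_replacement simplicial_group_sgroup_of T.group_diagram_axioms,
      unfold sT rep_srow_Face rep_srow_Degen rep_col_simps, goal_cases)
    case (1 d)
    show ?case by (rule eval_to_hom)
  next
    case (2 y d)
    then show ?case by (rule eval_to_surj)
  next
    case (3 x d)
    then show ?case by (rule eval_to_coequal)
  next
    case (4 i q x)
    then show ?case using eval_to_push[of "coface (Suc q) i" x] by (simp add: coface_Arr Dom_Cod_coface)
  next
    case (5 i q x)
    then show ?case using eval_to_push[of "codegen q i" x] by (simp add: codegen_Arr Dom_Cod_codegen)
  next
    case (6 d)
    have "(free_prod_map (chain_index 0 d) chain_grp (at_id d) \<circ> decomp d) \<one>\<^bsub>Grp T d\<^esub> = \<one>\<^bsub>free_prod (chain_index 0 d) chain_grp\<^esub>"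
      by (rule hom_one[OF hom_compose[OF decomp_hom free_prod_map_hom[OF at_id_hom]] T_group group_free_prod[OF chain_grp_group]])
    then show ?case by simp
  next
    case (7 x d p)
    then show ?case using free_prod_map_hom[OF append_lift_hom] by (auto simp: hom_def)
  next
    case (8 d p)
    show ?case
      by (rule hom_one[OF free_prod_map_hom[OF append_lift_hom]]; rule group_free_prod; erule chain_grp_group)
  next
    case (9 x d p)
    show ?case
      by (rule free_prod_map_inverse[OF append_lift_hom chain_face_hom chain_face_append_lift_top 9]) auto
  next
    case (10 i p x d)
    show ?case
      by (rule free_prod_map_comp_eq[OF append_lift_hom chain_face_hom chain_face_hom append_lift_hom chain_face_append_lift 10(2)])
        (use 10(1) in auto)
  next
    case (11 x d)
    then show ?case by (rule decomp_eval)
  qed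
qed

theorem colim_n_iso: "colim_n n C F \<cong> homotopy_group n (sgroup_of T)"
  unfolding colim_n_def
  by (rule contracted_both_iso[OF contracted_to_extension contracted_to_replacement])

end

lemma free_prod_inclusion:
  assumes "i \<in> I" "group (G i)"
  shows "(\<lambda>x. word_cong I G {} `` {[(i, x)]}) \<in> hom (G i) (free_prod I G)"
proof (rule homI)
  interpret group "G i" by (rule assms(2))
  fix x assume x: "x \<in> carrier (G i)"
  then show "word_cong I G {} `` {[(i, x)]} \<in> carrier (free_prod I G)"
    using assms(1) by (intro letter_in_free_prod) (simp add: letters_def)
  fix y assume y: "y \<in> carrier (G i)"
  have l: "(i, x) \<in> letters I G" "(i, y) \<in> letters I G" "(i, x \<otimes>\<^bsub>G i\<^esub> y) \<in> letters I G"
    using x y assms(1) by (simp_all add: letters_def)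
  have "([(i, x), (i, y)], [(i, x \<otimes>\<^bsub>G i\<^esub> y)]) \<in> word_cong I G {}"
    using word_cong.mult[of "[]" I G "[]" i x y] l by simp
  then show "word_cong I G {} `` {[(i, x \<otimes>\<^bsub>G i\<^esub> y)]} =
      word_cong I G {} `` {[(i, x)]} \<otimes>\<^bsub>free_prod I G\<^esub> word_cong I G {} `` {[(i, y)]}"
    unfolding free_prod_def using l by (simp add: amalg_mult_class word_class_eq_iff word_cong.sym)
qed

context opfibred_kan_data
begin

text \<open>In the colimit over \<open>S \<down> d\<close>, each letter is identified with its image at the terminal object of its
  component, which is a letter over the fibre of \<open>d\<close>.\<close>

definition transport :: "nat \<Rightarrow> ('o \<times> delta_arr) \<times> 'g \<Rightarrow> ('o \<times> 'g) list set" where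
  "transport d = (\<lambda>((c, \<phi>), x).
     word_cong (fibre d) (Grp F) {} `` {[(Cod C (lift c \<phi>), Act F (lift c \<phi>) x)]})"

lemma transport_target: "amalg_target (free_prod (fibre d) (Grp F)) (cObj d) cGrp (cRel d) (transport d)"
proof (intro amalg_target.intro amalg_target_axioms.intro cGrp_group group_free_prod, goal_cases)
  case (1 i)
  then show ?case by (simp add: F.Grp_group)
next
  case (2 i)
  then obtain c \<phi> where i: "i = (c, \<phi>)" "c \<in> Obj C" "\<phi> \<in> Arr delta" "Cod delta \<phi> = FObj S c" "Dom delta \<phi> = d"
    by (cases i) (auto simp: cObj_iff)
  note l = lift[OF i(2-4)] and lC = lift_Cod[OF i(2-4)]
  have "Act F (lift c \<phi>) \<in> hom (Grp F c) (Grp F (Cod C (lift c \<phi>)))"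
    using F.Act_hom[of "lift c \<phi>"] l by simp
  from hom_compose[OF this free_prod_inclusion[of "Cod C (lift c \<phi>)" "fibre d" "Grp F"]] lC i(5)
  show ?case by (simp add: i(1) transport_def cGrp_eq comp_def F.Grp_group)
next
  case (3 a b)
  from 3(1) show ?case
  proof (rule cRelE)
    fix f \<phi> x
    assume *: "f \<in> Arr C" "\<phi> \<in> Arr (op_cat delta)" "Dom (op_cat delta) \<phi> = FObj S (Cod C f)" "Cod (op_cat delta) \<phi> = d"
      "x \<in> carrier (Grp F (Dom C f))" "a = ((Dom C f, Comp (op_cat delta) \<phi> (FArr S f)), x)"
      "b = ((Cod C f, \<phi>), Act F f x)"
    then have l: "lift (Cod C f) \<phi> \<in> Arr C" "Dom C (lift (Cod C f) \<phi>) = Cod C f" "FArr S (lift (Cod C f) \<phi>) = \<phi>"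
      using lift[of "Cod C f" \<phi>] C.Cod_Obj by auto
    have "lift (Dom C f) (Comp delta (FArr S f) \<phi>) = Comp C (lift (Cod C f) \<phi>) f"
      using lift_unique[of "Comp C (lift (Cod C f) \<phi>) f"] l *(1)
      by (simp add: C.Comp_Arr C.Dom_Comp S.FArr_Comp)
    moreover have "Act F (Comp C (lift (Cod C f) \<phi>) f) x = Act F (lift (Cod C f) \<phi>) (Act F f x)"
      using l *(1,5) by (intro F.Act_Comp) auto
    ultimately show "transport d a = transport d b"
      using l *(1) by (simp add: *(6,7) transport_def C.Cod_Comp)
  qed
qed

lemma lan_letter:
  assumes "c \<in> Obj C" "\<phi> \<in> Arr delta" "Cod delta \<phi> = FObj S c" "x \<in> carrier (Grp F c)"
  shows "word_cong (cObj (Dom delta \<phi>)) cGrp (cRel (Dom delta \<phi>)) `` {[((c, \<phi>), x)]} =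
    lan_unit C (op_cat delta) S F (Cod C (lift c \<phi>)) (Act F (lift c \<phi>) x)"
proof -
  note l = lift[OF assms(1-3)]
  have "lan_unit C (op_cat delta) S F (Cod C (lift c \<phi>)) (Act F (lift c \<phi>) x) =
      Act (lan C (op_cat delta) S F) \<phi> (lan_unit C (op_cat delta) S F c x)"
    using lan_unit_natural l assms(4) unfolding grp_natural_def grp_pullback_def by auto
  then show ?thesis using Act_lan_unit[of c \<phi> x] assms by simp
qed

lemma lan_generated:
  "carrier (Grp (lan C (op_cat delta) S F) d) \<subseteq>
    generate (Grp (lan C (op_cat delta) S F) d)
      {lan_unit C (op_cat delta) S F c x |c x. c \<in> fibre d \<and> x \<in> carrier (Grp F c)}"
  (is "_ \<subseteq> generate ?L ?U")
proof
  have L: "?L = amalg (cObj d) cGrp (cRel d)" by (rule Grp_lan)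
  have gen: "word_cong (cObj d) cGrp (cRel d) `` {w} \<in> generate ?L ?U" if "w \<in> lists (letters (cObj d) cGrp)" for w
    using that
  proof (induction w)
    case Nil
    then show ?case using generate.one[of ?L ?U] by (simp add: L one_amalg)
  next
    case (Cons a w)
    then have a: "a \<in> letters (cObj d) cGrp" and w: "w \<in> lists (letters (cObj d) cGrp)" by auto
    from a obtain c \<phi> x where a': "a = ((c, \<phi>), x)" "c \<in> Obj C" "\<phi> \<in> Arr delta" "Cod delta \<phi> = FObj S c"
      "Dom delta \<phi> = d" "x \<in> carrier (Grp F c)"
      by (cases a) (auto simp: letters_def cObj_iff cGrp_eq)
    note l = lift[OF a'(2-4)] and lC = lift_Cod[OF a'(2-4)]
    have "Act F (lift c \<phi>) x \<in> carrier (Grp F (Cod C (lift c \<phi>)))"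
      using F.Act_hom[of "lift c \<phi>"] l a'(6) by (auto simp: hom_def)
    with lC a'(5) have "word_cong (cObj d) cGrp (cRel d) `` {[a]} \<in> ?U"
      using lan_letter[OF a'(2-4,6)] a'(1,5) by auto
    then have "word_cong (cObj d) cGrp (cRel d) `` {[a]} \<in> generate ?L ?U" by (rule generate.incl)
    from generate.eng[OF this Cons.IH] show ?case
      using amalg_mult_class[of "[a]" "cObj d" cGrp w "cRel d"] a w by (simp add: L)
  qed
  fix K assume "K \<in> carrier ?L"
  then show "K \<in> generate ?L ?U" unfolding L using gen[unfolded L] by (elim amalg_classE) auto
qed

lemma lan_fibrewise_free:
  "fibrewise_free_extension C S F lift (lan C (op_cat delta) S F) (lan_unit C (op_cat delta) S F)
     (\<lambda>d. amalg_target.amalg_lift (free_prod (fibre d) (Grp F)) (transport d))"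
proof (intro fibrewise_free_extension.intro fibrewise_free_extension_axioms.intro
    opfibred_kan_data_axioms group_diagram_lan lan_unit_natural lan_generated, goal_cases)
  case (1 d)
  show ?case unfolding Grp_lan by (rule amalg_target.amalg_lift_hom[OF transport_target])
next
  case (2 c d x)
  then have c: "c \<in> Obj C" "FObj S c = d" by auto
  have l: "lift c (Ide delta d) = Ide C c"
    using lift_unique[of "Ide C c"] c by (simp add: C.Ide_Arr C.Dom_Ide S.FArr_Ide)
  have "((c, Ide delta d), x) \<in> letters (cObj d) cGrp"
    using letter_in[of c "Ide delta d" d x] c 2(2) by (simp add: Ide_delta)
  then show ?case
    using amalg_target.amalg_lift_class[OF transport_target, of "[((c, Ide delta d), x)]" d]
      amalg_target.word_eval_singleton[OF transport_target, of "((c, Ide delta d), x)" d] c 2(2)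
    by (simp add: lan_unit_def transport_def l C.Cod_Ide F.Act_Ide)
qed

corollary colim_n_iso_lan:
  "colim_n n C F \<cong> homotopy_group n (sgroup_of (lan C (op_cat delta) S F))"
  by (rule fibrewise_free_extension.colim_n_iso[OF lan_fibrewise_free])

end

section \<open>The two instances\<close>

lemma colim_n_delta_iso:
  assumes "group_diagram (op_cat delta) L"
  shows "colim_n n (op_cat delta) L \<cong> homotopy_group n (sgroup_of L)"
proof -
  let ?I = "\<lparr>FObj = (\<lambda>n. n), FArr = (\<lambda>f. f)\<rparr> :: (nat, delta_arr, nat, delta_arr) func"
  interpret L: group_diagram "op_cat delta" L by (rule assms)
  interpret D: category "op_cat delta" by (rule category_op_cat[OF category_delta])
  interpret I: cat_functor "op_cat delta" "op_cat delta" ?I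
    by unfold_locales auto
  interpret opfibred_kan_data "op_cat delta" ?I L "\<lambda>_ \<phi>. \<phi>"
    by unfold_locales auto
  have "fibrewise_free_extension (op_cat delta) ?I L (\<lambda>_ \<phi>. \<phi>) L (\<lambda>_ x. x)
     (\<lambda>d x. word_cong (fibre d) (Grp L) {} `` {[(d, x)]})"
  proof (unfold_locales, goal_cases)
    case 1
    show ?case by (auto simp: grp_natural_def grp_pullback_def hom_def)
  next
    case (2 d)
    show ?case by (auto intro: generate.incl)
  next
    case (3 d)
    show ?case using L.Grp_group[of d] by (intro free_prod_inclusion) auto
  qed auto
  then show ?thesis by (rule fibrewise_free_extension.colim_n_iso)
qed

lemma opfibred_simplices:
  assumes X: "simplicial_set X" and G: "group_diagram (op_cat (simplices X)) \<G>"
  shows "opfibred_kan_data (op_cat (simplices X)) Q_functor \<G>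
    (\<lambda>(n, x) \<alpha>. ((Dom delta \<alpha>, Map X \<alpha> x), \<alpha>, (n, x)))"
proof (intro opfibred_kan_data.intro simplicial_kan_data.intro kan_data_Q[OF X G] opfibred_kan_data_axioms.intro, goal_cases)
  case (1 c \<phi>)
  then show ?case using set_functor.Map_Elts[OF X, of \<phi> "snd c"]
    by (cases c) (simp add: op_cat_def simplices_def Q_functor_def)
next
  case (2 f)
  then have "f \<in> Arr (simplices X)" by (simp add: op_cat_def)
  then show ?case by (rule simplices_ArrE) (simp add: op_cat_def simplices_def Q_functor_def)
qed

theorem mainTheorem5:
  fixes X :: "'x sset"
    and \<G> :: "(nat \<times> 'x, 'x simp_arr, 'g) grp_diagram"
    and n :: nat
  assumes "simplicial_set X"
    and "group_diagram (op_cat (simplices X)) \<G>"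
  shows "colim_n n (op_cat (simplices X)) \<G> \<cong> sset_homology n X \<G> \<and>
    sset_homology n X \<G> \<cong> homotopy_group n (sgroup_of (lan_Q X \<G>))"
proof
  have L: "group_diagram (op_cat delta) (lan_Q X \<G>)"
    unfolding lan_Q_def by (rule kan_data.group_diagram_lan[OF kan_data_Q[OF assms]])
  show H: "sset_homology n X \<G> \<cong> homotopy_group n (sgroup_of (lan_Q X \<G>))"
    unfolding sset_homology_def by (rule colim_n_delta_iso[OF L])
  have "colim_n n (op_cat (simplices X)) \<G> \<cong> homotopy_group n (sgroup_of (lan_Q X \<G>))"
    unfolding lan_Q_def by (rule opfibred_kan_data.colim_n_iso_lan[OF opfibred_simplices[OF assms]])
  also have "\<dots> \<cong> sset_homology n X \<G>"
    by (rule group.iso_sym[OF group_sset_homology[OF assms] H])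
  finally show "colim_n n (op_cat (simplices X)) \<G> \<cong> sset_homology n X \<G>" .
qed

end
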